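(* Let $\Sigma\in\mathbb{R}^{p\times p}$ be positive definite, $\mathbf{X}\in\mathbb{R}^{n\times p}$ with i.i.d. $\mathcal{N}_p(0,\Sigma)$ rows, $\rho_\lambda$ satisfying Condition (R), and $\hat B$ a global minimizer of $Q$ over $\mathbb{D}$. There exist positive constants $C_1=C_1(\Sigma)$, $C_2=C_2(\Sigma)$ and positive constants $c_1,c_2$ such that the following holds. Suppose $n>C_1\,d\log p$, $\lambda\ge C_2\sqrt{(d+1)\log p/n}$ (with $d=d(\Sigma)$), that $\rho_\lambda(\beta_{\min}(\Sigma))\ge a_1\,\rho_\lambda'(0^+)^2/\lambda_{\min}(\Sigma)$ for some $a_1>2$, and that there exists a minimum-trace permutation $\pi_0$ with $\rho_\lambda(\tilde B(\pi_0))/\operatorname{tr}\tilde\Omega(\pi_0)\ge a_2\sqrt{(d+1)\log p/n}$ for some $a_2>0$. Then with probability at least $1-c_1\exp(-c_2\min\{n,(d+1)\log p\})$, for every $\hat\pi\in\hat\Pi$, $$\rho_\lambda(\tilde B(\hat\pi))\lesssim\rho_\lambda(\hat B)\lesssim\rho_\lambda(\tilde B(\pi_0)),$$ where the implicit constants depend only on $a_1,a_2$. If $\rho_\lambda$ is also $\ell_0$-compatible with constant $b'$, then with the same probability $$\|\tilde B(\hat\pi)\|_0\lesssim\lambda_{\min}(\Sigma)\frac{\lambda^2}{\rho_\lambda'(0^+)^2}\|\tilde B(\pi_0)\|_0,$$ with implicit constant depending only on $a_1,a_2,b'$.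
   Context: Setup. $\mathbb{D}$: real $p\times p$ matrices whose directed graph (edge $i\to j$ iff $b_{ij}\ne0$) is acyclic. For a permutation $\pi$, $(P_\pi A)_{ij}=a_{\pi(i)\pi(j)}$; write uniquely $P_\pi\Sigma^{-1}=(I-L)D^{-1}(I-L)^T$ ($L$ strictly lower triangular, $D$ positive diagonal) and set $\tilde B(\pi)=P_{\pi^{-1}}L$, $\tilde\Omega(\pi)=P_{\pi^{-1}}D$, $\tilde\beta_j(\pi)$ its columns. $\mathbb{D}[\pi]=\{B\in\mathbb{D}:P_\pi B\text{ lower triangular}\}$; $\hat\Pi=\{\pi:\hat B\in\mathbb{D}[\pi]\}$. $\rho_\lambda(B)=\sum_{i,j}\rho_\lambda(|b_{ij}|)$; $Q(B)=\frac{1}{2n}\|\mathbf{X}-\mathbf{X}B\|_F^2+\rho_\lambda(B)$. $\beta_{\min}(v)=\min\{|v_i|:v_i\neq0\}$; $d(\Sigma)=\max_{\pi,j}\|\tilde\beta_j(\pi)\|_0$; $\beta_{\min}(\Sigma)=\min_{\pi,j}\beta_{\min}(\tilde\beta_j(\pi))$. A minimum-trace permutation is any $\pi_0\in\arg\min_\pi\operatorname{tr}\tilde\Omega(\pi)$. Condition (R): $\rho_\lambda:[0,\infty)\to[0,\infty)$ concave, nondecreasing, right-differentiable at $0$, $\rho_\lambda(0)=0$, $0<\rho_\lambda'(0^+)<\infty$, and constants $a,b\ge0$ independent of $\lambda$ with $\rho_\lambda(x)\ge\min\{a\lambda x,b\lambda^2\}$. $\rho_\lambda$ is $\ell_0$-compatible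 if there is $b'\ge0$ independent of $\lambda$ with $\rho_\lambda(x)\le b'\lambda^2$ for all $x\ge0$. $X\lesssim Y$ means $X\le aY$ for a constant $a$ independent of $n,\Sigma$. *)

theory Defs
  imports "HOL-Probability.Probability" "Jordan_Normal_Form.Char_Poly"
    "HOL-Combinatorics.Permutations"
begin

definition inv_mat :: "real mat \<Rightarrow> real mat" where
  "inv_mat A = (THE S. S \<in> carrier_mat (dim_row A) (dim_row A) \<and>
      A * S = 1\<^sub>m (dim_row A) \<and> S * A = 1\<^sub>m (dim_row A))"

definition mat_trace :: "real mat \<Rightarrow> real" where
  "mat_trace A = (\<Sum>i<dim_row A. A $$ (i, i))"

definition pos_def :: "nat \<Rightarrow> real mat \<Rightarrow> bool" where
  "pos_def p S \<longleftrightarrow> S \<in> carrier_mat p p \<and> transpose_mat S = S \<and>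
     (\<forall>v \<in> carrier_vec p. v \<noteq> 0\<^sub>v p \<longrightarrow> v \<bullet> (S *\<^sub>v v) > 0)"

text \<open>Smallest eigenvalue (for a symmetric matrix all eigenvalues are real).\<close>
definition lambda_min :: "real mat \<Rightarrow> real" where
  "lambda_min S = Min {k. eigenvalue S k}"

definition perm_mat :: "(nat \<Rightarrow> nat) \<Rightarrow> real mat \<Rightarrow> real mat" where
  "perm_mat \<pi> A = mat (dim_row A) (dim_col A) (\<lambda>(i, j). A $$ (\<pi> i, \<pi> j))"

definition strictly_lower :: "nat \<Rightarrow> real mat \<Rightarrow> bool" where
  "strictly_lower p L \<longleftrightarrow> L \<in> carrier_mat p p \<and> (\<forall>i<p. \<forall>j<p. i \<le> j \<longrightarrow> L $$ (i, j) = 0)"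

definition lower_tri :: "nat \<Rightarrow> real mat \<Rightarrow> bool" where
  "lower_tri p L \<longleftrightarrow> L \<in> carrier_mat p p \<and> (\<forall>i<p. \<forall>j<p. i < j \<longrightarrow> L $$ (i, j) = 0)"

definition pos_diag :: "nat \<Rightarrow> real mat \<Rightarrow> bool" where
  "pos_diag p D \<longleftrightarrow> D \<in> carrier_mat p p \<and> (\<forall>i<p. \<forall>j<p. i \<noteq> j \<longrightarrow> D $$ (i, j) = 0)
      \<and> (\<forall>i<p. D $$ (i, i) > 0)"

definition LD_factor :: "real mat \<Rightarrow> (nat \<Rightarrow> nat) \<Rightarrow> real mat \<times> real mat" where
  "LD_factor S \<pi> = (let p = dim_row S in
     THE (L, D). strictly_lower p L \<and> pos_diag p D \<and>
       perm_mat \<pi> (inv_mat S) = (1\<^sub>m p - L) * inv_mat D * transpose_mat (1\<^sub>m p - L))"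

definition B_tilde :: "real mat \<Rightarrow> (nat \<Rightarrow> nat) \<Rightarrow> real mat" where
  "B_tilde S \<pi> = perm_mat (inv_into UNIV \<pi>) (fst (LD_factor S \<pi>))"

definition Omega_tilde :: "real mat \<Rightarrow> (nat \<Rightarrow> nat) \<Rightarrow> real mat" where
  "Omega_tilde S \<pi> = perm_mat (inv_into UNIV \<pi>) (snd (LD_factor S \<pi>))"

definition l0_mat :: "real mat \<Rightarrow> nat" where
  "l0_mat B = card {(i, j). i < dim_row B \<and> j < dim_col B \<and> B $$ (i, j) \<noteq> 0}"

definition l0_col :: "real mat \<Rightarrow> nat \<Rightarrow> nat" where
  "l0_col B j = card {i. i < dim_row B \<and> B $$ (i, j) \<noteq> 0}"

definition d_Sigma :: "real mat \<Rightarrow> nat" where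
  "d_Sigma S = Max {l0_col (B_tilde S \<pi>) j | \<pi> j. \<pi> permutes {..<dim_row S} \<and> j < dim_row S}"

text \<open>Set of the values \<open>\<beta>_min(\<beta>_j(\<pi>))\<close> over all \<open>\<pi>, j\<close> with \<open>\<beta>_j(\<pi>) \<noteq> 0\<close>
  (for a zero column \<open>\<beta>_min\<close> is \<open>min \<emptyset> = +\<infinity>\<close>, which does not affect the minimum).\<close>
definition beta_min_vec :: "nat \<Rightarrow> (nat \<Rightarrow> real) \<Rightarrow> real" where
  "beta_min_vec p v = Min {\<bar>v i\<bar> | i. i < p \<and> v i \<noteq> 0}"

definition beta_min_set :: "real mat \<Rightarrow> real set" where
  "beta_min_set S = {beta_min_vec (dim_row S) (\<lambda>i. B_tilde S \<pi> $$ (i, j)) | \<pi> j.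
      \<pi> permutes {..<dim_row S} \<and> j < dim_row S \<and> (\<exists>i < dim_row S. B_tilde S \<pi> $$ (i, j) \<noteq> 0)}"

definition beta_min_Sigma :: "real mat \<Rightarrow> real" where
  "beta_min_Sigma S = Min (beta_min_set S)"

definition min_trace_perm :: "real mat \<Rightarrow> (nat \<Rightarrow> nat) \<Rightarrow> bool" where
  "min_trace_perm S \<pi>0 \<longleftrightarrow> \<pi>0 permutes {..<dim_row S} \<and>
     (\<forall>\<pi>. \<pi> permutes {..<dim_row S} \<longrightarrow> mat_trace (Omega_tilde S \<pi>0) \<le> mat_trace (Omega_tilde S \<pi>))"

definition DAG :: "nat \<Rightarrow> real mat set" where
  "DAG p = {B. B \<in> carrier_mat p p \<and> acyclic {(i, j). i < p \<and> j < p \<and> B $$ (i, j) \<noteq> 0}}"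

definition DAG_perm :: "nat \<Rightarrow> (nat \<Rightarrow> nat) \<Rightarrow> real mat set" where
  "DAG_perm p \<pi> = {B \<in> DAG p. lower_tri p (perm_mat \<pi> B)}"

definition Pi_hat :: "nat \<Rightarrow> real mat \<Rightarrow> (nat \<Rightarrow> nat) set" where
  "Pi_hat p Bh = {\<pi>. \<pi> permutes {..<p} \<and> Bh \<in> DAG_perm p \<pi>}"

definition rho_d0 :: "(real \<Rightarrow> real \<Rightarrow> real) \<Rightarrow> real \<Rightarrow> real" where
  "rho_d0 rho lam = (THE D. (rho lam has_real_derivative D) (at_right 0))"

definition condition_R :: "(real \<Rightarrow> real \<Rightarrow> real) \<Rightarrow> bool" where
  "condition_R rho \<longleftrightarrow>
     (\<forall>lam>0. concave_on {0..} (rho lam) \<and> mono_on {0..} (rho lam) \<and> (\<forall>x\<ge>0. rho lam x \<ge> 0)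
        \<and> rho lam 0 = 0 \<and> (\<exists>D. (rho lam has_real_derivative D) (at_right 0)) \<and> rho_d0 rho lam > 0)
     \<and> (\<exists>a\<ge>0. \<exists>b\<ge>0. \<forall>lam>0. \<forall>x\<ge>0. rho lam x \<ge> min (a * lam * x) (b * lam\<^sup>2))"

definition l0_compatible :: "(real \<Rightarrow> real \<Rightarrow> real) \<Rightarrow> real \<Rightarrow> bool" where
  "l0_compatible rho b' \<longleftrightarrow> b' \<ge> 0 \<and> (\<forall>lam>0. \<forall>x\<ge>0. rho lam x \<le> b' * lam\<^sup>2)"

definition pen :: "(real \<Rightarrow> real \<Rightarrow> real) \<Rightarrow> real \<Rightarrow> real mat \<Rightarrow> real" where
  "pen rho lam B = (\<Sum>i<dim_row B. \<Sum>j<dim_col B. rho lam \<bar>B $$ (i, j)\<bar>)"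

definition Qfun :: "(real \<Rightarrow> real \<Rightarrow> real) \<Rightarrow> real \<Rightarrow> real mat \<Rightarrow> real mat \<Rightarrow> real" where
  "Qfun rho lam X B = 1 / (2 * real (dim_row X)) *
      (\<Sum>i<dim_row X. \<Sum>j<dim_col X. ((X - X * B) $$ (i, j))\<^sup>2) + pen rho lam B"

definition global_min_Q :: "(real \<Rightarrow> real \<Rightarrow> real) \<Rightarrow> real \<Rightarrow> real mat \<Rightarrow> real mat \<Rightarrow> bool" where
  "global_min_Q rho lam X Bh \<longleftrightarrow> Bh \<in> DAG (dim_col X) \<and>
      (\<forall>B \<in> DAG (dim_col X). Qfun rho lam X Bh \<le> Qfun rho lam X B)"

definition mvn_density :: "real mat \<Rightarrow> (nat \<Rightarrow> real) \<Rightarrow> real" where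
  "mvn_density S x = (let p = dim_row S; v = vec p x in
     (2 * pi) powr (- real p / 2) * det S powr (- 1 / 2) * exp (- (v \<bullet> (inv_mat S *\<^sub>v v)) / 2))"

text \<open>The sample space is the space of data matrices itself: \<open>\<omega> i j = X_{ij}\<close>
  (\<open>i < n\<close>, \<open>j < p\<close>); rows are i.i.d. \<open>N_p(0,\<Sigma>)\<close> under \<open>M\<close>.\<close>
definition gaussian_design :: "(nat \<Rightarrow> nat \<Rightarrow> real) measure \<Rightarrow> nat \<Rightarrow> real mat \<Rightarrow> bool" where
  "gaussian_design M n S \<longleftrightarrow> (let p = dim_row S in prob_space M \<and>
     prob_space.indep_vars M (\<lambda>_. PiM {..<p} (\<lambda>_. lborel)) (\<lambda>i \<omega>. restrict (\<omega> i) {..<p}) {..<n} \<and>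
     (\<forall>i<n. distributed M (PiM {..<p} (\<lambda>_. lborel)) (\<lambda>\<omega>. restrict (\<omega> i) {..<p})
                 (\<lambda>x. ennreal (mvn_density S x))))"

definition data_mat :: "nat \<Rightarrow> nat \<Rightarrow> (nat \<Rightarrow> nat \<Rightarrow> real) \<Rightarrow> real mat" where
  "data_mat n p \<omega> = mat n p (\<lambda>(i, j). \<omega> i j)"

end

theory Submission
  imports Defs
begin

text \<open>
  Write \<open>H\<close> for the empirical covariance, \<open>A[u] = u\<^sup>T A u\<close>, and \<open>r\<^sub>j(\<pi>)\<close> for the residual vector
  \<open>e\<^sub>j - \<beta>\<^sub>j(\<pi>)\<close>. A population regression column is determined by its support, so there are at most
  \<open>p (p + 1)\<^sup>d\<close> residual vectors, and a union bound over chi-square tails gives \<open>\<bar>H[v] - \<Sigma>[v]\<bar> \<le> \<tau> \<Sigma>[v]\<close>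
  for all of them simultaneously, with \<open>\<tau> = 23 sqrt ((d + 1) log p / n)\<close> free of \<open>\<Sigma>\<close>. Including the vectors
  \<open>e\<^sub>i + e\<^sub>j\<close> also controls \<open>H - \<Sigma>\<close> entrywise, up to a factor depending on \<open>\<Sigma>\<close>. Since \<open>r\<^sub>j(\<pi>)\<close> is
  \<open>\<Sigma>\<close>-orthogonal to every admissible perturbation \<open>\<Delta>\<close>, the \<open>\<Sigma>\<close>-dependent error is of order
  \<open>\<tau> \<parallel>\<Delta>\<parallel>\<close> only; completing the square against \<open>\<lambda>\<^sub>m\<^sub>i\<^sub>n \<parallel>\<Delta>\<parallel>\<^sup>2\<close> leaves \<open>O(\<tau>\<^sup>2)\<close>, which
  \<open>n > C\<^sub>1 d log p\<close> absorbs into \<open>\<tau> tr \<Omega>(\<pi>\<^sub>0)\<close>.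

  For the first inequality the minimiser is compared with its midpoint to the population matrix with the same
  ordering. If the sampling error is small against the penalty slope, the signal condition bounds the loss of
  penalty by a fixed fraction of \<open>\<rho>(B(\<pi>))\<close>; otherwise \<open>\<parallel>\<Delta>\<parallel>\<close> is below half the smallest coefficient.
  For the second, the minimiser is compared with \<open>B(\<pi>\<^sub>0)\<close>: trace minimality removes the population
  losses, and the hypothesis on \<open>a\<^sub>2\<close> turns the remaining \<open>\<tau> tr \<Omega>(\<pi>\<^sub>0)\<close> into \<open>\<rho>(B(\<pi>\<^sub>0))\<close>.
\<close>

section \<open>Sums of squares of Gaussian variables\<close>

lemma cosh_ge_quartic:
  fixes x :: real
  shows "1 + x\<^sup>2 / 2 + x ^ 4 / 24 \<le> cosh x"
proof -
  have "(\<lambda>n. if n \<in> {0, 2, 4} then (if even n then x ^ n /\<^sub>R fact n else 0) else 0) sums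
      (\<Sum>n\<in>{0, 2, 4}. if even n then x ^ n /\<^sub>R fact n else 0)"
    by (rule sums_If_finite_set) simp
  moreover have "(\<Sum>n\<in>{0, 2, 4::nat}. if even n then x ^ n /\<^sub>R fact n else 0) = 1 + x\<^sup>2 / 2 + x ^ 4 / 24"
    by (simp add: fact_numeral)
  ultimately have "(\<lambda>n. if n \<in> {0, 2, 4} then (if even n then x ^ n /\<^sub>R fact n else 0) else 0) sums
      (1 + x\<^sup>2 / 2 + x ^ 4 / 24)"
    by simp
  then show ?thesis
    by (rule sums_le[rotated, OF _ cosh_converges]) (auto simp: zero_le_even_power)
qed

text \<open>The weights \<open>4 / 3\<close> and \<open>1 / 12\<close> reproduce the quadratic term
  and cancel the quartic one; every later coefficient \<open>2 ^ n / 12 - 4 / 3\<close> is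
  nonnegative since \<open>2 ^ n\<close> is then at least 16. Under an expectation this bounds a
  second moment from below by the moment generating function at \<open>t\<close> and
  \<open>2 * t\<close>.\<close>

lemma cosh_quadratic_bound:
  fixes x :: real
  shows "4 / 3 * (cosh x - 1) - 1 / 12 * (cosh (2 * x) - 1) \<le> x\<^sup>2 / 2"
proof -
  let ?c = "\<lambda>x n. if even n then x ^ n /\<^sub>R fact n else (0::real)"
  let ?f = "\<lambda>n. 1 / 12 * ?c (2 * x) n - 4 / 3 * ?c x n"
  have f: "?f sums (1 / 12 * cosh (2 * x) - 4 / 3 * cosh x)"
    by (intro sums_diff sums_mult cosh_converges)
  have "(\<lambda>n. if n \<in> {0, 2} then ?f n else 0) sums (\<Sum>n\<in>{0, 2}. ?f n)"
    by (rule sums_If_finite_set) simp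
  moreover have "(\<Sum>n\<in>{0, 2::nat}. ?f n) = - 5 / 4 - x\<^sup>2 / 2"
    by (simp add: power_mult_distrib)
  ultimately have g: "(\<lambda>n. if n \<in> {0, 2} then ?f n else 0) sums (- 5 / 4 - x\<^sup>2 / 2)"
    by simp
  have "(if n \<in> {0, 2} then ?f n else 0) \<le> ?f n" for n
  proof (cases "even n \<and> n \<ge> 4")
    case True
    have "(2::real) ^ 4 \<le> 2 ^ n"
      using True by (intro power_increasing) auto
    moreover have "x ^ n / fact n \<ge> 0"
      using True by (simp add: zero_le_even_power)
    ultimately have "0 \<le> (2 ^ n / 12 - 4 / 3) * (x ^ n / fact n)"
      by (intro mult_nonneg_nonneg) auto
    also have "(2 ^ n / 12 - 4 / 3) * (x ^ n / fact n) = ?f n"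
      using True by (simp only: if_True power_mult_distrib real_scaleR_def divide_inverse) (simp add: algebra_simps)
    finally show ?thesis
      by (simp only: if_cancel split: if_split) simp
  next
    case False
    then have "n \<in> {0, 2} \<or> odd n"
      by (auto elim!: evenE)
    then show ?thesis by auto
  qed
  from sums_le[OF this g f] show ?thesis
    by argo
qed

section \<open>Exponential moments of Gaussian variables and of their squares\<close>

lemma std_normal_mgf:
  "(\<integral>\<^sup>+g. ennreal (std_normal_density g * exp (a * g)) \<partial>lborel) = ennreal (exp (a\<^sup>2 / 2))"
proof -
  have "std_normal_density g * exp (a * g) = exp (a\<^sup>2 / 2) * normal_density a 1 g" for g
  proof -
    have "- g\<^sup>2 / 2 + a * g = a\<^sup>2 / 2 + - (g - a)\<^sup>2 / 2"
      by (simp add: power2_eq_square field_simps)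
    then have "exp (- g\<^sup>2 / 2) * exp (a * g) = exp (a\<^sup>2 / 2) * exp (- (g - a)\<^sup>2 / 2)"
      by (metis exp_add)
    then show ?thesis
      by (simp add: normal_density_def)
  qed
  then have "(\<integral>\<^sup>+g. ennreal (std_normal_density g * exp (a * g)) \<partial>lborel)
      = (\<integral>\<^sup>+g. ennreal (exp (a\<^sup>2 / 2)) * ennreal (normal_density a 1 g) \<partial>lborel)"
    by (simp add: ennreal_mult')
  also have "\<dots> = ennreal (exp (a\<^sup>2 / 2)) * (\<integral>\<^sup>+g. ennreal (normal_density a 1 g) \<partial>lborel)"
    by (rule nn_integral_cmult) simp
  also have "(\<integral>\<^sup>+g. ennreal (normal_density a 1 g) \<partial>lborel) = 1"
    by (simp add: nn_integral_eq_integral)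
  finally show ?thesis by simp
qed

text \<open>Up to the factor \<open>s\<close>, the tilted density is the centred normal density of
  variance \<open>1 / (1 - 2 * u)\<close>, whose total mass is one.\<close>

lemma std_normal_square_mgf:
  assumes "u < 1 / 2"
  shows "(\<integral>\<^sup>+g. ennreal (std_normal_density g * exp (u * g\<^sup>2)) \<partial>lborel) = ennreal (1 / sqrt (1 - 2 * u))"
proof -
  define s where "s = 1 / sqrt (1 - 2 * u)"
  have s: "s > 0" "s\<^sup>2 = 1 / (1 - 2 * u)"
    using assms by (simp_all add: s_def power_divide)
  have "std_normal_density g * exp (u * g\<^sup>2) = s * normal_density 0 s g" for g
  proof -
    have "- g\<^sup>2 / 2 + u * g\<^sup>2 = - g\<^sup>2 / (2 * s\<^sup>2)"
      using assms by (simp add: s field_simps)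
    then have "exp (- g\<^sup>2 / 2) * exp (u * g\<^sup>2) = exp (- g\<^sup>2 / (2 * s\<^sup>2))"
      by (metis exp_add)
    then show ?thesis
      using s(1) by (simp add: normal_density_def real_sqrt_mult)
  qed
  then have "(\<integral>\<^sup>+g. ennreal (std_normal_density g * exp (u * g\<^sup>2)) \<partial>lborel)
      = (\<integral>\<^sup>+g. ennreal s * ennreal (normal_density 0 s g) \<partial>lborel)"
    using s(1) by (simp add: ennreal_mult')
  also have "\<dots> = ennreal s * (\<integral>\<^sup>+g. ennreal (normal_density 0 s g) \<partial>lborel)"
    by (rule nn_integral_cmult) simp
  also have "(\<integral>\<^sup>+g. ennreal (normal_density 0 s g) \<partial>lborel) = 1"
    using s(1) by (simp add: nn_integral_eq_integral)
  finally show ?thesis by (simp add: s_def)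
qed

context prob_space
begin

text \<open>Linearising the square by an independent standard normal \<open>g\<close>:
  \<open>exp (\<theta> y\<^sup>2) = E exp (sqrt (2 \<theta>) g y)\<close>, and the two expectations are exchanged.\<close>
lemma square_mgf_upper:
  assumes [measurable]: "Y \<in> borel_measurable M"
    and mgf: "\<And>t. (\<integral>\<^sup>+\<omega>. ennreal (exp (t * Y \<omega>)) \<partial>M) = ennreal (exp (t\<^sup>2 * v / 2))"
    and "0 \<le> \<theta>" "0 \<le> v" "\<theta> * v \<le> 1 / 4"
  shows "(\<integral>\<^sup>+\<omega>. ennreal (exp (\<theta> * (Y \<omega>)\<^sup>2)) \<partial>M) \<le> ennreal (exp (\<theta> * v + 4 * (\<theta> * v)\<^sup>2))"
proof -
  interpret pair_sigma_finite M lborel ..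
  have "ennreal (exp (\<theta> * y\<^sup>2)) =
      (\<integral>\<^sup>+g. ennreal (std_normal_density g * exp ((sqrt (2 * \<theta>) * g) * y)) \<partial>lborel)" for y
    using std_normal_mgf[of "sqrt (2 * \<theta>) * y"] assms(3)
    by (simp add: power_mult_distrib mult_ac)
  then have "(\<integral>\<^sup>+\<omega>. ennreal (exp (\<theta> * (Y \<omega>)\<^sup>2)) \<partial>M) =
      (\<integral>\<^sup>+\<omega>. \<integral>\<^sup>+g. ennreal (std_normal_density g * exp ((sqrt (2 * \<theta>) * g) * Y \<omega>)) \<partial>lborel \<partial>M)"
    by simp
  also have "\<dots> = (\<integral>\<^sup>+g. \<integral>\<^sup>+\<omega>. ennreal (std_normal_density g * exp ((sqrt (2 * \<theta>) * g) * Y \<omega>)) \<partial>M \<partial>lborel)"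
    by (rule Fubini'[symmetric]) measurable
  also have "\<dots> = (\<integral>\<^sup>+g. ennreal (std_normal_density g) *
      (\<integral>\<^sup>+\<omega>. ennreal (exp ((sqrt (2 * \<theta>) * g) * Y \<omega>)) \<partial>M) \<partial>lborel)"
    by (subst nn_integral_cmult[symmetric]) (simp_all add: ennreal_mult')
  also have "\<dots> = (\<integral>\<^sup>+g. ennreal (std_normal_density g * exp (\<theta> * v * g\<^sup>2)) \<partial>lborel)"
    using assms(3) by (subst mgf) (simp add: ennreal_mult' power_mult_distrib mult_ac)
  also have "\<dots> = ennreal (1 / sqrt (1 - 2 * (\<theta> * v)))"
    using assms(5) by (intro std_normal_square_mgf) simp
  also have "\<dots> \<le> ennreal (exp (\<theta> * v + 4 * (\<theta> * v)\<^sup>2))"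
  proof (rule ennreal_leI)
    \<comment> \<open>The lower bound for the logarithm holds for arguments up to 1/2, which is what
      \<open>\<theta> * v \<le> 1 / 4\<close> provides.\<close>
    have "- (2 * (\<theta> * v)) - 2 * (2 * (\<theta> * v))\<^sup>2 \<le> ln (1 - 2 * (\<theta> * v))"
      using assms by (intro ln_one_minus_pos_lower_bound) auto
    then have "- ln (1 - 2 * (\<theta> * v)) / 2 \<le> \<theta> * v + 4 * (\<theta> * v)\<^sup>2"
      by (simp add: power2_eq_square)
    moreover have "1 / sqrt (1 - 2 * (\<theta> * v)) = exp (- ln (1 - 2 * (\<theta> * v)) / 2)"
      using assms(5) by (simp add: exp_minus inverse_eq_divide ln_sqrt[symmetric])
    ultimately show "1 / sqrt (1 - 2 * (\<theta> * v)) \<le> exp (\<theta> * v + 4 * (\<theta> * v)\<^sup>2)"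
      by simp
  qed
  finally show ?thesis .
qed

text \<open>A negative exponent cannot be linearised with a real multiple of \<open>g\<close>, so
  \<open>exp (- z) \<le> 1 - z + z^2 / 2\<close> is integrated instead. The second and fourth
  moments that appear are not computed but bounded through the expectation of
  \<open>cosh (t * Y)\<close>.\<close>

lemma square_mgf_lower:
  assumes [measurable]: "Y \<in> borel_measurable M"
    and mgf: "\<And>t. (\<integral>\<^sup>+\<omega>. ennreal (exp (t * Y \<omega>)) \<partial>M) = ennreal (exp (t\<^sup>2 * v / 2))"
    and \<theta>: "0 \<le> \<theta>" and v: "0 < v" and \<theta>v: "\<theta> * v \<le> 1 / 4"
  shows "(\<integral>\<^sup>+\<omega>. ennreal (exp (- \<theta> * (Y \<omega>)\<^sup>2)) \<partial>M) \<le> ennreal (exp (- (\<theta> * v) + 22 * (\<theta> * v)\<^sup>2))"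
proof -
  have i: "integrable M (\<lambda>\<omega>. exp (t * Y \<omega>))" and e: "expectation (\<lambda>\<omega>. exp (t * Y \<omega>)) = exp (t\<^sup>2 * v / 2)" for t
  proof -
    show "integrable M (\<lambda>\<omega>. exp (t * Y \<omega>))"
      by (rule integrableI_nonneg) (simp_all add: mgf)
    then show "expectation (\<lambda>\<omega>. exp (t * Y \<omega>)) = exp (t\<^sup>2 * v / 2)"
      using mgf[of t] by (subst (asm) nn_integral_eq_integral) simp_all
  qed
  have ic: "integrable M (\<lambda>\<omega>. cosh (t * Y \<omega>))"
    and ec: "expectation (\<lambda>\<omega>. cosh (t * Y \<omega>)) = exp (t\<^sup>2 * v / 2)" for t
  proof -
    have c: "cosh (t * Y \<omega>) = (exp (t * Y \<omega>) + exp ((- t) * Y \<omega>)) / 2" for \<omega>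
      by (simp add: cosh_field_def)
    show "integrable M (\<lambda>\<omega>. cosh (t * Y \<omega>))"
      unfolding c by (intro integrable_divide_zero Bochner_Integration.integrable_add i)
    show "expectation (\<lambda>\<omega>. cosh (t * Y \<omega>)) = exp (t\<^sup>2 * v / 2)"
      unfolding c using i[of t] i[of "- t"] e[of t] e[of "- t"]
      by (simp add: Bochner_Integration.integral_add)
  qed
  define u where "u = \<theta> * v"
  have u: "0 \<le> u" "u \<le> 1 / 4"
    using assms by (simp_all add: u_def)
  have i4: "integrable M (\<lambda>\<omega>. (Y \<omega>) ^ 4)"
  proof (rule Bochner_Integration.integrable_bound)
    show "integrable M (\<lambda>\<omega>. 24 * cosh (1 * Y \<omega>))"
      by (intro integrable_mult_right ic)
    have "(Y \<omega>) ^ 4 \<le> 24 * cosh (1 * Y \<omega>)" for \<omega>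
      using cosh_ge_quartic[of "Y \<omega>"] zero_le_power2[of "Y \<omega>"] by (simp only: mult_1)
    then show "AE \<omega> in M. norm ((Y \<omega>) ^ 4) \<le> norm (24 * cosh (1 * Y \<omega>))"
      by (intro AE_I2) simp
  qed simp
  have i2: "integrable M (\<lambda>\<omega>. (Y \<omega>)\<^sup>2)"
  proof (rule Bochner_Integration.integrable_bound)
    show "integrable M (\<lambda>\<omega>. 2 * cosh (1 * Y \<omega>))"
      by (intro integrable_mult_right ic)
    have "(Y \<omega>)\<^sup>2 \<le> 2 * cosh (1 * Y \<omega>)" for \<omega>
    proof -
      have "0 \<le> (Y \<omega>) ^ 4" by simp
      then show ?thesis
        using cosh_ge_quartic[of "Y \<omega>"] unfolding mult_1 by linarith
    qed
    then have "norm ((Y \<omega>)\<^sup>2) \<le> norm (2 * cosh (1 * Y \<omega>))" for \<omega>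
      unfolding real_norm_def abs_of_nonneg[OF zero_le_power2] by (rule order_trans[OF _ abs_ge_self])
    then show "AE \<omega> in M. norm ((Y \<omega>)\<^sup>2) \<le> norm (2 * cosh (1 * Y \<omega>))"
      by (rule AE_I2)
  qed simp
  \<comment> \<open>With \<open>t^2 * v = 1\<close> the expectation of
    \<open>cosh (t * Y) - 1\<close> is \<open>exp (1 / 2) - 1\<close>, which is at most 3/4;
    multiplication by 24 gives 18.\<close>
  have m4: "expectation (\<lambda>\<omega>. (Y \<omega>) ^ 4) \<le> 18 * v\<^sup>2"
  proof -
    define t where "t = 1 / sqrt v"
    have "t\<^sup>2 = 1 / v"
      using v by (simp add: t_def power_divide)
    moreover have "t ^ 4 = (t\<^sup>2)\<^sup>2"
      by (simp flip: power_mult)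
    ultimately have t: "t\<^sup>2 * v = 1" "t ^ 4 = 1 / v\<^sup>2"
      using v by (simp_all add: power_divide)
    have "expectation (\<lambda>\<omega>. t ^ 4 * (Y \<omega>) ^ 4 / 24) \<le> expectation (\<lambda>\<omega>. cosh (t * Y \<omega>) - 1)"
    proof (rule integral_mono)
      show "t ^ 4 * (Y \<omega>) ^ 4 / 24 \<le> cosh (t * Y \<omega>) - 1" for \<omega>
        using cosh_ge_quartic[of "t * Y \<omega>"] zero_le_power2[of "t * Y \<omega>"]
        unfolding power_mult_distrib by linarith
    qed (auto intro!: i4 ic)
    also have "\<dots> = exp (1 / 2) - 1"
      using ic[of t] by (simp add: ec t prob_space)
    also have "exp (1 / 2 :: real) \<le> 1 + 1 / 2 + (1 / 2)\<^sup>2"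
      by (rule exp_bound) auto
    finally show ?thesis
      using v by (simp add: t field_simps power2_eq_square)
  qed
  \<comment> \<open>The choice \<open>t^2 = 2 * \<theta>\<close> turns the two generating functions
    into \<open>exp u\<close> and \<open>exp (4 * u)\<close>; the quadratic bound for the latter is
    where \<open>u \<le> 1 / 4\<close> enters.\<close>
  have m2: "u - 4 / 3 * u\<^sup>2 \<le> expectation (\<lambda>\<omega>. \<theta> * (Y \<omega>)\<^sup>2)"
  proof -
    define t where "t = sqrt (2 * \<theta>)"
    have t: "t\<^sup>2 = 2 * \<theta>" "(2 * t)\<^sup>2 = 8 * \<theta>"
      using \<theta> by (simp_all add: t_def power_mult_distrib)
    define E where "E = exp u"
    have "1 + u \<le> E"
      unfolding E_def by (rule exp_ge_add_one_self)
    moreover have "exp (4 * u) \<le> 1 + 4 * u + 16 * u\<^sup>2"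
      using exp_bound[of "4 * u"] u by (simp add: power_mult_distrib)
    ultimately have "u - 4 / 3 * u\<^sup>2 \<le> 4 / 3 * (E - 1) - 1 / 12 * (exp (4 * u) - 1)"
      by argo
    also have "\<dots> = 4 / 3 * (exp (t\<^sup>2 * v / 2) - 1) - 1 / 12 * (exp ((2 * t)\<^sup>2 * v / 2) - 1)"
      unfolding t E_def by (simp add: u_def)
    also have "\<dots> = expectation (\<lambda>\<omega>. 4 / 3 * (cosh (t * Y \<omega>) - 1)) - expectation (\<lambda>\<omega>. 1 / 12 * (cosh ((2 * t) * Y \<omega>) - 1))"
      unfolding integral_mult_right_zero Bochner_Integration.integral_diff[OF ic integrable_const] ec
      by (simp add: prob_space)
    also have "\<dots> = expectation (\<lambda>\<omega>. 4 / 3 * (cosh (t * Y \<omega>) - 1) - 1 / 12 * (cosh ((2 * t) * Y \<omega>) - 1))"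
      by (intro Bochner_Integration.integral_diff[symmetric] ic Bochner_Integration.integrable_diff
        integrable_mult_right integrable_const)
    also have "\<dots> \<le> expectation (\<lambda>\<omega>. \<theta> * (Y \<omega>)\<^sup>2)"
    proof (rule integral_mono)
      show "4 / 3 * (cosh (t * Y \<omega>) - 1) - 1 / 12 * (cosh ((2 * t) * Y \<omega>) - 1) \<le> \<theta> * (Y \<omega>)\<^sup>2" for \<omega>
        using cosh_quadratic_bound[of "t * Y \<omega>"] by (simp add: power_mult_distrib t mult.assoc)
    qed (intro i2 ic Bochner_Integration.integrable_diff integrable_mult_right integrable_const)+
    finally show ?thesis .
  qed
  have exp_le: "exp (- \<theta> * y\<^sup>2) \<le> 1 - \<theta> * y\<^sup>2 + \<theta>\<^sup>2 * y ^ 4 / 2" for y :: real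
  proof -
    define z where "z = \<theta> * y\<^sup>2"
    have z: "z \<ge> 0" using \<theta> by (simp add: z_def)
    have "((\<lambda>z. 1 - z + z\<^sup>2 / 2 - exp (- z)) has_real_derivative (- 1 + x + exp (- x))) (at x)" for x :: real
      by (auto intro!: derivative_eq_intros)
    moreover have "- 1 + x + exp (- x) \<ge> 0" for x :: real
      using exp_ge_add_one_self[of "- x"] by argo
    ultimately have "1 - 0 + 0\<^sup>2 / 2 - exp (- 0) \<le> 1 - z + z\<^sup>2 / 2 - exp (- z)"
      using z by (intro DERIV_nonneg_imp_nondecreasing[of 0 z "\<lambda>z. 1 - z + z\<^sup>2 / 2 - exp (- z)"]) blast+
    then show ?thesis
      by (simp add: z_def power_mult_distrib flip: power_mult)
  qed
  from exp_le have "(\<integral>\<^sup>+\<omega>. ennreal (exp (- \<theta> * (Y \<omega>)\<^sup>2)) \<partial>M) \<le>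
      (\<integral>\<^sup>+\<omega>. ennreal (1 - \<theta> * (Y \<omega>)\<^sup>2 + \<theta>\<^sup>2 * (Y \<omega>) ^ 4 / 2) \<partial>M)"
    by (intro nn_integral_mono ennreal_leI)
  also have "\<dots> = ennreal (expectation (\<lambda>\<omega>. 1 - \<theta> * (Y \<omega>)\<^sup>2 + \<theta>\<^sup>2 * (Y \<omega>) ^ 4 / 2))"
    by (rule nn_integral_eq_integral)
      (intro i2 i4 Bochner_Integration.integrable_add Bochner_Integration.integrable_diff
        integrable_mult_right integrable_divide_zero integrable_const AE_I2
        order_trans[OF exp_ge_zero exp_le])+
  also have "\<dots> \<le> ennreal (exp (- u + 22 * u\<^sup>2))"
  proof (rule ennreal_leI)
    have "expectation (\<lambda>\<omega>. 1 - \<theta> * (Y \<omega>)\<^sup>2 + \<theta>\<^sup>2 * (Y \<omega>) ^ 4 / 2) =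
        1 - expectation (\<lambda>\<omega>. \<theta> * (Y \<omega>)\<^sup>2) + \<theta>\<^sup>2 * expectation (\<lambda>\<omega>. (Y \<omega>) ^ 4) / 2"
      using i2 i4 by (simp add: prob_space)
    also have "\<dots> \<le> 1 - (u - 4 / 3 * u\<^sup>2) + \<theta>\<^sup>2 * (18 * v\<^sup>2) / 2"
      using m2 m4 by (intro add_mono diff_mono divide_right_mono mult_left_mono) auto
    also have "\<dots> \<le> 1 + (- u + 22 * u\<^sup>2)"
      by (simp add: u_def power_mult_distrib)
    also have "\<dots> \<le> exp (- u + 22 * u\<^sup>2)"
      by (rule exp_ge_add_one_self)
    finally show "expectation (\<lambda>\<omega>. 1 - \<theta> * (Y \<omega>)\<^sup>2 + \<theta>\<^sup>2 * (Y \<omega>) ^ 4 / 2) \<le> exp (- u + 22 * u\<^sup>2)" .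
  qed
  finally show ?thesis
    by (simp add: u_def)
qed

end

text \<open>Chernoff's method with \<open>\<theta> = \<tau> / 44 / v\<close>. This value minimises
  the lower-tail exponent \<open>22 * (\<theta> * v)^2 - \<theta> * v * \<tau>\<close>, whose
  minimum \<open>- \<tau>^2 / 88\<close> is below \<open>- \<tau>^2 / 100\<close>; it also serves
  the upper tail, where the quadratic coefficient is only 4.\<close>

lemma square_sum_tail:
  fixes Y :: "nat \<Rightarrow> 'a \<Rightarrow> real"
  assumes "prob_space M"
    and indep: "prob_space.indep_vars M (\<lambda>_. borel) Y {..<n}"
    and mgf: "\<And>i t. i < n \<Longrightarrow> (\<integral>\<^sup>+\<omega>. ennreal (exp (t * Y i \<omega>)) \<partial>M) = ennreal (exp (t\<^sup>2 * v / 2))"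
    and v: "0 < v" and \<tau>: "0 \<le> \<tau>" "\<tau> \<le> 1"
  shows "measure M {\<omega> \<in> space M. real n * v * (1 + \<tau>) < (\<Sum>i<n. (Y i \<omega>)\<^sup>2)} \<le> exp (- real n * \<tau>\<^sup>2 / 100)" (is ?upper)
    and "measure M {\<omega> \<in> space M. (\<Sum>i<n. (Y i \<omega>)\<^sup>2) < real n * v * (1 - \<tau>)} \<le> exp (- real n * \<tau>\<^sup>2 / 100)" (is ?lower)
proof -
  interpret prob_space M by fact
  have [measurable]: "Y i \<in> borel_measurable M" if "i < n" for i
    using indep that by (auto simp: indep_vars_def)
  \<comment> \<open>The sign of \<open>\<theta>\<close> is left free, so that one Markov inequality
    yields both tails.\<close>
  have chernoff: "measure M {\<omega> \<in> space M. c < \<theta> * (\<Sum>i<n. (Y i \<omega>)\<^sup>2)} \<le> exp (real n * b - c)"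
    if b: "\<And>i. i < n \<Longrightarrow> (\<integral>\<^sup>+\<omega>. ennreal (exp (\<theta> * (Y i \<omega>)\<^sup>2)) \<partial>M) \<le> ennreal (exp b)" for b c \<theta>
  proof -
    have "emeasure M {\<omega> \<in> space M. c < \<theta> * (\<Sum>i<n. (Y i \<omega>)\<^sup>2)} \<le>
        emeasure M ({\<omega> \<in> space M. 1 \<le> ennreal (exp (- c)) * (\<Prod>i<n. ennreal (exp (\<theta> * (Y i \<omega>)\<^sup>2)))})"
    proof (rule emeasure_mono)
      show "{\<omega> \<in> space M. c < \<theta> * (\<Sum>i<n. (Y i \<omega>)\<^sup>2)} \<subseteq>
        {\<omega> \<in> space M. 1 \<le> ennreal (exp (- c)) * (\<Prod>i<n. ennreal (exp (\<theta> * (Y i \<omega>)\<^sup>2)))}"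
      proof safe
        fix \<omega> assume "c < \<theta> * (\<Sum>i<n. (Y i \<omega>)\<^sup>2)"
        then have "1 \<le> exp (- c + \<theta> * (\<Sum>i<n. (Y i \<omega>)\<^sup>2))"
          by simp
        also have "\<dots> = exp (- c) * (\<Prod>i<n. exp (\<theta> * (Y i \<omega>)\<^sup>2))"
          unfolding exp_add sum_distrib_left by (simp add: exp_sum)
        finally show "1 \<le> ennreal (exp (- c)) * (\<Prod>i<n. ennreal (exp (\<theta> * (Y i \<omega>)\<^sup>2)))"
          by (subst prod_ennreal) (simp_all add: prod_nonneg flip: ennreal_mult')
      qed
    qed measurable
    also have "\<dots> \<le> ennreal (exp (- c)) * (\<integral>\<^sup>+\<omega>. (\<Prod>i<n. ennreal (exp (\<theta> * (Y i \<omega>)\<^sup>2))) * indicator (space M) \<omega> \<partial>M)"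
      by (rule nn_integral_Markov_inequality) measurable
    also have "(\<integral>\<^sup>+\<omega>. (\<Prod>i<n. ennreal (exp (\<theta> * (Y i \<omega>)\<^sup>2))) * indicator (space M) \<omega> \<partial>M) =
        (\<integral>\<^sup>+\<omega>. (\<Prod>i<n. ennreal (exp (\<theta> * (Y i \<omega>)\<^sup>2))) \<partial>M)"
      by (rule nn_integral_cong) simp
    also have "\<dots> = (\<Prod>i<n. \<integral>\<^sup>+\<omega>. ennreal (exp (\<theta> * (Y i \<omega>)\<^sup>2)) \<partial>M)"
      by (rule indep_vars_nn_integral) (auto intro!: indep_vars_compose2[OF indep, where Y = "\<lambda>_ y. ennreal (exp (\<theta> * y\<^sup>2))"])
    also have "\<dots> \<le> (\<Prod>i<n. ennreal (exp b))"
      by (intro prod_mono_ennreal) (auto intro: b)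
    also have "\<dots> = ennreal (exp (real n * b))"
      by (simp add: ennreal_power exp_of_nat_mult)
    finally have "emeasure M {\<omega> \<in> space M. c < \<theta> * (\<Sum>i<n. (Y i \<omega>)\<^sup>2)} \<le> ennreal (exp (- c)) * ennreal (exp (real n * b))"
      by (simp add: mult_left_mono)
    also have "\<dots> = ennreal (exp (real n * b - c))"
      by (simp add: exp_diff exp_minus divide_inverse mult.commute flip: ennreal_mult')
    finally show ?thesis
      by (simp add: emeasure_eq_measure)
  qed
  define \<theta> where "\<theta> = \<tau> / 44 / v"
  have \<theta>: "0 \<le> \<theta>" "\<theta> * v = \<tau> / 44"
    using v \<tau> by (simp_all add: \<theta>_def)
  have \<theta>pos: "0 < \<theta>" if "\<tau> \<noteq> 0"
    using that v \<tau> by (simp add: \<theta>_def)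
  have \<tau>2: "0 \<le> \<tau> * \<tau>" by simp
  show ?upper
  \<comment> \<open>For \<open>\<tau> = 0\<close> the event cannot be rescaled by
    \<open>\<theta> = 0\<close>, but then the claimed bound is 1.\<close>
  proof (cases "\<tau> = 0")
    case False
    have "measure M {\<omega> \<in> space M. real n * v * (1 + \<tau>) < (\<Sum>i<n. (Y i \<omega>)\<^sup>2)} =
        measure M {\<omega> \<in> space M. \<theta> * (real n * v * (1 + \<tau>)) < \<theta> * (\<Sum>i<n. (Y i \<omega>)\<^sup>2)}"
      using \<theta>pos[OF False] by (simp only: mult_less_cancel_left_pos)
    also have "\<dots> \<le> exp (real n * (\<theta> * v + 4 * (\<theta> * v)\<^sup>2) - \<theta> * (real n * v * (1 + \<tau>)))"
      using \<theta> v \<tau> by (intro chernoff square_mgf_upper mgf) auto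
    also have "\<dots> \<le> exp (- real n * \<tau>\<^sup>2 / 100)"
    proof (subst exp_le_cancel_iff)
      have "real n * (\<theta> * v + 4 * (\<theta> * v)\<^sup>2) - \<theta> * (real n * v * (1 + \<tau>)) = real n * (4 * (\<theta> * v)\<^sup>2 - (\<theta> * v) * \<tau>)"
        by (simp add: algebra_simps)
      also have "\<dots> \<le> real n * (- \<tau>\<^sup>2 / 100)"
        unfolding \<theta>(2) using \<tau>2 by (intro mult_left_mono) (auto simp: power2_eq_square)
      finally show "real n * (\<theta> * v + 4 * (\<theta> * v)\<^sup>2) - \<theta> * (real n * v * (1 + \<tau>)) \<le> - real n * \<tau>\<^sup>2 / 100"
        by simp
    qed
    finally show ?thesis .
  qed simp
  show ?lower
  proof (cases "\<tau> = 0")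
    case False
    have "measure M {\<omega> \<in> space M. (\<Sum>i<n. (Y i \<omega>)\<^sup>2) < real n * v * (1 - \<tau>)} =
        measure M {\<omega> \<in> space M. - \<theta> * (real n * v * (1 - \<tau>)) < - \<theta> * (\<Sum>i<n. (Y i \<omega>)\<^sup>2)}"
      using \<theta>pos[OF False] by (simp only: mult_less_cancel_left_neg neg_less_0_iff_less)
    also have "\<dots> \<le> exp (real n * (- (\<theta> * v) + 22 * (\<theta> * v)\<^sup>2) - - \<theta> * (real n * v * (1 - \<tau>)))"
      using \<theta> v \<tau> by (intro chernoff square_mgf_lower mgf) auto
    also have "\<dots> \<le> exp (- real n * \<tau>\<^sup>2 / 100)"
    proof (subst exp_le_cancel_iff)
      have "real n * (- (\<theta> * v) + 22 * (\<theta> * v)\<^sup>2) - - \<theta> * (real n * v * (1 - \<tau>)) = real n * (22 * (\<theta> * v)\<^sup>2 - (\<theta> * v) * \<tau>)"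
        by (simp add: algebra_simps)
      also have "\<dots> \<le> real n * (- \<tau>\<^sup>2 / 100)"
        unfolding \<theta>(2) using \<tau>2 by (intro mult_left_mono) (auto simp: power2_eq_square)
      finally show "real n * (- (\<theta> * v) + 22 * (\<theta> * v)\<^sup>2) - - \<theta> * (real n * v * (1 - \<tau>)) \<le> - real n * \<tau>\<^sup>2 / 100"
        by simp
    qed
    finally show ?thesis .
  qed simp
qed

text \<open>The product measure is determined by its values on boxes, and the preimage of a box is a
  box with translated sides, so the claim reduces to translation invariance on the line.\<close>

lemma nn_integral_PiM_lborel_shift:
  assumes "finite I" and [measurable]: "f \<in> borel_measurable (PiM I (\<lambda>_. lborel :: real measure))"
  shows "(\<integral>\<^sup>+x. f (\<lambda>i\<in>I. x i + c i) \<partial>PiM I (\<lambda>_. lborel)) = (\<integral>\<^sup>+x. f x \<partial>PiM I (\<lambda>_. lborel))"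
proof -
  interpret product_sigma_finite "\<lambda>_. lborel :: real measure" ..
  let ?T = "\<lambda>x. \<lambda>i\<in>I. x i + c i"
  have [measurable]: "?T \<in> measurable (PiM I (\<lambda>_. lborel)) (PiM I (\<lambda>_. lborel))"
    by (intro measurable_restrict) measurable
  have "distr (PiM I (\<lambda>_. lborel)) (PiM I (\<lambda>_. lborel)) ?T = PiM I (\<lambda>_. lborel)"
  proof (rule PiM_eqI)
    fix A :: "_ \<Rightarrow> real set" assume A: "\<And>i. i \<in> I \<Longrightarrow> A i \<in> sets lborel"
    have "emeasure (distr (PiM I (\<lambda>_. lborel)) (PiM I (\<lambda>_. lborel)) ?T) (PiE I A) =
        emeasure (PiM I (\<lambda>_. lborel)) (?T -` PiE I A \<inter> space (PiM I (\<lambda>_. lborel)))"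
      using A assms(1) by (intro emeasure_distr sets_PiM_I_finite) auto
    also have "?T -` PiE I A \<inter> space (PiM I (\<lambda>_. lborel)) = PiE I (\<lambda>i. (+) (c i) -` A i)"
      by (auto simp: space_PiM PiE_iff extensional_def add.commute)
    also have "emeasure (PiM I (\<lambda>_. lborel)) \<dots> = (\<Prod>i\<in>I. emeasure lborel ((+) (c i) -` A i))"
      using A by (intro emeasure_PiM assms(1)) (auto intro!: measurable_sets_borel[of "(+) _" borel])
    also have "\<dots> = (\<Prod>i\<in>I. emeasure (distr lborel borel ((+) (c i))) (A i))"
      using A by (intro prod.cong refl) (simp add: emeasure_distr)
    finally show "emeasure (distr (PiM I (\<lambda>_. lborel)) (PiM I (\<lambda>_. lborel)) ?T) (PiE I A) = (\<Prod>i\<in>I. emeasure lborel (A i))"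
      by (simp only: lborel_distr_plus)
  qed (use assms in simp_all)
  then have "(\<integral>\<^sup>+x. f x \<partial>PiM I (\<lambda>_. lborel)) = (\<integral>\<^sup>+x. f x \<partial>distr (PiM I (\<lambda>_. lborel)) (PiM I (\<lambda>_. lborel)) ?T)"
    by simp
  also have "\<dots> = (\<integral>\<^sup>+x. f (?T x) \<partial>PiM I (\<lambda>_. lborel))"
    by (rule nn_integral_distr) simp_all
  finally show ?thesis ..
qed

section \<open>Quadratic forms and inverses\<close>

text \<open>Vectors are plain functions of which only the values below \<open>p\<close> matter;
  sums, residuals and permuted vectors then need no carrier conditions.\<close>

definition bil :: "nat \<Rightarrow> (nat \<Rightarrow> nat \<Rightarrow> real) \<Rightarrow> (nat \<Rightarrow> real) \<Rightarrow> (nat \<Rightarrow> real) \<Rightarrow> real" where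
  "bil p A u v = (\<Sum>i<p. \<Sum>j<p. u i * A i j * v j)"

definition pd_form :: "nat \<Rightarrow> (nat \<Rightarrow> nat \<Rightarrow> real) \<Rightarrow> bool" where
  "pd_form p A \<longleftrightarrow> (\<forall>i<p. \<forall>j<p. A i j = A j i) \<and> (\<forall>u. (\<exists>i<p. u i \<noteq> 0) \<longrightarrow> 0 < bil p A u u)"

lemma bil_add_left: "bil p A (\<lambda>i. u i + w i) v = bil p A u v + bil p A w v"
  by (simp add: bil_def algebra_simps sum.distrib)

lemma bil_add_right: "bil p A v (\<lambda>i. u i + w i) = bil p A v u + bil p A v w"
  by (simp add: bil_def algebra_simps sum.distrib)

lemma bil_diff_right: "bil p A v (\<lambda>i. u i - w i) = bil p A v u - bil p A v w"
  by (simp add: bil_def algebra_simps sum_subtractf)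

lemma bil_mult_left: "bil p A (\<lambda>i. c * u i) v = c * bil p A u v"
  by (simp add: bil_def sum_distrib_left mult.assoc)

lemma bil_mult_right: "bil p A v (\<lambda>i. c * u i) = c * bil p A v u"
  by (simp add: bil_def sum_distrib_left mult_ac)

lemma bil_diff_form: "bil p (\<lambda>i j. A i j - B i j) u v = bil p A u v - bil p B u v"
  by (simp add: bil_def algebra_simps sum_subtractf)

lemma bil_cong:
  assumes "\<And>i j. i < p \<Longrightarrow> j < p \<Longrightarrow> A i j = B i j" "\<And>i. i < p \<Longrightarrow> u i = u' i" "\<And>i. i < p \<Longrightarrow> v i = v' i"
  shows "bil p A u v = bil p B u' v'"
  using assms by (simp add: bil_def)

lemma bil_sym:
  assumes "\<And>i j. i < p \<Longrightarrow> j < p \<Longrightarrow> A i j = A j i"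
  shows "bil p A u v = bil p A v u"
  unfolding bil_def by (subst sum.swap) (auto intro!: sum.cong simp: assms)

lemma bil_unit_left:
  assumes "i < p"
  shows "bil p A (\<lambda>k. of_bool (k = i)) v = (\<Sum>j<p. A i j * v j)"
proof -
  have "(\<Sum>j<p. of_bool (k = i) * A k j * v j) = (if k = i then \<Sum>j<p. A i j * v j else 0)" for k
    by simp
  then show ?thesis
    using assms by (simp add: bil_def)
qed

lemma bil_expand_left: "bil p A u v = (\<Sum>i<p. u i * bil p A (\<lambda>k. of_bool (k = i)) v)"
proof -
  have "bil p A u v = (\<Sum>i<p. u i * (\<Sum>j<p. A i j * v j))"
    by (simp add: bil_def sum_distrib_left mult.assoc)
  then show ?thesis
    by (simp add: bil_unit_left)
qed

lemma bil_unit_unit: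
  assumes "i < p" "j < p"
  shows "bil p A (\<lambda>k. of_bool (k = i)) (\<lambda>k. of_bool (k = j)) = A i j"
proof -
  have "A i l * of_bool (l = j) = (if l = j then A i j else 0)" for l
    by simp
  then show ?thesis
    using assms by (simp add: bil_unit_left)
qed

lemma bil_abs_le:
  assumes "\<And>i j. i < p \<Longrightarrow> j < p \<Longrightarrow> \<bar>A i j\<bar> \<le> \<eta>"
  shows "\<bar>bil p A u v\<bar> \<le> \<eta> * (\<Sum>i<p. \<bar>u i\<bar>) * (\<Sum>i<p. \<bar>v i\<bar>)"
proof -
  have "\<bar>bil p A u v\<bar> \<le> (\<Sum>i<p. \<Sum>j<p. \<bar>u i * A i j * v j\<bar>)"
    unfolding bil_def by (rule order_trans[OF sum_abs sum_mono[OF sum_abs]])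
  also have "\<dots> \<le> (\<Sum>i<p. \<Sum>j<p. \<bar>u i\<bar> * \<eta> * \<bar>v j\<bar>)"
    using assms by (intro sum_mono) (simp add: abs_mult mult_left_mono mult_right_mono)
  also have "\<dots> = \<eta> * (\<Sum>i<p. \<bar>u i\<bar>) * (\<Sum>i<p. \<bar>v i\<bar>)"
    by (simp add: sum_product sum_distrib_left sum_distrib_right mult_ac)
  finally show ?thesis .
qed

lemma pd_form_nonneg: "pd_form p A \<Longrightarrow> 0 \<le> bil p A u u"
  unfolding pd_form_def
  by (cases "\<exists>i<p. u i \<noteq> 0") (auto simp: bil_def intro: less_imp_le)

lemma pd_form_eq_0: "pd_form p A \<Longrightarrow> bil p A u u = 0 \<Longrightarrow> i < p \<Longrightarrow> u i = 0"
  unfolding pd_form_def by force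

section \<open>Positive definite matrices and their inverses\<close>

lemma scalar_prod_mult_mat_vec_bil:
  assumes "A \<in> carrier_mat p p" "u \<in> carrier_vec p" "v \<in> carrier_vec p"
  shows "u \<bullet> (A *\<^sub>v v) = bil p (\<lambda>i j. A $$ (i, j)) (($) u) (($) v)"
  using assms by (auto simp: bil_def scalar_prod_def sum_distrib_left mult.assoc lessThan_atLeast0 intro!: sum.cong)

lemma pos_def_pd_form:
  assumes "pos_def p S"
  shows "pd_form p (\<lambda>i j. S $$ (i, j))"
proof -
  have S: "S \<in> carrier_mat p p" "transpose_mat S = S"
    and pos: "\<And>v. v \<in> carrier_vec p \<Longrightarrow> v \<noteq> 0\<^sub>v p \<Longrightarrow> v \<bullet> (S *\<^sub>v v) > 0"
    using assms by (auto simp: pos_def_def)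
  have "0 < bil p (\<lambda>i j. S $$ (i, j)) u u" if "i < p" "u i \<noteq> 0" for u i
  proof -
    have "vec p u \<noteq> 0\<^sub>v p"
      using that by (metis index_vec index_zero_vec(1))
    then have "0 < vec p u \<bullet> (S *\<^sub>v vec p u)"
      by (intro pos) auto
    also have "\<dots> = bil p (\<lambda>i j. S $$ (i, j)) (($) (vec p u)) (($) (vec p u))"
      by (rule scalar_prod_mult_mat_vec_bil) (use S in auto)
    also have "\<dots> = bil p (\<lambda>i j. S $$ (i, j)) u u"
      by (rule bil_cong) auto
    finally show ?thesis .
  qed
  moreover have "S $$ (i, j) = S $$ (j, i)" if "i < p" "j < p" for i j
    using S that by (metis carrier_matD index_transpose_mat(1))
  ultimately show ?thesis
    by (auto simp: pd_form_def)
qed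

lemma pd_form_pos_def:
  assumes "S \<in> carrier_mat p p" "pd_form p (\<lambda>i j. S $$ (i, j))"
  shows "pos_def p S"
proof -
  have "transpose_mat S = S"
    using assms by (intro eq_matI) (auto simp: pd_form_def)
  moreover have "v \<bullet> (S *\<^sub>v v) > 0" if "v \<in> carrier_vec p" "v \<noteq> 0\<^sub>v p" for v
  proof -
    have "\<exists>i<p. v $ i \<noteq> 0"
      using that by (metis carrier_vecD eq_vecI index_zero_vec)
    then show ?thesis
      using assms that by (simp add: scalar_prod_mult_mat_vec_bil pd_form_def)
  qed
  ultimately show ?thesis
    using assms(1) by (auto simp: pos_def_def)
qed

lemma pos_def_det:
  assumes "pos_def p S"
  shows "det S \<noteq> 0"
proof
  have S: "S \<in> carrier_mat p p"
    using assms by (simp add: pos_def_def)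
  assume "det S = 0"
  then obtain v where "v \<in> carrier_vec p" "v \<noteq> 0\<^sub>v p" "S *\<^sub>v v = 0\<^sub>v p"
    using det_0_iff_vec_prod_zero_field[OF S] by auto
  moreover from this have "v \<bullet> (S *\<^sub>v v) > 0"
    using assms by (auto simp: pos_def_def)
  ultimately show False by simp
qed

text \<open>A one-sided inverse of a square matrix is two-sided and unique, so a single product
  determines the definite description.\<close>

lemma inv_mat_eqI:
  assumes "A \<in> carrier_mat p p" "T \<in> carrier_mat p p" "A * T = 1\<^sub>m p"
  shows "inv_mat A = T"
  unfolding inv_mat_def
proof (rule the_equality)
  have "dim_row A = p" using assms by simp
  then show "T \<in> carrier_mat (dim_row A) (dim_row A) \<and> A * T = 1\<^sub>m (dim_row A) \<and> T * A = 1\<^sub>m (dim_row A)"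
    using assms mat_mult_left_right_inverse by auto
  fix T' assume "T' \<in> carrier_mat (dim_row A) (dim_row A) \<and> A * T' = 1\<^sub>m (dim_row A) \<and> T' * A = 1\<^sub>m (dim_row A)"
  then have T': "T' \<in> carrier_mat p p" "T' * A = 1\<^sub>m p"
    using assms by auto
  have "T' = T' * (A * T)"
    using assms T' by simp
  also have "\<dots> = T' * A * T"
    by (rule assoc_mult_mat[symmetric]) (use assms T' in auto)
  also have "\<dots> = T"
    using assms T' by simp
  finally show "T' = T" .
qed

lemma inv_mat_det:
  assumes A: "A \<in> carrier_mat p p" and "det A \<noteq> 0"
  shows "inv_mat A \<in> carrier_mat p p" "A * inv_mat A = 1\<^sub>m p" "inv_mat A * A = 1\<^sub>m p"
proof -
  obtain T where T: "T \<in> carrier_mat p p" "A * T = 1\<^sub>m p" "T * A = 1\<^sub>m p"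
    using det_non_zero_imp_unit[OF assms, of undefined] by (auto simp: Units_def ring_mat_def)
  then show "inv_mat A \<in> carrier_mat p p" "A * inv_mat A = 1\<^sub>m p" "inv_mat A * A = 1\<^sub>m p"
    using inv_mat_eqI[OF A T(1,2)] by auto
qed

section \<open>Concentration of the design\<close>

text \<open>Completing the square: since the inverse of \<open>S\<close> maps \<open>w = S v\<close>
  back to \<open>v\<close>, shifting \<open>x\<close> by \<open>t * w\<close> changes the quadratic
  form by \<open>- 2 * t\<close> times the product of \<open>v\<close> and \<open>x\<close>, plus
  \<open>t^2\<close> times the variance of that linear form.\<close>

lemma mvn_density_tilt:
  fixes v :: "nat \<Rightarrow> real"
  assumes S: "pos_def p S"
  defines "w \<equiv> \<lambda>i. \<Sum>j<p. S $$ (i, j) * v j"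
  shows "mvn_density S x * exp (t * (\<Sum>j<p. v j * x j)) =
    exp (t\<^sup>2 * bil p (\<lambda>i j. S $$ (i, j)) v v / 2) * mvn_density S (\<lambda>i\<in>{..<p}. x i + - t * w i)"
proof -
  have SC: "S \<in> carrier_mat p p" and sym: "transpose_mat S = S"
    using S by (auto simp: pos_def_def)
  define T where "T = inv_mat S"
  have T: "T \<in> carrier_mat p p" "S * T = 1\<^sub>m p" "T * S = 1\<^sub>m p"
    unfolding T_def using inv_mat_det[OF SC pos_def_det[OF S]] by auto
  define X V where "X = vec p x" and "V = vec p v"
  have XV[simp]: "X \<in> carrier_vec p" "V \<in> carrier_vec p"
    by (simp_all add: X_def V_def)
  have W: "S *\<^sub>v V \<in> carrier_vec p"
    using SC by simp
  have TSV: "T *\<^sub>v (S *\<^sub>v V) = V"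
    using assoc_mult_mat_vec[OF T(1) SC XV(2)] T(3) by simp
  have STX: "S *\<^sub>v (T *\<^sub>v X) = X"
    using assoc_mult_mat_vec[OF SC T(1) XV(1)] T(2) by simp
  have TX: "T *\<^sub>v X \<in> carrier_vec p"
    using T by simp
  have vec: "vec p (\<lambda>i\<in>{..<p}. x i + - t * w i) = X - t \<cdot>\<^sub>v (S *\<^sub>v V)"
    using SC by (intro eq_vecI) (auto simp: X_def V_def w_def scalar_prod_def lessThan_atLeast0)
  have VX: "V \<bullet> X = (\<Sum>j<p. v j * x j)"
    by (simp add: V_def X_def scalar_prod_def lessThan_atLeast0)
  have VSV: "(S *\<^sub>v V) \<bullet> V = bil p (\<lambda>i j. S $$ (i, j)) v v"
  proof -
    have "(S *\<^sub>v V) \<bullet> V = V \<bullet> (S *\<^sub>v V)"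
      using W by (intro comm_scalar_prod[of _ p]) auto
    also have "\<dots> = bil p (\<lambda>i j. S $$ (i, j)) (($) V) (($) V)"
      by (rule scalar_prod_mult_mat_vec_bil) (use SC in auto)
    also have "\<dots> = bil p (\<lambda>i j. S $$ (i, j)) v v"
      by (rule bil_cong) (auto simp: V_def)
    finally show ?thesis .
  qed
  \<comment> \<open>Symmetry of \<open>S\<close> moves it to the other factor, where it cancels
    against \<open>T\<close>.\<close>
  have WTX: "(S *\<^sub>v V) \<bullet> (T *\<^sub>v X) = V \<bullet> X"
    using transpose_vec_mult_scalar[OF SC TX XV(2)] transpose_vec_mult_scalar[OF SC XV(2) TX]
      comm_scalar_prod[OF W TX] comm_scalar_prod[OF XV] STX sym
    by (metis SC XV(2) TX transpose_vec_mult_scalar)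
  have "(X - t \<cdot>\<^sub>v (S *\<^sub>v V)) \<bullet> (T *\<^sub>v (X - t \<cdot>\<^sub>v (S *\<^sub>v V))) =
      (X - t \<cdot>\<^sub>v (S *\<^sub>v V)) \<bullet> (T *\<^sub>v X - t \<cdot>\<^sub>v V)"
    using W T by (simp add: mult_minus_distrib_mat_vec[of _ p p] mult_mat_vec[of _ p p] TSV)
  also have "\<dots> = X \<bullet> (T *\<^sub>v X) - 2 * t * (V \<bullet> X) + t\<^sup>2 * ((S *\<^sub>v V) \<bullet> V)"
    using W TX by (simp add: minus_scalar_prod_distrib[of _ p] scalar_prod_minus_distrib[of _ p] WTX
        scalar_prod_smult_distrib[OF XV] comm_scalar_prod[OF XV] power2_eq_square algebra_simps)
  finally have q: "(X - t \<cdot>\<^sub>v (S *\<^sub>v V)) \<bullet> (T *\<^sub>v (X - t \<cdot>\<^sub>v (S *\<^sub>v V))) =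
      X \<bullet> (T *\<^sub>v X) - 2 * t * (V \<bullet> X) + t\<^sup>2 * ((S *\<^sub>v V) \<bullet> V)" .
  have dS: "dim_row S = p"
    using SC by simp
  let ?c = "(2 * pi) powr (- real p / 2) * det S powr (- 1 / 2)"
  have "mvn_density S x * exp (t * (\<Sum>j<p. v j * x j)) = ?c * exp (- (X \<bullet> (T *\<^sub>v X)) / 2 + t * (V \<bullet> X))"
    unfolding mvn_density_def Let_def dS VX[symmetric] exp_add T_def[symmetric] X_def[symmetric]
    by (simp only: mult.assoc)
  also have "- (X \<bullet> (T *\<^sub>v X)) / 2 + t * (V \<bullet> X) = t\<^sup>2 * bil p (\<lambda>i j. S $$ (i, j)) v v / 2 +
      - ((X - t \<cdot>\<^sub>v (S *\<^sub>v V)) \<bullet> (T *\<^sub>v (X - t \<cdot>\<^sub>v (S *\<^sub>v V)))) / 2"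
    unfolding q VSV by (simp add: field_simps)
  also have "?c * exp \<dots> = exp (t\<^sup>2 * bil p (\<lambda>i j. S $$ (i, j)) v v / 2) * mvn_density S (\<lambda>i\<in>{..<p}. x i + - t * w i)"
    unfolding mvn_density_def Let_def dS vec exp_add by (simp add: mult_ac flip: T_def)
  finally show ?thesis .
qed

text \<open>Tilting translates the density and Lebesgue measure is translation invariant, so only the total mass of
  the density is needed and no Gaussian integral has to be evaluated.\<close>
lemma mvn_linear_mgf:
  assumes S: "pos_def p S" and "prob_space M"
    and X: "distributed M (PiM {..<p} (\<lambda>_. lborel)) X (\<lambda>x. ennreal (mvn_density S x))"
  shows "(\<integral>\<^sup>+\<omega>. ennreal (exp (t * (\<Sum>j<p. v j * X \<omega> j))) \<partial>M) =
    ennreal (exp (t\<^sup>2 * bil p (\<lambda>i j. S $$ (i, j)) v v / 2))"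
proof -
  interpret prob_space M by fact
  let ?P = "PiM {..<p} (\<lambda>_. lborel :: real measure)"
  let ?c = "ennreal (exp (t\<^sup>2 * bil p (\<lambda>i j. S $$ (i, j)) v v / 2))"
  define w where "w i = (\<Sum>j<p. S $$ (i, j) * v j)" for i
  have [measurable]: "(\<lambda>x. ennreal (mvn_density S x)) \<in> borel_measurable ?P"
    using X by (simp add: distributed_def)
  have [measurable]: "(\<lambda>x. \<lambda>i\<in>{..<p}. x i + - t * w i) \<in> measurable ?P ?P"
    by (intro measurable_restrict) measurable
  have "(\<integral>\<^sup>+\<omega>. ennreal (exp (t * (\<Sum>j<p. v j * X \<omega> j))) \<partial>M) =
      (\<integral>\<^sup>+x. ennreal (mvn_density S x) * ennreal (exp (t * (\<Sum>j<p. v j * x j))) \<partial>?P)"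
    by (rule distributed_nn_integral[OF X, symmetric]) measurable
  also have "\<dots> = (\<integral>\<^sup>+x. ?c * ennreal (mvn_density S (\<lambda>i\<in>{..<p}. x i + - t * w i)) \<partial>?P)"
    using mvn_density_tilt[OF S, of _ t v, folded w_def]
    by (intro nn_integral_cong) (simp add: ennreal_mult' ennreal_mult'' flip: ennreal_mult'' ennreal_mult')
  also have "\<dots> = ?c * (\<integral>\<^sup>+x. ennreal (mvn_density S (\<lambda>i\<in>{..<p}. x i + - t * w i)) \<partial>?P)"
    by (rule nn_integral_cmult) measurable
  also have "(\<integral>\<^sup>+x. ennreal (mvn_density S (\<lambda>i\<in>{..<p}. x i + - t * w i)) \<partial>?P) =
      (\<integral>\<^sup>+x. ennreal (mvn_density S x) \<partial>?P)"
    by (rule nn_integral_PiM_lborel_shift) simp_all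
  also have "\<dots> = (\<integral>\<^sup>+x. ennreal (mvn_density S x) * 1 \<partial>?P)"
    by simp
  also have "\<dots> = (\<integral>\<^sup>+\<omega>. 1 \<partial>M)"
    by (rule distributed_nn_integral[OF X]) simp
  finally show ?thesis
    by (simp add: emeasure_space_1)
qed

text \<open>For each \<open>v\<close> the linear forms of the rows are independent Gaussians of
  common variance, so both tail bounds apply. The factor 2 counts the tails and
  \<open>card V\<close> is the union bound.\<close>

lemma gaussian_design_event:
  assumes S: "pos_def p S" and G: "gaussian_design M n S"
    and V: "finite V" "\<forall>v\<in>V. 0 < bil p (\<lambda>i j. S $$ (i, j)) v v"
    and \<tau>: "0 \<le> \<tau>" "\<tau> \<le> 1"
  shows "\<exists>A\<in>sets M. measure M A \<ge> 1 - real (card V) * (2 * exp (- real n * \<tau>\<^sup>2 / 100)) \<and>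
    (\<forall>\<omega>\<in>A. \<forall>v\<in>V.
      (\<Sum>i<n. (\<Sum>j<p. v j * \<omega> i j)\<^sup>2) \<le> real n * bil p (\<lambda>i j. S $$ (i, j)) v v * (1 + \<tau>) \<and>
      real n * bil p (\<lambda>i j. S $$ (i, j)) v v * (1 - \<tau>) \<le> (\<Sum>i<n. (\<Sum>j<p. v j * \<omega> i j)\<^sup>2))"
proof -
  let ?P = "PiM {..<p} (\<lambda>_. lborel :: real measure)"
  let ?\<sigma> = "\<lambda>v. bil p (\<lambda>i j. S $$ (i, j)) v v"
  have p: "dim_row S = p"
    using S by (auto simp: pos_def_def)
  have "prob_space M" and indep: "prob_space.indep_vars M (\<lambda>_. ?P) (\<lambda>i \<omega>. restrict (\<omega> i) {..<p}) {..<n}"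
    and dist: "\<And>i. i < n \<Longrightarrow> distributed M ?P (\<lambda>\<omega>. restrict (\<omega> i) {..<p}) (\<lambda>x. ennreal (mvn_density S x))"
    using G by (auto simp: gaussian_design_def p Let_def)
  interpret prob_space M by fact
  define Y where "Y v i \<omega> = (\<Sum>j<p. v j * \<omega> i j)" for v :: "nat \<Rightarrow> real" and i :: nat and \<omega> :: "nat \<Rightarrow> nat \<Rightarrow> real"
  have Y: "indep_vars (\<lambda>_. borel) (Y v) {..<n}" for v
  proof -
    have "indep_vars (\<lambda>_. borel) (\<lambda>i \<omega>. (\<Sum>j<p. v j * (restrict (\<omega> i) {..<p}) j)) {..<n}"
      by (rule indep_vars_compose2[OF indep, where Y = "\<lambda>_ x. \<Sum>j<p. v j * x j"]) measurable
    also have "(\<lambda>i \<omega>. (\<Sum>j<p. v j * (restrict (\<omega> i) {..<p}) j)) = Y v"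
      by (simp add: Y_def fun_eq_iff)
    finally show ?thesis .
  qed
  have mgf: "(\<integral>\<^sup>+\<omega>. ennreal (exp (t * Y v i \<omega>)) \<partial>M) = ennreal (exp (t\<^sup>2 * ?\<sigma> v / 2))" if "i < n" for v i t
    using mvn_linear_mgf[OF S \<open>prob_space M\<close> dist[OF that], of t v] by (simp add: Y_def)
  have [measurable]: "Y v i \<in> borel_measurable M" if "i < n" for v i
    using Y[of v] that by (auto simp: indep_vars_def)
  define U where "U v = {\<omega> \<in> space M. real n * ?\<sigma> v * (1 + \<tau>) < (\<Sum>i<n. (Y v i \<omega>)\<^sup>2)}" for v
  define L where "L v = {\<omega> \<in> space M. (\<Sum>i<n. (Y v i \<omega>)\<^sup>2) < real n * ?\<sigma> v * (1 - \<tau>)}" for v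
  have [measurable]: "U v \<in> sets M" "L v \<in> sets M" for v
    unfolding U_def L_def by measurable
  have b: "prob (U v \<union> L v) \<le> 2 * exp (- real n * \<tau>\<^sup>2 / 100)" if "v \<in> V" for v
  proof -
    have "prob (U v \<union> L v) \<le> prob (U v) + prob (L v)"
      by (rule measure_Un_le) measurable
    also have "prob (U v) \<le> exp (- real n * \<tau>\<^sup>2 / 100)"
      unfolding U_def by (rule square_sum_tail[OF \<open>prob_space M\<close> Y mgf bspec[OF V(2) that] \<tau>])
    also have "prob (L v) \<le> exp (- real n * \<tau>\<^sup>2 / 100)"
      unfolding L_def by (rule square_sum_tail[OF \<open>prob_space M\<close> Y mgf bspec[OF V(2) that] \<tau>])
    finally show ?thesis by simp
  qed
  define A where "A = space M - (\<Union>v\<in>V. U v \<union> L v)"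
  have UN: "(\<Union>v\<in>V. U v \<union> L v) \<in> sets M"
    using V(1) by (intro sets.finite_UN) auto
  have "prob (\<Union>v\<in>V. U v \<union> L v) \<le> (\<Sum>v\<in>V. prob (U v \<union> L v))"
    using V(1) by (intro finite_measure_subadditive_finite) auto
  also have "\<dots> \<le> (\<Sum>v\<in>V. 2 * exp (- real n * \<tau>\<^sup>2 / 100))"
    by (intro sum_mono b)
  finally have "1 - real (card V) * (2 * exp (- real n * \<tau>\<^sup>2 / 100)) \<le> prob A"
    unfolding A_def by (subst prob_compl[OF UN]) simp
  moreover have "A \<in> sets M"
    unfolding A_def using UN by auto
  moreover have "(\<Sum>i<n. (\<Sum>j<p. v j * \<omega> i j)\<^sup>2) \<le> real n * ?\<sigma> v * (1 + \<tau>) \<and>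
      real n * ?\<sigma> v * (1 - \<tau>) \<le> (\<Sum>i<n. (\<Sum>j<p. v j * \<omega> i j)\<^sup>2)" if "\<omega> \<in> A" "v \<in> V" for \<omega> v
    using that by (auto simp: A_def U_def L_def Y_def not_less)
  ultimately show ?thesis by blast
qed

section \<open>Regression and the triangular factorization\<close>

abbreviation unit_fun :: "nat \<Rightarrow> nat \<Rightarrow> real" where
  "unit_fun i \<equiv> (\<lambda>k. of_bool (k = i))"

lemma bil_orthogonal_span:
  assumes "\<And>i. i < p \<Longrightarrow> u i \<noteq> 0 \<Longrightarrow> bil p A (unit_fun i) v = 0"
  shows "bil p A u v = 0"
  unfolding bil_expand_left[of p A u] using assms by (intro sum.neutral) auto

text \<open>Gram-Schmidt by induction on \<open>T\<close>. The vector \<open>v\<close> is arbitrary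
  because the step regresses both \<open>v\<close> and the new unit vector on the old
  \<open>T\<close>; the residual of \<open>v\<close> is then corrected along the residual
  \<open>r\<close> of the new coordinate.\<close>

lemma regression_exists:
  assumes A: "pd_form p A" and "T \<subseteq> {..<p}"
  shows "\<exists>l. (\<forall>i. i \<notin> T \<longrightarrow> l i = 0) \<and> (\<forall>i\<in>T. bil p A (unit_fun i) (\<lambda>k. v k - l k) = 0)"
proof -
  have "finite T"
    using assms(2) finite_subset by blast
  then show ?thesis
    using assms(2)
  proof (induction T arbitrary: v rule: finite_induct)
    case empty
    then show ?case by (intro exI[of _ "\<lambda>_. 0"]) auto
  next
    case (insert k T)
    obtain l where l: "\<And>i. i \<notin> T \<Longrightarrow> l i = 0" "\<And>i. i \<in> T \<Longrightarrow> bil p A (unit_fun i) (\<lambda>k. v k - l k) = 0"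
      using insert.IH[of v] insert.prems by auto
    obtain m where m: "\<And>i. i \<notin> T \<Longrightarrow> m i = 0" "\<And>i. i \<in> T \<Longrightarrow> bil p A (unit_fun i) (\<lambda>j. unit_fun k j - m j) = 0"
      using insert.IH[of "unit_fun k"] insert.prems by auto
    define r where "r = (\<lambda>j. unit_fun k j - m j)"
    \<comment> \<open>Since \<open>m\<close> vanishes at \<open>k\<close>, \<open>r k = 1\<close>;
      hence \<open>r\<close> has positive energy and the quotient \<open>c\<close> below is
      meaningful.\<close>
    have "r k \<noteq> 0" "k < p"
      using m(1)[OF insert.hyps(2)] insert.prems by (auto simp: r_def)
    then have rr: "0 < bil p A r r"
      using A by (auto simp: pd_form_def)
    define c where "c = bil p A r (\<lambda>j. v j - l j) / bil p A r r"
    define l' where "l' = (\<lambda>j. l j + c * r j)"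
    have eq: "bil p A x (\<lambda>j. v j - l' j) = bil p A x (\<lambda>j. v j - l j) - c * bil p A x r" for x
    proof -
      have "(\<lambda>j. v j - l' j) = (\<lambda>j. (v j - l j) - c * r j)"
        by (simp add: l'_def fun_eq_iff)
      then show ?thesis
        by (simp add: bil_diff_right[of p A x "\<lambda>j. v j - l j"] bil_mult_right)
    qed
    have T: "bil p A (unit_fun i) (\<lambda>j. v j - l' j) = 0" if "i \<in> T" for i
      unfolding eq using l(2)[OF that] m(2)[OF that] by (simp add: r_def)
    have "bil p A (unit_fun k) (\<lambda>j. v j - l' j) = bil p A (\<lambda>j. r j + m j) (\<lambda>j. v j - l' j)"
      by (simp add: r_def)
    also have "\<dots> = bil p A r (\<lambda>j. v j - l' j) + bil p A m (\<lambda>j. v j - l' j)"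
      by (rule bil_add_left)
    also have "bil p A m (\<lambda>j. v j - l' j) = 0"
    proof (rule bil_orthogonal_span)
      fix i assume "m i \<noteq> 0"
      then have "i \<in> T" using m(1) by metis
      then show "bil p A (unit_fun i) (\<lambda>j. v j - l' j) = 0" by (rule T)
    qed
    also have "bil p A r (\<lambda>j. v j - l' j) = 0"
      unfolding eq using rr by (simp add: c_def)
    finally have k: "bil p A (unit_fun k) (\<lambda>j. v j - l' j) = 0" by simp
    have "l' i = 0" if "i \<notin> insert k T" for i
      using that l(1) m(1) by (simp add: l'_def r_def)
    then show ?case
      using T k by (intro exI[of _ l']) auto
  qed
qed

text \<open>The difference of two solutions is supported in \<open>T\<close> and orthogonal to
  \<open>T\<close>, so its own energy vanishes.\<close>

lemma regression_unique:
  assumes A: "pd_form p A"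
    and l: "\<And>i. i < p \<Longrightarrow> i \<notin> T \<Longrightarrow> l i = 0" "\<And>i. i < p \<Longrightarrow> i \<in> T \<Longrightarrow> bil p A (unit_fun i) (\<lambda>k. v k - l k) = 0"
    and m: "\<And>i. i < p \<Longrightarrow> i \<notin> T \<Longrightarrow> m i = 0" "\<And>i. i < p \<Longrightarrow> i \<in> T \<Longrightarrow> bil p A (unit_fun i) (\<lambda>k. v k - m k) = 0"
    and "i < p"
  shows "l i = m i"
proof -
  have "bil p A (\<lambda>k. l k - m k) (\<lambda>k. l k - m k) = 0"
  proof (rule bil_orthogonal_span)
    fix i assume "i < p" "l i - m i \<noteq> 0"
    then have "i \<in> T" using l(1) m(1) by fastforce
    then show "bil p A (unit_fun i) (\<lambda>k. l k - m k) = 0"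
      using l(2)[OF \<open>i < p\<close>] m(2)[OF \<open>i < p\<close>] by (simp add: bil_diff_right)
  qed
  then show ?thesis
    using pd_form_eq_0[OF A, of "\<lambda>k. l k - m k" i] \<open>i < p\<close> by simp
qed

section \<open>Reordering of the coordinates\<close>

lemma bil_permute:
  assumes "\<pi> permutes {..<p}"
  shows "bil p (\<lambda>i j. A (\<pi> i) (\<pi> j)) u v = bil p A (\<lambda>i. u (inv_into UNIV \<pi> i)) (\<lambda>i. v (inv_into UNIV \<pi> i))"
proof -
  have b: "bij_betw \<pi> {..<p} {..<p}"
    using assms by (rule permutes_imp_bij)
  have "bil p A (\<lambda>i. u (inv_into UNIV \<pi> i)) (\<lambda>i. v (inv_into UNIV \<pi> i)) =
      (\<Sum>i<p. \<Sum>j<p. u (inv_into UNIV \<pi> (\<pi> i)) * A (\<pi> i) (\<pi> j) * v (inv_into UNIV \<pi> (\<pi> j)))"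
    unfolding bil_def by (simp only: sum.reindex_bij_betw[OF b, symmetric, where g = "\<lambda>i. \<Sum>j<p. u (inv_into UNIV \<pi> i) * A i j * v (inv_into UNIV \<pi> j)"]
        sum.reindex_bij_betw[OF b, symmetric, where g = "\<lambda>j. u (inv_into UNIV \<pi> (\<pi> _)) * A (\<pi> _) j * v (inv_into UNIV \<pi> j)"])
  then show ?thesis
    using permutes_inverses(2)[OF assms] by (simp add: bil_def)
qed

lemma pd_form_permute:
  assumes \<pi>: "\<pi> permutes {..<p}" and A: "pd_form p A"
  shows "pd_form p (\<lambda>i j. A (\<pi> i) (\<pi> j))"
  unfolding pd_form_def
proof safe
  have lt: "\<pi> i < p" if "i < p" for i
    using permutes_in_image[OF \<pi>, of i] that by simp
  show "A (\<pi> i) (\<pi> j) = A (\<pi> j) (\<pi> i)" if "i < p" "j < p" for i j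
    using A lt that by (simp add: pd_form_def)
  fix u :: "nat \<Rightarrow> real" and i assume "i < p" "u i \<noteq> 0"
  then have "\<pi> i < p" "u (inv_into UNIV \<pi> (\<pi> i)) \<noteq> 0"
    using lt permutes_inverses(2)[OF \<pi>] by auto
  then show "0 < bil p (\<lambda>i j. A (\<pi> i) (\<pi> j)) u u"
    unfolding bil_permute[OF \<pi>] using A by (auto simp: pd_form_def)
qed

lemma perm_mat_mult:
  assumes \<pi>: "\<pi> permutes {..<p}" and A: "A \<in> carrier_mat p p" and B: "B \<in> carrier_mat p p"
  shows "perm_mat \<pi> A * perm_mat \<pi> B = perm_mat \<pi> (A * B)"
proof (rule eq_matI)
  have lt: "\<pi> i < p" if "i < p" for i
    using permutes_in_image[OF \<pi>, of i] that by simp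
  fix i j assume "i < dim_row (perm_mat \<pi> (A * B))" "j < dim_col (perm_mat \<pi> (A * B))"
  then have ij: "i < p" "j < p"
    using A B by (auto simp: perm_mat_def)
  have "(perm_mat \<pi> A * perm_mat \<pi> B) $$ (i, j) = (\<Sum>k<p. A $$ (\<pi> i, \<pi> k) * B $$ (\<pi> k, \<pi> j))"
    using ij A B by (simp add: perm_mat_def scalar_prod_def lessThan_atLeast0)
  also have "\<dots> = (\<Sum>k<p. A $$ (\<pi> i, k) * B $$ (k, \<pi> j))"
    by (rule sum.reindex_bij_betw[OF permutes_imp_bij[OF \<pi>], where g = "\<lambda>k. A $$ (\<pi> i, k) * B $$ (k, \<pi> j)"])
  also have "\<dots> = perm_mat \<pi> (A * B) $$ (i, j)"
    using ij A B lt by (simp add: perm_mat_def scalar_prod_def lessThan_atLeast0)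
  finally show "(perm_mat \<pi> A * perm_mat \<pi> B) $$ (i, j) = perm_mat \<pi> (A * B) $$ (i, j)" .
qed (use A B in \<open>auto simp: perm_mat_def\<close>)

lemma perm_mat_inv_mat:
  assumes \<pi>: "\<pi> permutes {..<p}" and S: "pos_def p S"
  shows "perm_mat \<pi> (inv_mat S) = inv_mat (perm_mat \<pi> S)"
proof -
  have SC: "S \<in> carrier_mat p p"
    using S by (simp add: pos_def_def)
  note T = inv_mat_det[OF SC pos_def_det[OF S]]
  have lt: "\<pi> i < p" if "i < p" for i
    using permutes_in_image[OF \<pi>, of i] that by simp
  have "perm_mat \<pi> S * perm_mat \<pi> (inv_mat S) = perm_mat \<pi> (1\<^sub>m p)"
    using perm_mat_mult[OF \<pi> SC T(1)] T(2) by simp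
  also have "\<dots> = 1\<^sub>m p"
    using lt permutes_inj[OF \<pi>] by (intro eq_matI) (auto simp: perm_mat_def inj_eq)
  finally show ?thesis
    using SC T(1) by (intro inv_mat_eqI[symmetric]) (auto simp: perm_mat_def)
qed

section \<open>Triangular factorization of the precision matrix\<close>

lemma pos_diag_inv_mat:
  assumes "pos_diag p D"
  shows "inv_mat D \<in> carrier_mat p p" "D * inv_mat D = 1\<^sub>m p" "inv_mat D * D = 1\<^sub>m p"
proof -
  have "pd_form p (\<lambda>i j. D $$ (i, j))"
    unfolding pd_form_def
  proof safe
    show "D $$ (i, j) = D $$ (j, i)" if "i < p" "j < p" for i j
      using assms that by (cases "i = j") (auto simp: pos_diag_def)
    fix u :: "nat \<Rightarrow> real" and i assume i: "i < p" "u i \<noteq> 0"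
    have "bil p (\<lambda>i j. D $$ (i, j)) u u = (\<Sum>i<p. \<Sum>j<p. if j = i then D $$ (i, i) * (u i)\<^sup>2 else 0)"
      unfolding bil_def using assms
      by (intro sum.cong refl) (auto simp: pos_diag_def power2_eq_square)
    also have "\<dots> = (\<Sum>i<p. D $$ (i, i) * (u i)\<^sup>2)"
      by simp
    also have "\<dots> > 0"
      using assms i by (intro sum_pos2[of _ i]) (auto simp: pos_diag_def less_imp_le)
    finally show "0 < bil p (\<lambda>i j. D $$ (i, j)) u u" .
  qed
  then have "pos_def p D"
    using assms by (intro pd_form_pos_def) (auto simp: pos_diag_def)
  from inv_mat_det[OF _ pos_def_det[OF this]] assms
  show "inv_mat D \<in> carrier_mat p p" "D * inv_mat D = 1\<^sub>m p" "inv_mat D * D = 1\<^sub>m p"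
    by (auto simp: pos_diag_def)
qed

text \<open>This trades a factorization of the inverse for a congruence of the matrix itself. With
  \<open>F = A * (U * inv_mat D)\<close>, one side says that \<open>F\<close> is a left inverse of
  the transpose of \<open>U\<close>, the other that it is a right inverse, and for square matrices
  these agree.\<close>

lemma inv_mat_factor_iff:
  assumes A: "pos_def p A" and U: "U \<in> carrier_mat p p" and D: "pos_diag p D"
  shows "inv_mat A = U * inv_mat D * transpose_mat U \<longleftrightarrow> transpose_mat U * A * U = D"
proof -
  have AC: "A \<in> carrier_mat p p" and DC: "D \<in> carrier_mat p p" and UT: "transpose_mat U \<in> carrier_mat p p"
    using A D U by (auto simp: pos_def_def pos_diag_def)
  note E = pos_diag_inv_mat[OF D]
  note T = inv_mat_det[OF AC pos_def_det[OF A]]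
  define F where "F = A * (U * inv_mat D)"
  have F: "F \<in> carrier_mat p p"
    using AC U E by (auto simp: F_def)
  have UD: "U * inv_mat D \<in> carrier_mat p p"
    using U E by auto
  have 1: "A * (U * inv_mat D * transpose_mat U) = F * transpose_mat U"
    unfolding F_def by (rule assoc_mult_mat[OF AC UD UT, symmetric])
  have 2: "transpose_mat U * F = transpose_mat U * A * U * inv_mat D"
    unfolding F_def using AC U UT E(1) UD
    by (simp add: assoc_mult_mat[of _ p p _ p _ p])
  show ?thesis
  proof
    assume "inv_mat A = U * inv_mat D * transpose_mat U"
    then have "F * transpose_mat U = 1\<^sub>m p"
      using 1 T(2) by simp
    then have "transpose_mat U * F = 1\<^sub>m p"
      by (rule mat_mult_left_right_inverse[OF F UT])
    then have "transpose_mat U * A * U * inv_mat D * D = 1\<^sub>m p * D"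
      by (simp add: 2)
    then have "transpose_mat U * A * U * (inv_mat D * D) = D"
      using AC U UT E(1) DC by (simp add: assoc_mult_mat[of _ p p _ p _ p])
    then show "transpose_mat U * A * U = D"
      using AC U UT E(3) by simp
  next
    assume "transpose_mat U * A * U = D"
    then have "transpose_mat U * F = 1\<^sub>m p"
      by (simp add: 2 E)
    then have "F * transpose_mat U = 1\<^sub>m p"
      by (rule mat_mult_left_right_inverse[OF UT F])
    then show "inv_mat A = U * inv_mat D * transpose_mat U"
      using 1 AC U UT E(1) by (intro inv_mat_eqI) auto
  qed
qed

lemma congruence_entry:
  assumes "A \<in> carrier_mat p p" "U \<in> carrier_mat p p" "i < p" "j < p"
  shows "(transpose_mat U * A * U) $$ (i, j) = bil p (\<lambda>i j. A $$ (i, j)) (\<lambda>k. U $$ (k, i)) (\<lambda>k. U $$ (k, j))"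
proof -
  have "(transpose_mat U * A * U) $$ (i, j) = (transpose_mat U * (A * U)) $$ (i, j)"
    using assms by (subst assoc_mult_mat[of _ p p _ p _ p]) auto
  also have "\<dots> = (\<Sum>k<p. U $$ (k, i) * (\<Sum>l<p. A $$ (k, l) * U $$ (l, j)))"
    using assms by (simp add: scalar_prod_def lessThan_atLeast0)
  finally show ?thesis
    by (simp add: bil_def sum_distrib_left mult.assoc)
qed

text \<open>The columns \<open>u j\<close> of \<open>1 - L\<close> are residuals, and a diagonal
  congruence makes them mutually orthogonal. By triangularity the \<open>u k\<close> with
  \<open>k \<ge> i\<close> and the unit vectors from \<open>i\<close> on have the same span, so this
  amounts to the normal equations of column \<open>j\<close> against all later coordinates.\<close>

lemma LD_congruence_iff:
  fixes L D A :: "real mat"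
  assumes A: "pos_def p A" and L: "strictly_lower p L" and D: "D \<in> carrier_mat p p"
  defines "u \<equiv> \<lambda>j k. of_bool (k = j) - L $$ (k, j)" and "b \<equiv> bil p (\<lambda>i j. A $$ (i, j))"
  shows "pos_diag p D \<and> transpose_mat (1\<^sub>m p - L) * A * (1\<^sub>m p - L) = D \<longleftrightarrow>
    (\<forall>j<p. \<forall>i<p. j < i \<longrightarrow> b (unit_fun i) (u j) = 0) \<and>
    (\<forall>i<p. \<forall>j<p. D $$ (i, j) = (if i = j then b (u i) (u i) else 0))"
    (is "?l \<longleftrightarrow> ?r1 \<and> ?r2")
proof -
  have AC: "A \<in> carrier_mat p p" and LC: "L \<in> carrier_mat p p"
    using A L by (auto simp: pos_def_def strictly_lower_def)
  note pd = pos_def_pd_form[OF A]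
  have sym: "b x y = b y x" for x y
    unfolding b_def using pd by (intro bil_sym) (auto simp: pd_form_def)
  have L0: "L $$ (i, j) = 0" if "i < p" "j < p" "i \<le> j" for i j
    using L that by (auto simp: strictly_lower_def)
  have entry: "(transpose_mat (1\<^sub>m p - L) * A * (1\<^sub>m p - L)) $$ (i, j) = b (u i) (u j)" if "i < p" "j < p" for i j
    unfolding b_def using that LC
    by (subst congruence_entry[OF AC _ that]) (auto simp: u_def intro!: bil_cong)
  have pos: "0 < b (u i) (u i)" if "i < p" for i
  proof -
    have "u i i \<noteq> 0"
      using L0[OF that that] by (simp add: u_def)
    then show ?thesis
      using pd that unfolding pd_form_def b_def by blast
  qed
  show ?thesis
  proof
    assume l: ?l
    have uu: "b (u i) (u j) = D $$ (i, j)" if "i < p" "j < p" for i j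
      using entry[OF that] l by simp
    have "b (unit_fun i) (u j) = 0" if "j < i" "i < p" for i j
      using that
    \<comment> \<open>Downward induction on \<open>i\<close>: the unit vector at \<open>i\<close> is
      \<open>u i\<close> plus a combination of unit vectors at later indices.\<close>
    proof (induction "p - i" arbitrary: i rule: less_induct)
      case less
      have "b (unit_fun i) (u j) = b (\<lambda>k. u i k + L $$ (k, i)) (u j)"
        by (simp add: u_def)
      also have "\<dots> = b (u i) (u j) + b (\<lambda>k. L $$ (k, i)) (u j)"
        unfolding b_def by (rule bil_add_left)
      also have "b (\<lambda>k. L $$ (k, i)) (u j) = 0"
        unfolding b_def
      proof (rule bil_orthogonal_span)
        fix k assume "k < p" "L $$ (k, i) \<noteq> 0"
        then have "i < k" using L0[of k i] less.prems by force
        then show "bil p (\<lambda>i j. A $$ (i, j)) (unit_fun k) (u j) = 0"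
          using less.hyps[of k] less.prems \<open>k < p\<close> by (simp add: b_def)
      qed
      finally show ?case
        using uu[of i j] less.prems l by (auto simp: pos_diag_def)
    qed
    moreover have ?r2
      using uu l by (auto simp: pos_diag_def)
    ultimately show "?r1 \<and> ?r2" by blast
  next
    assume r: "?r1 \<and> ?r2"
    have lt: "b (u i) (u j) = 0" if "j < i" "i < p" for i j
      unfolding b_def
    proof (rule bil_orthogonal_span)
      fix k assume k: "k < p" "u i k \<noteq> 0"
      then have "i \<le> k" using L0[of k i] that by (cases "k = i") (auto simp: u_def intro: leI)
      then show "bil p (\<lambda>i j. A $$ (i, j)) (unit_fun k) (u j) = 0"
        using r k that by (simp add: b_def)
    qed
    have "transpose_mat (1\<^sub>m p - L) * A * (1\<^sub>m p - L) = D"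
    proof (rule eq_matI)
      fix i j assume "i < dim_row D" "j < dim_col D"
      then have ij: "i < p" "j < p" using D by auto
      have "b (u i) (u j) = D $$ (i, j)"
        using r ij lt[of i j] lt[of j i] sym[of "u i" "u j"] by (cases i j rule: linorder_cases) auto
      then show "(transpose_mat (1\<^sub>m p - L) * A * (1\<^sub>m p - L)) $$ (i, j) = D $$ (i, j)"
        using entry[OF ij] by simp
    qed (use D AC LC in auto)
    moreover have "pos_diag p D"
      using D r pos by (auto simp: pos_diag_def)
    ultimately show ?l by blast
  qed
qed

text \<open>Solving the normal equations for the coordinates after \<open>j\<close> produces a
  factorization, and uniqueness of the regression excludes any other, so the definite description in
  \<open>LD_factor\<close> denotes it.\<close>

lemma LD_factor_props:
  assumes S: "pos_def p S" and \<pi>: "\<pi> permutes {..<p}"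
  obtains L D where "LD_factor S \<pi> = (L, D)" "strictly_lower p L" "pos_diag p D"
    "\<And>i j. j < i \<Longrightarrow> i < p \<Longrightarrow>
      bil p (\<lambda>i j. S $$ (\<pi> i, \<pi> j)) (unit_fun i) (\<lambda>k. of_bool (k = j) - L $$ (k, j)) = 0"
    "\<And>j. j < p \<Longrightarrow> D $$ (j, j) =
      bil p (\<lambda>i j. S $$ (\<pi> i, \<pi> j)) (\<lambda>k. of_bool (k = j) - L $$ (k, j)) (\<lambda>k. of_bool (k = j) - L $$ (k, j))"
proof -
  have SC: "S \<in> carrier_mat p p" and dS: "dim_row S = p"
    using S by (auto simp: pos_def_def)
  define A where "A = perm_mat \<pi> S"
  have AC: "A \<in> carrier_mat p p" and Aij: "\<And>i j. i < p \<Longrightarrow> j < p \<Longrightarrow> A $$ (i, j) = S $$ (\<pi> i, \<pi> j)"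
    using SC by (auto simp: A_def perm_mat_def)
  let ?b = "bil p (\<lambda>i j. A $$ (i, j))"
  have b: "bil p (\<lambda>i j. S $$ (\<pi> i, \<pi> j)) u v = ?b u v" for u v
    by (rule bil_cong) (auto simp: Aij)
  have pd: "pd_form p (\<lambda>i j. S $$ (\<pi> i, \<pi> j))"
    using pd_form_permute[OF \<pi> pos_def_pd_form[OF S]] by simp
  then have pdA: "pd_form p (\<lambda>i j. A $$ (i, j))"
    by (simp add: pd_form_def b Aij)
  have A: "pos_def p A"
    using pdA by (rule pd_form_pos_def[OF AC])
  let ?u = "\<lambda>L j k. of_bool (k = j) - L $$ (k, j)"
  let ?P = "\<lambda>L D. strictly_lower p L \<and> pos_diag p D \<and>
       perm_mat \<pi> (inv_mat S) = (1\<^sub>m p - L) * inv_mat D * transpose_mat (1\<^sub>m p - L)"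
  have P_iff: "?P L D \<longleftrightarrow> strictly_lower p L \<and> D \<in> carrier_mat p p \<and>
     (\<forall>j<p. \<forall>i<p. j < i \<longrightarrow> ?b (unit_fun i) (?u L j) = 0) \<and>
     (\<forall>i<p. \<forall>j<p. D $$ (i, j) = (if i = j then ?b (?u L i) (?u L i) else 0))" for L D
  proof (cases "strictly_lower p L \<and> D \<in> carrier_mat p p")
    case True
    then have "1\<^sub>m p - L \<in> carrier_mat p p"
      by (auto simp: strictly_lower_def)
    then have "?P L D \<longleftrightarrow> pos_diag p D \<and> transpose_mat (1\<^sub>m p - L) * A * (1\<^sub>m p - L) = D"
      using inv_mat_factor_iff[OF A] True perm_mat_inv_mat[OF \<pi> S] by (auto simp: A_def)
    then show ?thesis
      using LD_congruence_iff[OF A, of L D] True by blast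
  qed (auto simp: pos_diag_def)
  have "\<exists>l. (\<forall>i. i \<notin> {j<..<p} \<longrightarrow> l i = 0) \<and> (\<forall>i\<in>{j<..<p}. ?b (unit_fun i) (\<lambda>k. unit_fun j k - l k) = 0)" for j
    by (rule regression_exists[OF pdA]) auto
  then obtain l where l: "\<And>j i. i \<notin> {j<..<p} \<Longrightarrow> l j i = 0"
      "\<And>j i. i \<in> {j<..<p} \<Longrightarrow> ?b (unit_fun i) (\<lambda>k. unit_fun j k - l j k) = 0"
    by metis
  define L where "L = mat p p (\<lambda>(i, j). l j i)"
  define D where "D = mat p p (\<lambda>(i, j). if i = j then ?b (?u L i) (?u L i) else 0)"
  have Lu: "?b x (?u L j) = ?b x (\<lambda>k. unit_fun j k - l j k)" if "j < p" for x j
    using that by (intro bil_cong) (auto simp: L_def)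
  have P: "?P L D"
    unfolding P_iff
  proof (intro conjI allI impI)
    show "strictly_lower p L"
      using l(1) by (auto simp: L_def strictly_lower_def)
    show "?b (unit_fun i) (?u L j) = 0" if "j < p" "i < p" "j < i" for i j
      unfolding Lu[OF that(1)] using l(2) that by auto
  qed (auto simp: D_def)
  have uniq: "L' = L \<and> D' = D" if "?P L' D'" for L' D'
  proof -
    note 1 = P[unfolded P_iff] and 2 = that[unfolded P_iff]
    have eq: "L' $$ (i, j) = L $$ (i, j)" if "i < p" "j < p" for i j
      by (rule regression_unique[OF pdA, of "{j<..<p}" "\<lambda>i. L' $$ (i, j)" "unit_fun j" "\<lambda>i. L $$ (i, j)"])
         (use 1 2 that in \<open>auto simp: strictly_lower_def\<close>)
    then have "L' = L"
      using 1 2 by (intro eq_matI) (auto simp: strictly_lower_def)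
    moreover from this have "D' = D"
      using 1 2 by (intro eq_matI) auto
    ultimately show ?thesis by blast
  qed
  have LD: "LD_factor S \<pi> = (L, D)"
    unfolding LD_factor_def Let_def dS
  proof (rule the_equality)
    show "case (L, D) of (L, D) \<Rightarrow> ?P L D"
      unfolding prod.case by (rule P)
    fix x :: "real mat \<times> real mat" assume "case x of (L, D) \<Rightarrow> ?P L D"
    then have "?P (fst x) (snd x)"
      by (simp only: case_prod_beta)
    from uniq[OF this] show "x = (L, D)"
      by (simp add: prod_eq_iff)
  qed
  show thesis
    using P P[unfolded P_iff] by (intro that[OF LD]) (auto simp: b)
qed

text \<open>In the original labels \<open>inv_into UNIV \<pi> i\<close> is the position of
  \<open>i\<close> in the ordering. Column \<open>j\<close> is thus the regression of coordinate
  \<open>j\<close> on the coordinates placed after it, and the trace is the sum of the residual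
  variances.\<close>

lemma B_tilde_props:
  assumes S: "pos_def p S" and \<pi>: "\<pi> permutes {..<p}"
  defines "r \<equiv> \<lambda>j k. of_bool (k = j) - B_tilde S \<pi> $$ (k, j)"
  shows "B_tilde S \<pi> \<in> carrier_mat p p"
    and "\<And>i j. i < p \<Longrightarrow> j < p \<Longrightarrow> B_tilde S \<pi> $$ (i, j) \<noteq> 0 \<Longrightarrow> inv_into UNIV \<pi> j < inv_into UNIV \<pi> i"
    and "\<And>i j. i < p \<Longrightarrow> j < p \<Longrightarrow> inv_into UNIV \<pi> j < inv_into UNIV \<pi> i \<Longrightarrow> bil p (\<lambda>i j. S $$ (i, j)) (unit_fun i) (r j) = 0"
    and "mat_trace (Omega_tilde S \<pi>) = (\<Sum>j<p. bil p (\<lambda>i j. S $$ (i, j)) (r j) (r j))"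
proof -
  obtain L D where LD: "LD_factor S \<pi> = (L, D)" "strictly_lower p L" "pos_diag p D"
    and orth: "\<And>i j. j < i \<Longrightarrow> i < p \<Longrightarrow>
      bil p (\<lambda>i j. S $$ (\<pi> i, \<pi> j)) (unit_fun i) (\<lambda>k. of_bool (k = j) - L $$ (k, j)) = 0"
    and diag: "\<And>j. j < p \<Longrightarrow> D $$ (j, j) =
      bil p (\<lambda>i j. S $$ (\<pi> i, \<pi> j)) (\<lambda>k. of_bool (k = j) - L $$ (k, j)) (\<lambda>k. of_bool (k = j) - L $$ (k, j))"
    using LD_factor_props[OF S \<pi>] by blast
  have C: "L \<in> carrier_mat p p" "D \<in> carrier_mat p p"
    using LD by (auto simp: strictly_lower_def pos_diag_def)
  have lt: "inv_into UNIV \<pi> i < p" if "i < p" for i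
    using permutes_in_image[OF permutes_inv[OF \<pi>], of i] that by simp
  have eq_iff: "inv_into UNIV \<pi> i = inv_into UNIV \<pi> j \<longleftrightarrow> i = j" for i j
    using permutes_inj[OF permutes_inv[OF \<pi>]] by (auto simp: inj_eq)
  have B: "B_tilde S \<pi> $$ (i, j) = L $$ (inv_into UNIV \<pi> i, inv_into UNIV \<pi> j)" if "i < p" "j < p" for i j
    using that C by (simp add: B_tilde_def LD perm_mat_def)
  show "B_tilde S \<pi> \<in> carrier_mat p p"
    using C by (simp add: B_tilde_def LD perm_mat_def)
  show "inv_into UNIV \<pi> j < inv_into UNIV \<pi> i" if "i < p" "j < p" "B_tilde S \<pi> $$ (i, j) \<noteq> 0" for i j
  proof (rule ccontr)
    assume "\<not> inv_into UNIV \<pi> j < inv_into UNIV \<pi> i"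
    then have "L $$ (inv_into UNIV \<pi> i, inv_into UNIV \<pi> j) = 0"
      using LD(2) lt[OF that(1)] lt[OF that(2)] by (simp add: strictly_lower_def)
    then show False
      using that(3) B[OF that(1,2)] by simp
  qed
  have r: "r j k = of_bool (inv_into UNIV \<pi> k = inv_into UNIV \<pi> j) - L $$ (inv_into UNIV \<pi> k, inv_into UNIV \<pi> j)" if "k < p" "j < p" for j k
    using B[OF that] by (simp add: r_def eq_iff)
  show "bil p (\<lambda>i j. S $$ (i, j)) (unit_fun i) (r j) = 0" if "i < p" "j < p" "inv_into UNIV \<pi> j < inv_into UNIV \<pi> i" for i j
  proof -
    have "0 = bil p (\<lambda>i j. S $$ (\<pi> i, \<pi> j)) (unit_fun (inv_into UNIV \<pi> i)) (\<lambda>k. of_bool (k = inv_into UNIV \<pi> j) - L $$ (k, inv_into UNIV \<pi> j))"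
      using orth[OF that(3) lt[OF that(1)]] by simp
    also have "\<dots> = bil p (\<lambda>i j. S $$ (i, j)) (\<lambda>k. unit_fun (inv_into UNIV \<pi> i) (inv_into UNIV \<pi> k))
        (\<lambda>k. of_bool (inv_into UNIV \<pi> k = inv_into UNIV \<pi> j) - L $$ (inv_into UNIV \<pi> k, inv_into UNIV \<pi> j))"
      by (rule bil_permute[OF \<pi>, where A = "\<lambda>i j. S $$ (i, j)"])
    also have "\<dots> = bil p (\<lambda>i j. S $$ (i, j)) (unit_fun i) (r j)"
      by (rule bil_cong) (auto simp: eq_iff r that)
    finally show ?thesis ..
  qed
  have "mat_trace (Omega_tilde S \<pi>) = (\<Sum>j<p. D $$ (inv_into UNIV \<pi> j, inv_into UNIV \<pi> j))"
    using C by (simp add: mat_trace_def Omega_tilde_def LD perm_mat_def)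
  also have "\<dots> = (\<Sum>j<p. bil p (\<lambda>i j. S $$ (i, j)) (r j) (r j))"
  proof (intro sum.cong refl)
    fix j assume "j \<in> {..<p}"
    then have j: "j < p" by simp
    have "D $$ (inv_into UNIV \<pi> j, inv_into UNIV \<pi> j) = bil p (\<lambda>i j. S $$ (i, j))
        (\<lambda>k. of_bool (inv_into UNIV \<pi> k = inv_into UNIV \<pi> j) - L $$ (inv_into UNIV \<pi> k, inv_into UNIV \<pi> j))
        (\<lambda>k. of_bool (inv_into UNIV \<pi> k = inv_into UNIV \<pi> j) - L $$ (inv_into UNIV \<pi> k, inv_into UNIV \<pi> j))"
      unfolding diag[OF lt[OF j]] by (rule bil_permute[OF \<pi>, where A = "\<lambda>i j. S $$ (i, j)"])
    also have "\<dots> = bil p (\<lambda>i j. S $$ (i, j)) (r j) (r j)"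
      by (rule bil_cong) (auto simp: r j)
    finally show "D $$ (inv_into UNIV \<pi> j, inv_into UNIV \<pi> j) = bil p (\<lambda>i j. S $$ (i, j)) (r j) (r j)" .
  qed
  finally show "mat_trace (Omega_tilde S \<pi>) = (\<Sum>j<p. bil p (\<lambda>i j. S $$ (i, j)) (r j) (r j))" .
qed

section \<open>The smallest eigenvalue\<close>

text \<open>Stated for semidefinite forms, because it is applied to \<open>S - t I\<close> with
  \<open>t\<close> the infimum of the Rayleigh quotient. If \<open>w\<close> has zero energy the
  quadratic in \<open>s\<close> becomes affine, and nonnegativity forces its slope to
  vanish.\<close>

lemma psd_cauchy_schwarz:
  assumes sym: "\<And>i j. i < p \<Longrightarrow> j < p \<Longrightarrow> A i j = A j i" and psd: "\<And>u. 0 \<le> bil p A u u"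
  shows "(bil p A u w)\<^sup>2 \<le> bil p A u u * bil p A w w"
proof -
  let ?a = "bil p A u u" and ?b = "bil p A u w" and ?c = "bil p A w w"
  have q: "0 \<le> ?a + 2 * s * ?b + s\<^sup>2 * ?c" for s
  proof -
    have "bil p A (\<lambda>i. u i + s * w i) (\<lambda>i. u i + s * w i) = ?a + 2 * s * ?b + s\<^sup>2 * ?c"
      using bil_sym[of p A, OF sym, of w u]
      by (simp add: bil_add_left bil_add_right bil_mult_left bil_mult_right power2_eq_square algebra_simps)
    then show ?thesis
      using psd[of "\<lambda>i. u i + s * w i"] by simp
  qed
  show ?thesis
  proof (cases "?c = 0")
    case True
    have "?b = 0"
    proof (rule ccontr)
      assume "?b \<noteq> 0"
      \<comment> \<open>This value of \<open>s\<close> makes the affine function equal to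
        \<open>- 1\<close>.\<close>
      then show False
        using q[of "- (?a + 1) / (2 * ?b)"] True by (simp add: field_simps)
    qed
    then show ?thesis using True by simp
  next
    case False
    then have c: "0 < ?c" using psd[of w] by simp
    \<comment> \<open>The quadratic in \<open>s\<close> is taken at its minimiser
      \<open>- ?b / ?c\<close>; the factor \<open>?c\<close> clears the denominators.\<close>
    have "0 \<le> ?c * (?a + 2 * (- ?b / ?c) * ?b + (- ?b / ?c)\<^sup>2 * ?c)"
      by (rule mult_nonneg_nonneg[OF less_imp_le[OF c] q])
    also have "\<dots> = ?a * ?c - ?b\<^sup>2"
      using False by (simp add: field_simps power2_eq_square)
    finally show ?thesis by simp
  qed
qed

lemma sum_abs_squared_le:
  fixes u :: "'a \<Rightarrow> real"
  assumes "finite I"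
  shows "(\<Sum>i\<in>I. \<bar>u i\<bar>)\<^sup>2 \<le> real (card I) * (\<Sum>i\<in>I. (u i)\<^sup>2)"
  using Cauchy_Schwarz_ineq_sum[of "\<lambda>_. 1" "\<lambda>i. \<bar>u i\<bar>" I] by simp

lemma finite_eigenvalues:
  fixes S :: "real mat"
  assumes "S \<in> carrier_mat p p"
  shows "finite {k. eigenvalue S k}"
proof -
  have "char_poly S \<noteq> 0"
    using degree_monic_char_poly[OF assms] by auto
  then show ?thesis
    using poly_roots_finite by (simp add: eigenvalue_root_char_poly[OF assms])
qed

lemma eigenvalue_pos:
  assumes "pos_def p S" "eigenvalue S k"
  shows "0 < k"
proof -
  obtain v where v: "v \<in> carrier_vec p" "v \<noteq> 0\<^sub>v p" "S *\<^sub>v v = k \<cdot>\<^sub>v v"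
    using assms by (auto simp: eigenvalue_def eigenvector_def pos_def_def)
  have "0 < k * (v \<bullet> v)"
    using assms(1) v by (auto simp: pos_def_def scalar_prod_smult_distrib)
  moreover have "0 \<le> v \<bullet> v"
    by (auto simp: scalar_prod_def intro: sum_nonneg)
  ultimately show ?thesis
    by (simp add: zero_less_mult_iff)
qed

text \<open>The infimum \<open>t\<close> of the Rayleigh quotient is an eigenvalue: otherwise \<open>S - t I\<close> is invertible
  with inverse \<open>T\<close>, and Cauchy--Schwarz for the form of \<open>S - t I\<close> applied to \<open>T u\<close> and \<open>u\<close> bounds this
  form below by a positive multiple of \<open>\<parallel>u\<parallel>\<^sup>2\<close>.\<close>
lemma lambda_min_props:
  assumes S: "pos_def p S" and p: "0 < p"
  shows "0 < lambda_min S" "lambda_min S * (\<Sum>i<p. (u i)\<^sup>2) \<le> bil p (\<lambda>i j. S $$ (i, j)) u u"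
proof -
  have SC: "S \<in> carrier_mat p p"
    using S by (simp add: pos_def_def)
  note pd = pos_def_pd_form[OF S]
  let ?q = "\<lambda>u. bil p (\<lambda>i j. S $$ (i, j)) u u"
  let ?s = "\<lambda>u. \<Sum>i<p. (u i)\<^sup>2"
  have s_pos: "0 < ?s u" if "\<exists>i<p. u i \<noteq> 0" for u :: "nat \<Rightarrow> real"
    using that by (auto intro: sum_pos2)
  define R where "R = {?q u / ?s u | u. \<exists>i<p. u i \<noteq> 0}"
  have memR: "?q u / ?s u \<in> R" if "\<exists>i<p. u i \<noteq> 0" for u
    unfolding R_def using that by (intro CollectI exI[of _ u] conjI refl)
  have R: "R \<noteq> {}" "bdd_below R"
  proof -
    have "\<exists>i<p. unit_fun 0 i \<noteq> (0::real)"
      using p by (intro exI[of _ 0]) simp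
    from memR[OF this] show "R \<noteq> {}"
      by (metis empty_iff)
    show "bdd_below R"
      by (rule bdd_belowI[of _ 0]) (auto simp: R_def intro!: divide_nonneg_nonneg pd_form_nonneg[OF pd] sum_nonneg)
  qed
  define t where "t = Inf R"
  have t: "t * ?s u \<le> ?q u" for u
  proof (cases "\<exists>i<p. u i \<noteq> 0")
    case True
    then have "t \<le> ?q u / ?s u"
      unfolding t_def by (intro cInf_lower R memR)
    then show ?thesis
      unfolding pos_le_divide_eq[OF s_pos[OF True]] .
  next
    case False
    then show ?thesis by (simp add: bil_def)
  qed
  define A where "A = mat p p (\<lambda>(i, j). S $$ (i, j) - t * of_bool (j = i))"
  let ?a = "bil p (\<lambda>i j. A $$ (i, j))"
  have AC: "A \<in> carrier_mat p p"
    by (simp add: A_def)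
  have Aq: "?a u u = ?q u - t * ?s u" for u
  proof -
    have "(\<Sum>j<p. u i * (t * of_bool (j = i)) * u j) = t * (u i)\<^sup>2" if "i < p" for i
    proof -
      have "u i * (t * of_bool (j = i)) * u j = (if j = i then t * (u i)\<^sup>2 else 0)" for j
        by (simp add: power2_eq_square)
      then show ?thesis using that by simp
    qed
    then have "bil p (\<lambda>i j. t * of_bool (j = i)) u u = t * ?s u"
      by (simp add: bil_def sum_distrib_left)
    moreover have "?a u u = bil p (\<lambda>i j. S $$ (i, j) - t * of_bool (j = i)) u u"
      by (rule bil_cong) (auto simp: A_def)
    ultimately show ?thesis
      by (simp add: bil_diff_form)
  qed
  have "det A = 0"
  proof (rule ccontr)
    assume "det A \<noteq> 0"
    note T = inv_mat_det[OF AC this]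
    define \<eta> where "\<eta> = 1 + (\<Sum>i<p. \<Sum>j<p. \<bar>inv_mat A $$ (i, j)\<bar>)"
    have \<eta>: "\<bar>inv_mat A $$ (i, j)\<bar> \<le> \<eta>" if "i < p" "j < p" for i j
    proof -
      have "\<bar>inv_mat A $$ (i, j)\<bar> \<le> (\<Sum>j<p. \<bar>inv_mat A $$ (i, j)\<bar>)"
        using that by (intro member_le_sum) auto
      also have "\<dots> \<le> (\<Sum>i<p. \<Sum>j<p. \<bar>inv_mat A $$ (i, j)\<bar>)"
        using that by (intro member_le_sum[of i _ "\<lambda>i. \<Sum>j<p. \<bar>inv_mat A $$ (i, j)\<bar>"]) (auto intro: sum_nonneg)
      finally show ?thesis by (simp add: \<eta>_def)
    qed
    have \<eta>0: "0 < \<eta>"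
      unfolding \<eta>_def by (intro add_pos_nonneg sum_nonneg) auto
    \<comment> \<open>The gap \<open>1 / (\<eta> * p)\<close> arises because the form of the inverse
      at \<open>u\<close> is at most \<open>\<eta> * p\<close> times the squared norm of
      \<open>u\<close>, by comparison of the absolute sum with the Euclidean norm.\<close>
    have lower: "t + 1 / (\<eta> * p) \<le> ?q u / ?s u" if u: "\<exists>i<p. u i \<noteq> 0" for u
    proof -
      define z where "z i = (\<Sum>j<p. inv_mat A $$ (i, j) * u j)" for i
      have Az: "(\<Sum>j<p. A $$ (i, j) * z j) = u i" if "i < p" for i
      proof -
        have "A *\<^sub>v (inv_mat A *\<^sub>v vec p u) = vec p u"
          using T by (subst assoc_mult_mat_vec[symmetric, OF AC T(1)]) auto
        then have "(A *\<^sub>v (inv_mat A *\<^sub>v vec p u)) $ i = u i"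
          using that by simp
        then show ?thesis
          using that AC T(1) by (simp add: scalar_prod_def z_def lessThan_atLeast0)
      qed
      have uz: "?a u z = ?s u"
      proof -
        have "?a u z = (\<Sum>i<p. u i * (\<Sum>j<p. A $$ (i, j) * z j))"
          by (simp add: bil_def sum_distrib_left mult.assoc)
        then show ?thesis
          by (simp add: Az power2_eq_square)
      qed
      have zz: "?a z z = bil p (\<lambda>i j. inv_mat A $$ (i, j)) u u"
      proof -
        have "?a z z = (\<Sum>i<p. z i * (\<Sum>j<p. A $$ (i, j) * z j))"
          by (simp add: bil_def sum_distrib_left mult.assoc)
        also have "\<dots> = (\<Sum>i<p. u i * z i)"
          by (intro sum.cong refl) (simp add: Az)
        finally show ?thesis
          by (simp add: bil_def z_def sum_distrib_left mult.assoc)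
      qed
      have "\<bar>?a z z\<bar> \<le> \<eta> * (\<Sum>i<p. \<bar>u i\<bar>) * (\<Sum>i<p. \<bar>u i\<bar>)"
        unfolding zz by (rule bil_abs_le) (rule \<eta>)
      then have "?a z z \<le> \<eta> * (\<Sum>i<p. \<bar>u i\<bar>) * (\<Sum>i<p. \<bar>u i\<bar>)"
        by (rule order_trans[OF abs_ge_self])
      also have "\<dots> = \<eta> * (\<Sum>i<p. \<bar>u i\<bar>)\<^sup>2"
        by (simp add: power2_eq_square mult.assoc)
      also have "\<dots> \<le> \<eta> * (p * ?s u)"
        using \<eta>0 sum_abs_squared_le[of "{..<p}" u] by (intro mult_left_mono) auto
      finally have zz_le: "?a z z \<le> \<eta> * (p * ?s u)" .
      have psd: "0 \<le> ?a w w" for w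
        unfolding Aq using t[of w] by simp
      have "(?s u)\<^sup>2 \<le> ?a u u * ?a z z"
        unfolding uz[symmetric]
      proof (rule psd_cauchy_schwarz[OF _ psd])
        show "A $$ (i, j) = A $$ (j, i)" if "i < p" "j < p" for i j
          using that pd by (auto simp: A_def pd_form_def)
      qed
      also have "\<dots> \<le> ?a u u * (\<eta> * (p * ?s u))"
        using zz_le psd by (intro mult_left_mono) auto
      finally have "?s u * ?s u \<le> (?a u u * (\<eta> * p)) * ?s u"
        by (simp add: power2_eq_square mult_ac)
      then have "?s u \<le> ?a u u * (\<eta> * p)"
        using s_pos[OF u] by (simp only: mult_le_cancel_right_pos)
      then have "?s u / (\<eta> * p) \<le> ?q u - t * ?s u"
        unfolding Aq using \<eta>0 p by (simp only: pos_divide_le_eq mult_pos_pos of_nat_0_less_iff)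
      then have "(t + 1 / (\<eta> * p)) * ?s u \<le> ?q u"
        by (simp add: algebra_simps)
      then show ?thesis
        unfolding pos_le_divide_eq[OF s_pos[OF u]] .
    qed
    have "t + 1 / (\<eta> * p) \<le> t"
      unfolding t_def
    proof (intro cInf_greatest R(1))
      fix x assume "x \<in> R"
      from this[unfolded R_def mem_Collect_eq] obtain u where u: "x = ?q u / ?s u \<and> (\<exists>i<p. u i \<noteq> 0)"
        by (rule exE)
      from conjunct1[OF u] conjunct2[OF u] show "Inf R + 1 / (\<eta> * p) \<le> x"
        using lower[of u] by (simp only: t_def)
    qed
    then show False
      using \<eta>0 p by (simp add: field_simps)
  qed
  then obtain v where v: "v \<in> carrier_vec p" "v \<noteq> 0\<^sub>v p" "A *\<^sub>v v = 0\<^sub>v p"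
    using det_0_iff_vec_prod_zero_field[OF AC] by auto
  have "S *\<^sub>v v = t \<cdot>\<^sub>v v"
  proof (rule eq_vecI)
    fix i assume "i < dim_vec (t \<cdot>\<^sub>v v)"
    then have i: "i < p" using v by simp
    have "0 = (\<Sum>j<p. A $$ (i, j) * v $ j)"
      using arg_cong[OF v(3), of "\<lambda>w. w $ i"] i AC v(1) by (simp add: scalar_prod_def lessThan_atLeast0)
    also have "\<dots> = (\<Sum>j<p. S $$ (i, j) * v $ j - (if j = i then t * v $ i else 0))"
      using i by (intro sum.cong) (auto simp: A_def algebra_simps)
    also have "\<dots> = (\<Sum>j<p. S $$ (i, j) * v $ j) - t * v $ i"
      using i by (simp add: sum_subtractf)
    finally show "(S *\<^sub>v v) $ i = (t \<cdot>\<^sub>v v) $ i"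
      using i SC v(1) by (simp add: scalar_prod_def lessThan_atLeast0)
  qed (use SC v in auto)
  then have ev: "eigenvalue S t"
    using v SC by (auto simp: eigenvalue_def eigenvector_def)
  have "lambda_min S \<le> t"
    unfolding lambda_min_def using finite_eigenvalues[OF SC] ev by (intro Min_le) auto
  then have "lambda_min S * ?s u \<le> t * ?s u"
    by (intro mult_right_mono sum_nonneg) auto
  with t[of u] show "lambda_min S * ?s u \<le> ?q u"
    by (rule order_trans[rotated])
  have "lambda_min S \<in> {k. eigenvalue S k}"
    unfolding lambda_min_def using finite_eigenvalues[OF SC] ev by (intro Min_in) auto
  then show "0 < lambda_min S"
    using eigenvalue_pos[OF S] by simp
qed

section \<open>Concave penalties\<close>

locale concave_penalty =
  fixes f :: "real \<Rightarrow> real" and D :: real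
  assumes concave: "concave_on {0..} f" and mono: "mono_on {0..} f" and f0: "f 0 = 0"
    and D: "(f has_real_derivative D) (at_right 0)" and D_pos: "0 < D"
begin

lemma nonneg: "0 \<le> x \<Longrightarrow> 0 \<le> f x"
  using mono f0 by (metis atLeast_iff mono_onD order_refl)

lemma le: "0 \<le> x \<Longrightarrow> x \<le> y \<Longrightarrow> f x \<le> f y"
  using mono by (auto intro: mono_onD)

lemma scale: "0 \<le> c \<Longrightarrow> c \<le> 1 \<Longrightarrow> 0 \<le> x \<Longrightarrow> c * f x \<le> f (c * x)"
  using concave_onD[OF concave, of c 0 x] f0 by simp

lemma half: "0 \<le> x \<Longrightarrow> f x \<le> 2 * f (x / 2)"
  using scale[of "1/2" x] by simp

text \<open>By \<open>scale\<close>, \<open>f x\<close> and \<open>f y\<close> each dominate their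
  proportional share of \<open>f (x + y)\<close>.\<close>

lemma subadditive:
  assumes "0 \<le> x" "0 \<le> y"
  shows "f (x + y) \<le> f x + f y"
proof (cases "x + y = 0")
  case False
  then have pos: "0 < x + y" using assms by simp
  have "x / (x + y) * f (x + y) \<le> f x" "y / (x + y) * f (x + y) \<le> f y"
    using scale[of "x / (x + y)" "x + y"] scale[of "y / (x + y)" "x + y"] pos assms by simp_all
  moreover have "x / (x + y) * f (x + y) + y / (x + y) * f (x + y) = f (x + y)"
    using pos by (simp add: distrib_right[symmetric] add_divide_distrib[symmetric] del: times_divide_eq_left)
  ultimately show ?thesis by simp
next
  case True
  then have "x = 0" "y = 0" using assms by auto
  then show ?thesis using f0 by simp
qed

text \<open>By \<open>scale\<close> the quotient \<open>f y / y\<close> does not decrease as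
  \<open>y\<close> shrinks, so its limit \<open>D\<close> at the origin dominates its value at
  \<open>x\<close>.\<close>

lemma linear_bound:
  assumes "0 \<le> x"
  shows "f x \<le> D * x"
proof (cases "x = 0")
  case False
  then have x: "0 < x" using assms by simp
  have lim: "((\<lambda>y. (f y - f 0) / (y - 0)) \<longlongrightarrow> D) (at_right 0)"
    using D by (simp add: has_field_derivative_iff)
  have ev: "\<forall>\<^sub>F y in at_right 0. f x / x \<le> (f y - f 0) / (y - 0)"
    using eventually_at_right_real[OF x]
  proof (rule eventually_mono)
    fix y assume "y \<in> {0<..<x}"
    then have y: "0 < y" "y < x" by auto
    then have "y / x * f x \<le> f y"
      using scale[of "y / x" x] x by simp
    then show "f x / x \<le> (f y - f 0) / (y - 0)"
      using y x f0 by (simp add: field_simps)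
  qed
  have "f x / x \<le> D"
    by (rule tendsto_lowerbound[OF lim ev]) simp
  then show ?thesis
    using x by (simp add: field_simps)
qed (simp add: f0)

lemma abs_add: "f \<bar>x + y\<bar> \<le> f \<bar>x\<bar> + D * \<bar>y\<bar>"
proof -
  have "f \<bar>x + y\<bar> \<le> f (\<bar>x\<bar> + \<bar>y\<bar>)"
    by (intro le) auto
  also have "\<dots> \<le> f \<bar>x\<bar> + f \<bar>y\<bar>"
    by (intro subadditive) auto
  also have "f \<bar>y\<bar> \<le> D * \<bar>y\<bar>"
    by (intro linear_bound) auto
  finally show ?thesis by simp
qed

end

lemma condition_R_concave_penalty:
  assumes "condition_R rho" "0 < lam"
  shows "concave_penalty (rho lam) (rho_d0 rho lam)"
proof
  have R: "concave_on {0..} (rho lam)" "mono_on {0..} (rho lam)" "rho lam 0 = 0"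
      "\<exists>D. (rho lam has_real_derivative D) (at_right 0)" "0 < rho_d0 rho lam"
    using assms by (auto simp: condition_R_def)
  then show "concave_on {0..} (rho lam)" "mono_on {0..} (rho lam)" "rho lam 0 = 0" "0 < rho_d0 rho lam"
    by auto
  obtain D where D: "(rho lam has_real_derivative D) (at_right 0)"
    using R by blast
  \<comment> \<open>One-sided limits at 0 are unique, so the definite description
    \<open>rho_d0\<close> denotes the right derivative.\<close>
  have "D' = D" if "(rho lam has_real_derivative D') (at_right 0)" for D'
    using tendsto_unique[OF _ that[unfolded has_field_derivative_iff] D[unfolded has_field_derivative_iff]] by simp
  then have "rho_d0 rho lam = D"
    unfolding rho_d0_def using D by (intro the_equality)
  then show "(rho lam has_real_derivative rho_d0 rho lam) (at_right 0)"
    using D by simp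
qed

section \<open>Deterministic bounds\<close>

definition resid :: "(nat \<Rightarrow> nat \<Rightarrow> real) \<Rightarrow> nat \<Rightarrow> nat \<Rightarrow> real" where
  "resid B j k = of_bool (k = j) - B k j"

definition loss :: "nat \<Rightarrow> (nat \<Rightarrow> nat \<Rightarrow> real) \<Rightarrow> (nat \<Rightarrow> nat \<Rightarrow> real) \<Rightarrow> real" where
  "loss p A B = (\<Sum>j<p. bil p A (resid B j) (resid B j))"

definition penalty :: "nat \<Rightarrow> (real \<Rightarrow> real) \<Rightarrow> (nat \<Rightarrow> nat \<Rightarrow> real) \<Rightarrow> real" where
  "penalty p f B = (\<Sum>i<p. \<Sum>j<p. f \<bar>B i j\<bar>)"

definition supp :: "nat \<Rightarrow> (nat \<Rightarrow> nat \<Rightarrow> real) \<Rightarrow> (nat \<times> nat) set" where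
  "supp p B = {(i, j). i < p \<and> j < p \<and> B i j \<noteq> 0}"

lemma supp_subset: "supp p B \<subseteq> {..<p} \<times> {..<p}"
  by (auto simp: supp_def)

lemma finite_supp: "finite (supp p B)"
  by (rule finite_subset[OF supp_subset]) simp

lemma penalty_pairs: "penalty p f B = (\<Sum>x\<in>{..<p} \<times> {..<p}. f \<bar>B (fst x) (snd x)\<bar>)"
  by (simp add: penalty_def sum.cartesian_product case_prod_beta)

lemma penalty_supp:
  assumes "f 0 = 0"
  shows "penalty p f B = (\<Sum>x\<in>supp p B. f \<bar>B (fst x) (snd x)\<bar>)"
  unfolding penalty_pairs using assms
  by (intro sum.mono_neutral_right supp_subset) (auto simp: supp_def)

lemma (in concave_penalty) penalty_ge_card:
  assumes "0 \<le> \<beta>" "\<And>i j. i < p \<Longrightarrow> j < p \<Longrightarrow> B i j \<noteq> 0 \<Longrightarrow> \<beta> \<le> \<bar>B i j\<bar>"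
  shows "real (card (supp p B)) * f \<beta> \<le> penalty p f B"
proof -
  have "(\<Sum>x\<in>supp p B. f \<beta>) \<le> (\<Sum>x\<in>supp p B. f \<bar>B (fst x) (snd x)\<bar>)"
    using assms by (intro sum_mono le) (auto simp: supp_def)
  then show ?thesis
    by (simp add: penalty_supp[of f, OF f0])
qed

lemma quadratic_form_step:
  assumes "\<And>i j. i < p \<Longrightarrow> j < p \<Longrightarrow> A i j = A j i"
  shows "bil p A (\<lambda>k. r k + c * \<delta> k) (\<lambda>k. r k + c * \<delta> k) =
    bil p A r r + 2 * c * bil p A r \<delta> + c\<^sup>2 * bil p A \<delta> \<delta>"
  using bil_sym[of p A, OF assms, of \<delta> r]
  by (simp add: bil_add_left bil_add_right bil_mult_left bil_mult_right power2_eq_square algebra_simps)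

text \<open>\<open>S\<close> is the population covariance with smallest eigenvalue at least \<open>\<mu>\<close>, \<open>H\<close> the empirical one,
  \<open>B\<close> a population regression matrix and \<open>Bh\<close> an estimate with the same admissible support.\<close>
locale perturbed_regression = concave_penalty f D for f D +
  fixes p :: nat and S H B Bh :: "nat \<Rightarrow> nat \<Rightarrow> real" and \<mu> \<eta> R :: real
  assumes S_sym: "\<And>i j. i < p \<Longrightarrow> j < p \<Longrightarrow> S i j = S j i"
    and H_sym: "\<And>i j. i < p \<Longrightarrow> j < p \<Longrightarrow> H i j = H j i"
    and \<mu>_pos: "0 < \<mu>" and \<mu>: "\<And>u. \<mu> * (\<Sum>i<p. (u i)\<^sup>2) \<le> bil p S u u"
    and \<eta>: "\<And>i j. i < p \<Longrightarrow> j < p \<Longrightarrow> \<bar>H i j - S i j\<bar> \<le> \<eta>"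
    and \<eta>_nonneg: "0 \<le> \<eta>" and \<eta>_small: "\<eta> * p \<le> \<mu> / 100"
    and R: "\<And>j. j < p \<Longrightarrow> (\<Sum>k<p. \<bar>resid B j k\<bar>) \<le> R" and R_nonneg: "0 \<le> R"
    and orth: "\<And>i j. i < p \<Longrightarrow> j < p \<Longrightarrow> B i j \<noteq> Bh i j \<Longrightarrow> bil p S (unit_fun i) (resid B j) = 0"
begin

text \<open>Indexed column first, so that \<open>\<Delta> j\<close> is the perturbation added to the
  \<open>j\<close>-th residual vector of \<open>B\<close>.\<close>

definition \<Delta> :: "nat \<Rightarrow> nat \<Rightarrow> real" where "\<Delta> j k = B k j - Bh k j"

text \<open>The Frobenius norm of \<open>B - Bh\<close>.\<close>

definition F :: real where "F = sqrt (\<Sum>j<p. \<Sum>k<p. (\<Delta> j k)\<^sup>2)"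

lemma F_nonneg: "0 \<le> F"
  by (simp add: F_def sum_nonneg)

lemma F_squared: "F\<^sup>2 = (\<Sum>j<p. \<Sum>k<p. (\<Delta> j k)\<^sup>2)"
  by (simp add: F_def sum_nonneg)

lemma F_squared_pairs: "F\<^sup>2 = (\<Sum>x\<in>{..<p} \<times> {..<p}. (\<Delta> (snd x) (fst x))\<^sup>2)"
  unfolding F_squared by (subst sum.swap) (simp add: sum.cartesian_product case_prod_beta)

lemma abs_sum_le_F:
  assumes "T \<subseteq> {..<p} \<times> {..<p}"
  shows "(\<Sum>x\<in>T. \<bar>\<Delta> (snd x) (fst x)\<bar>) \<le> sqrt (card T) * F"
proof -
  have T: "finite T" using assms finite_subset by blast
  have "(\<Sum>x\<in>T. \<bar>\<Delta> (snd x) (fst x)\<bar>)\<^sup>2 \<le> real (card T) * (\<Sum>x\<in>T. (\<Delta> (snd x) (fst x))\<^sup>2)"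
    by (rule sum_abs_squared_le[OF T])
  also have "\<dots> \<le> real (card T) * F\<^sup>2"
    unfolding F_squared_pairs using assms by (intro mult_left_mono sum_mono2) auto
  also have "\<dots> = (sqrt (card T) * F)\<^sup>2"
    by (simp add: power_mult_distrib)
  finally show ?thesis
    by (rule power2_le_imp_le) (simp add: F_nonneg)
qed

lemma abs_\<Delta>_le: "i < p \<Longrightarrow> j < p \<Longrightarrow> \<bar>\<Delta> j i\<bar> \<le> F"
  using abs_sum_le_F[of "{(i, j)}"] by simp

lemma resid_shift: "resid Bh j = (\<lambda>k. resid B j k + 1 * \<Delta> j k)"
  by (simp add: resid_def \<Delta>_def fun_eq_iff)

lemma quadratic_shift:
  "bil p H (\<lambda>k. resid B j k + c * \<Delta> j k) (\<lambda>k. resid B j k + c * \<Delta> j k) =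
    bil p H (resid B j) (resid B j) + 2 * c * bil p H (resid B j) (\<Delta> j) + c\<^sup>2 * bil p H (\<Delta> j) (\<Delta> j)"
  by (rule quadratic_form_step[OF H_sym])

text \<open>In the cross term the population part vanishes by \<open>orth\<close>, which leaves an
  error linear in \<open>\<Delta>\<close>. In the square the error is at most
  \<open>\<eta> * p\<close> times the squared norm, hence one percent of \<open>\<mu>\<close>. The
  weights \<open>a\<close> and \<open>b\<close> are free because the two comparisons below use
  different ones.\<close>

lemma quadratic_lower:
  assumes "0 \<le> a" "0 \<le> b"
  shows "b * (99 / 100 * \<mu>) * F\<^sup>2 - a * (\<eta> * R * p) * F \<le>
    (\<Sum>j<p. a * bil p H (resid B j) (\<Delta> j) + b * bil p H (\<Delta> j) (\<Delta> j))"
proof -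
  let ?n = "\<lambda>j. \<Sum>k<p. \<bar>\<Delta> j k\<bar>" and ?s = "\<lambda>j. \<Sum>k<p. (\<Delta> j k)\<^sup>2"
  have H_split: "bil p H u v = bil p S u v + bil p (\<lambda>i j. H i j - S i j) u v" for u v
    by (simp add: bil_diff_form)
  have cross: "- (\<eta> * R * ?n j) \<le> bil p H (resid B j) (\<Delta> j)" if j: "j < p" for j
  proof -
    have "bil p S (\<Delta> j) (resid B j) = 0"
    proof (rule bil_orthogonal_span)
      fix i assume i: "i < p" and "\<Delta> j i \<noteq> 0"
      then have "B i j \<noteq> Bh i j"
        by (simp add: \<Delta>_def)
      then show "bil p S (unit_fun i) (resid B j) = 0"
        by (rule orth[OF i j])
    qed
    then have "bil p S (resid B j) (\<Delta> j) = 0"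
      using bil_sym[of p S, OF S_sym, of "\<Delta> j" "resid B j"] by simp
    moreover have "\<bar>bil p (\<lambda>i j. H i j - S i j) (resid B j) (\<Delta> j)\<bar> \<le> \<eta> * (\<Sum>k<p. \<bar>resid B j k\<bar>) * ?n j"
      by (rule bil_abs_le) (rule \<eta>)
    moreover have "\<eta> * (\<Sum>k<p. \<bar>resid B j k\<bar>) * ?n j \<le> \<eta> * R * ?n j"
      using R[OF j] \<eta>_nonneg by (intro mult_right_mono mult_left_mono sum_nonneg) auto
    ultimately show ?thesis
      unfolding H_split by linarith
  qed
  have square: "99 / 100 * \<mu> * ?s j \<le> bil p H (\<Delta> j) (\<Delta> j)" if j: "j < p" for j
  proof -
    have "\<bar>bil p (\<lambda>i j. H i j - S i j) (\<Delta> j) (\<Delta> j)\<bar> \<le> \<eta> * ?n j * ?n j"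
      by (rule bil_abs_le) (rule \<eta>)
    also have "\<dots> = \<eta> * (?n j)\<^sup>2"
      by (simp add: power2_eq_square mult.assoc)
    also have "\<dots> \<le> \<eta> * (p * ?s j)"
      using sum_abs_squared_le[of "{..<p}" "\<Delta> j"] \<eta>_nonneg by (intro mult_left_mono) auto
    also have "\<dots> = (\<eta> * p) * ?s j"
      by simp
    also have "\<dots> \<le> \<mu> / 100 * ?s j"
      using \<eta>_small by (intro mult_right_mono sum_nonneg) auto
    finally show ?thesis
      unfolding H_split[of "\<Delta> j"] using \<mu>[of "\<Delta> j"] by linarith
  qed
  have n: "(\<Sum>j<p. ?n j) \<le> p * F"
  proof -
    have "(\<Sum>j<p. ?n j) = (\<Sum>x\<in>{..<p} \<times> {..<p}. \<bar>\<Delta> (snd x) (fst x)\<bar>)"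
      by (subst sum.swap) (simp add: sum.cartesian_product case_prod_beta)
    also have "\<dots> \<le> sqrt (card ({..<p} \<times> {..<p})) * F"
      by (rule abs_sum_le_F) simp
    finally show ?thesis by (simp add: real_sqrt_mult)
  qed
  have "b * (99 / 100 * \<mu>) * F\<^sup>2 - a * (\<eta> * R * p) * F \<le> b * (99 / 100 * \<mu>) * F\<^sup>2 - a * (\<eta> * R) * (\<Sum>j<p. ?n j)"
  proof -
    have "a * (\<eta> * R) * (\<Sum>j<p. ?n j) \<le> a * (\<eta> * R) * (p * F)"
      using n assms \<eta>_nonneg R_nonneg by (intro mult_left_mono) auto
    then show ?thesis by (simp add: mult_ac)
  qed
  also have "\<dots> = (\<Sum>j<p. a * (- (\<eta> * R * ?n j)) + b * (99 / 100 * \<mu> * ?s j))"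
  proof -
    have "(\<Sum>j<p. a * (- (c * x j)) + b * (e * y j)) = b * e * (\<Sum>j<p. y j) - a * c * (\<Sum>j<p. x j)" for c e x y
      by (simp add: sum.distrib sum_subtractf sum_negf sum_distrib_left mult.assoc)
    then show ?thesis
      unfolding F_squared by (simp only:)
  qed
  also have "\<dots> \<le> (\<Sum>j<p. a * bil p H (resid B j) (\<Delta> j) + b * bil p H (\<Delta> j) (\<Delta> j))"
    using assms cross square by (intro sum_mono add_mono mult_left_mono) auto
  finally show ?thesis .
qed

text \<open>Comparing \<open>Bh\<close> with the midpoint of \<open>Bh\<close> and \<open>B\<close> instead of \<open>B\<close> itself improves the constant
  of the basic inequality; this is what makes the bound uniform in \<open>a\<^sub>1 > 2\<close>.\<close>
lemma penalty_comparison: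
  assumes minimal: "loss p H Bh / 2 + penalty p f Bh \<le>
      loss p H (\<lambda>i j. (B i j + Bh i j) / 2) / 2 + penalty p f (\<lambda>i j. (B i j + Bh i j) / 2)"
    and \<beta>_pos: "0 < \<beta>" and \<beta>: "\<And>i j. i < p \<Longrightarrow> j < p \<Longrightarrow> B i j \<noteq> 0 \<Longrightarrow> \<beta> \<le> \<bar>B i j\<bar>"
    and signal: "supp p B \<noteq> {} \<Longrightarrow> 2 * D\<^sup>2 / \<mu> \<le> f \<beta>"
    and noise: "280 * (\<eta> * R * p) \<le> \<beta> * \<mu>"
  shows "penalty p f B \<le> 4 * penalty p f Bh"
proof (cases "supp p B = {}")
  case True
  have "0 \<le> penalty p f Bh"
    unfolding penalty_def by (intro sum_nonneg nonneg) auto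
  then show ?thesis
    using True by (simp add: penalty_supp[of f, OF f0])
next
  case False
  define q where "q = real (card (supp p B))"
  have q: "1 \<le> q"
    using False finite_supp[of p B] by (simp add: q_def Suc_le_eq card_gt_0_iff)
  let ?M = "\<lambda>i j. (B i j + Bh i j) / 2" and ?P = "{..<p} \<times> {..<p}"
  let ?d = "\<lambda>x. \<bar>\<Delta> (snd x) (fst x)\<bar>"
  have M: "resid ?M j = (\<lambda>k. resid B j k + 1 / 2 * \<Delta> j k)" for j
    by (simp add: resid_def \<Delta>_def fun_eq_iff field_simps)
  \<comment> \<open>From step length \<open>1 / 2\<close> to \<open>1\<close> the cross term gains
    \<open>2 - 1\<close> and the square \<open>1 - 1 / 4\<close>; both are halved.\<close>
  have "loss p H Bh / 2 - loss p H ?M / 2 =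
      (\<Sum>j<p. 1 / 2 * bil p H (resid B j) (\<Delta> j) + 3 / 8 * bil p H (\<Delta> j) (\<Delta> j))"
    unfolding loss_def resid_shift M quadratic_shift sum_divide_distrib sum_subtractf[symmetric]
    by (intro sum.cong refl) (simp add: power2_eq_square field_simps)
  with quadratic_lower[of "1 / 2" "3 / 8"]
  have basic: "3 / 8 * (99 / 100 * \<mu>) * F\<^sup>2 - 1 / 2 * (\<eta> * R * p) * F \<le> penalty p f ?M - penalty p f Bh"
    using minimal by simp
  have dT: "(\<Sum>x\<in>supp p B. ?d x) \<le> sqrt q * F"
    unfolding q_def by (rule abs_sum_le_F) (rule supp_subset)
  have split: "(\<Sum>x\<in>?P. (if x \<in> supp p B then ?d x else 0)) = (\<Sum>x\<in>supp p B. ?d x)"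
    using supp_subset[of p B] by (simp add: sum.If_cases Int_absorb1)
  \<comment> \<open>Off the support of \<open>B\<close> the midpoint halves the entry of
    \<open>Bh\<close>, so only the support is charged, with slope \<open>D\<close> over half the
    distance.\<close>
  have penM: "penalty p f ?M - penalty p f Bh \<le> D / 2 * (sqrt q * F)"
  proof -
    have "f \<bar>?M (fst x) (snd x)\<bar> - f \<bar>Bh (fst x) (snd x)\<bar> \<le> D / 2 * (if x \<in> supp p B then ?d x else 0)"
      if "x \<in> ?P" for x
    proof (cases "x \<in> supp p B")
      case True
      have "?M (fst x) (snd x) = Bh (fst x) (snd x) + \<Delta> (snd x) (fst x) / 2"
        by (simp add: \<Delta>_def field_simps)
      then have "f \<bar>?M (fst x) (snd x)\<bar> \<le> f \<bar>Bh (fst x) (snd x)\<bar> + D * \<bar>\<Delta> (snd x) (fst x) / 2\<bar>"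
        by (simp only: abs_add)
      moreover have "D * \<bar>\<Delta> (snd x) (fst x) / 2\<bar> = D / 2 * ?d x"
        by simp
      ultimately show ?thesis
        unfolding if_P[OF True] by argo
    next
      case False
      then have "B (fst x) (snd x) = 0"
        using that by (auto simp: supp_def)
      then have "f \<bar>?M (fst x) (snd x)\<bar> \<le> f \<bar>Bh (fst x) (snd x)\<bar>"
        by (intro le) auto
      then show ?thesis using False by simp
    qed
    then have "penalty p f ?M - penalty p f Bh \<le> (\<Sum>x\<in>?P. D / 2 * (if x \<in> supp p B then ?d x else 0))"
      unfolding penalty_pairs sum_subtractf[symmetric] by (rule sum_mono)
    also have "\<dots> = D / 2 * (\<Sum>x\<in>supp p B. ?d x)"
      by (simp only: sum_distrib_left[symmetric] split)
    also have "\<dots> \<le> D / 2 * (sqrt q * F)"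
      using dT D_pos by (intro mult_left_mono) auto
    finally show ?thesis .
  qed
  have penB: "penalty p f B - penalty p f Bh \<le> D * (sqrt q * F)"
  proof -
    have "f \<bar>B (fst x) (snd x)\<bar> - f \<bar>Bh (fst x) (snd x)\<bar> \<le> D * (if x \<in> supp p B then ?d x else 0)"
      if "x \<in> ?P" for x
    proof (cases "x \<in> supp p B")
      case True
      then show ?thesis
        using abs_add[of "Bh (fst x) (snd x)" "\<Delta> (snd x) (fst x)"] by (simp add: \<Delta>_def)
    next
      case False
      then have "B (fst x) (snd x) = 0"
        using that by (auto simp: supp_def)
      then show ?thesis using False f0 nonneg by simp
    qed
    then have "penalty p f B - penalty p f Bh \<le> (\<Sum>x\<in>?P. D * (if x \<in> supp p B then ?d x else 0))"
      unfolding penalty_pairs sum_subtractf[symmetric] by (rule sum_mono)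
    also have "\<dots> = D * (\<Sum>x\<in>supp p B. ?d x)"
      by (simp only: sum_distrib_left[symmetric] split)
    also have "\<dots> \<le> D * (sqrt q * F)"
      using dT D_pos by (intro mult_left_mono) auto
    finally show ?thesis .
  qed
  \<comment> \<open>\<open>g\<close> is the pull of the penalty slope over the support and
    \<open>h\<close> the sampling error; their ratio separates the two cases below.\<close>
  define g where "g = D * sqrt q"
  define h where "h = \<eta> * R * p"
  have g: "0 < g" and h: "0 \<le> h"
    using q D_pos \<eta>_nonneg R_nonneg by (auto simp: g_def h_def)
  have "297 / 400 * \<mu> * F * F \<le> (g + h) * F"
    using basic penM by (simp add: g_def h_def power2_eq_square algebra_simps)
  then have F: "297 / 400 * \<mu> * F \<le> g + h"
    using F_nonneg g h by (cases "F = 0") auto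
  show ?thesis
  \<comment> \<open>With negligible error, \<open>101 / 100 * 400 / 297\<close> is below
    \<open>137 / 100\<close>. The signal condition then bounds the penalty lost by
    \<open>137 / 200\<close> of the penalty of \<open>B\<close>; this is less than 3/4, which gives
    the factor 4.\<close>
  proof (cases "100 * h \<le> g")
    case True
    then have F': "\<mu> * F \<le> 137 / 100 * g"
      using F g by linarith
    have "\<mu> * (g * F) = g * (\<mu> * F)"
      by simp
    also have "\<dots> \<le> g * (137 / 100 * g)"
      using F' g by (intro mult_left_mono) auto
    also have "\<dots> = 137 / 100 * (q * D\<^sup>2)"
      using q by (simp add: g_def power2_eq_square)
    finally have "g * F \<le> 137 / 100 * (q * D\<^sup>2) / \<mu>"
      using \<mu>_pos by (simp add: pos_le_divide_eq mult_ac)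
    also have "\<dots> = 137 / 200 * (q * (2 * D\<^sup>2 / \<mu>))"
      by simp
    also have "\<dots> \<le> 137 / 200 * (q * f \<beta>)"
      using signal[OF False] q by (intro mult_left_mono) auto
    also have "\<dots> \<le> 137 / 200 * penalty p f B"
      using penalty_ge_card[of \<beta> p B] \<beta>_pos \<beta> by (intro mult_left_mono) (auto simp: q_def)
    finally have "penalty p f B - penalty p f Bh \<le> 137 / 200 * penalty p f B"
      using penB by (simp add: g_def mult_ac)
    moreover have "0 \<le> penalty p f B"
      unfolding penalty_def by (intro sum_nonneg nonneg) auto
    ultimately show ?thesis by linarith
  next
    case False
    \<comment> \<open>Here \<open>101 * 400 / 297\<close> is below 140, and \<open>noise\<close>
      makes \<open>F\<close> at most \<open>\<beta> / 2\<close>: every nonzero entry of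
      \<open>B\<close> keeps at least half of its size in \<open>Bh\<close>.\<close>
    then have "\<mu> * F \<le> 140 * h"
      using F g h by linarith
    also have "\<dots> \<le> \<mu> * (\<beta> / 2)"
      using noise by (simp add: h_def mult_ac)
    finally have F': "F \<le> \<beta> / 2"
      using \<mu>_pos by (simp only: mult_le_cancel_left_pos)
    have "f \<bar>B i j\<bar> \<le> 2 * f \<bar>Bh i j\<bar>" if "i < p" "j < p" for i j
    proof (cases "B i j = 0")
      case True
      then show ?thesis using f0 nonneg by simp
    next
      case False
      have "\<bar>B i j\<bar> / 2 \<le> \<bar>Bh i j\<bar>"
        using abs_\<Delta>_le[OF that] F' \<beta>[OF that False] by (simp add: \<Delta>_def)
      then have "f (\<bar>B i j\<bar> / 2) \<le> f \<bar>Bh i j\<bar>"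
        by (intro le) auto
      then show ?thesis
        using half[of "\<bar>B i j\<bar>"] by simp
    qed
    then have "penalty p f B \<le> 2 * penalty p f Bh"
      unfolding penalty_def sum_distrib_left by (intro sum_mono) auto
    moreover have "0 \<le> penalty p f Bh"
      unfolding penalty_def by (intro sum_nonneg nonneg) auto
    ultimately show ?thesis by linarith
  qed
qed

text \<open>The empirical loss of \<open>Bh\<close> is first compared with that of \<open>B\<close>,
  the population matrix with the ordering of \<open>Bh\<close>, at the price of the last summand.
  The population losses of \<open>B0\<close> and \<open>B\<close> then cancel by
  \<open>trace\<close> up to two relative errors \<open>\<tau>\<close>, each halved.\<close>

lemma penalty_upper:
  assumes basic: "loss p H Bh / 2 + penalty p f Bh \<le> loss p H B0 / 2 + penalty p f B0"
    and lower: "\<And>j. j < p \<Longrightarrow> (1 - \<tau>) * bil p S (resid B j) (resid B j) \<le> bil p H (resid B j) (resid B j)"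
    and upper: "\<And>j. j < p \<Longrightarrow> bil p H (resid B0 j) (resid B0 j) \<le> (1 + \<tau>) * bil p S (resid B0 j) (resid B0 j)"
    and trace: "loss p S B0 \<le> loss p S B" and "\<tau> \<le> 1"
  shows "penalty p f Bh \<le> penalty p f B0 + \<tau> * loss p S B0 + (\<eta> * R * p)\<^sup>2 / \<mu>"
proof -
  have "loss p H Bh / 2 - loss p H B / 2 =
      (\<Sum>j<p. 1 * bil p H (resid B j) (\<Delta> j) + 1 / 2 * bil p H (\<Delta> j) (\<Delta> j))"
    unfolding loss_def resid_shift quadratic_shift sum_divide_distrib sum_subtractf[symmetric]
    by (intro sum.cong refl) (simp add: field_simps)
  with quadratic_lower[of 1 "1 / 2"]
  have 1: "1 / 2 * (99 / 100 * \<mu>) * F\<^sup>2 - (\<eta> * R * p) * F \<le> loss p H Bh / 2 - loss p H B / 2"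
    by simp
  \<comment> \<open>Completing the square: the term linear in \<open>F\<close> costs the displayed
    constant and a quarter of \<open>\<mu> * F^2\<close>, for which \<open>99 / 200\<close> is
    available.\<close>
  have "0 \<le> ((\<eta> * R * p) - \<mu> * F / 2)\<^sup>2 / \<mu>"
    using \<mu>_pos by simp
  also have "\<dots> = (\<eta> * R * p)\<^sup>2 / \<mu> - (\<eta> * R * p) * F + \<mu> * F\<^sup>2 / 4"
    using \<mu>_pos by (simp add: power2_eq_square field_simps)
  finally have 2: "0 \<le> (\<eta> * R * p)\<^sup>2 / \<mu> - (\<eta> * R * p) * F + \<mu> * F\<^sup>2 / 4" .
  have 3: "0 \<le> \<mu> * F\<^sup>2"
    using \<mu>_pos by simp
  have "(1 - \<tau>) * loss p S B0 \<le> (1 - \<tau>) * loss p S B"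
    using trace \<open>\<tau> \<le> 1\<close> by (intro mult_left_mono) auto
  also have "\<dots> \<le> loss p H B"
    unfolding loss_def sum_distrib_left using lower by (intro sum_mono) auto
  finally have 4: "(1 - \<tau>) * loss p S B0 \<le> loss p H B" .
  have 5: "loss p H B0 \<le> (1 + \<tau>) * loss p S B0"
    unfolding loss_def sum_distrib_left using upper by (intro sum_mono) auto
  show ?thesis
    using 1 2 3 4 5 basic by (simp add: algebra_simps)
qed

end

section \<open>Matrices, orderings and test vectors\<close>

abbreviation entries :: "real mat \<Rightarrow> nat \<Rightarrow> nat \<Rightarrow> real" where
  "entries A \<equiv> \<lambda>i j. A $$ (i, j)"

definition gram :: "nat \<Rightarrow> (nat \<Rightarrow> nat \<Rightarrow> real) \<Rightarrow> nat \<Rightarrow> nat \<Rightarrow> real" where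
  "gram n \<omega> i j = (\<Sum>r<n. \<omega> r i * \<omega> r j) / real n"

lemma bil_gram: "bil p (gram n \<omega>) u u = (\<Sum>r<n. (\<Sum>j<p. u j * \<omega> r j)\<^sup>2) / real n"
proof -
  have "(\<Sum>r<n. (\<Sum>j<p. u j * \<omega> r j)\<^sup>2) = (\<Sum>r<n. \<Sum>i<p. \<Sum>j<p. u i * \<omega> r i * (u j * \<omega> r j))"
    by (simp add: power2_eq_square sum_product)
  also have "\<dots> = (\<Sum>i<p. \<Sum>r<n. \<Sum>j<p. u i * \<omega> r i * (u j * \<omega> r j))"
    by (rule sum.swap)
  also have "\<dots> = (\<Sum>i<p. \<Sum>j<p. \<Sum>r<n. u i * \<omega> r i * (u j * \<omega> r j))"
    by (intro sum.cong refl sum.swap)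
  finally show ?thesis
    by (simp add: bil_def gram_def sum_distrib_left sum_distrib_right sum_divide_distrib mult_ac)
qed

section \<open>The objective function and the orderings of acyclic graphs\<close>

lemma pen_eq_penalty:
  assumes "B \<in> carrier_mat p p"
  shows "pen rho lam B = penalty p (rho lam) (entries B)"
  using assms by (auto simp: pen_def penalty_def)

text \<open>Column \<open>j\<close> of \<open>X - X * B\<close> is the data matrix applied to the
  residual vector of column \<open>j\<close>, so the least-squares term is a sum of quadratic forms
  of the empirical covariance.\<close>

lemma Qfun_eq_loss:
  assumes B: "B \<in> carrier_mat p p"
  shows "Qfun rho lam (data_mat n p \<omega>) B = loss p (gram n \<omega>) (entries B) / 2 + penalty p (rho lam) (entries B)"
proof -
  let ?X = "data_mat n p \<omega>"
  have X: "?X \<in> carrier_mat n p" "dim_row ?X = n" "dim_col ?X = p"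
    by (auto simp: data_mat_def)
  have e: "(?X - ?X * B) $$ (r, j) = (\<Sum>k<p. resid (entries B) j k * \<omega> r k)" if "r < n" "j < p" for r j
  proof -
    have "(?X - ?X * B) $$ (r, j) = \<omega> r j - (\<Sum>k<p. \<omega> r k * B $$ (k, j))"
      using that B by (simp add: data_mat_def scalar_prod_def lessThan_atLeast0)
    also have "\<dots> = (\<Sum>k<p. (if k = j then \<omega> r k else 0) - \<omega> r k * B $$ (k, j))"
      using that by (simp add: sum_subtractf)
    also have "\<dots> = (\<Sum>k<p. resid (entries B) j k * \<omega> r k)"
      by (intro sum.cong refl) (auto simp: resid_def algebra_simps)
    finally show ?thesis .
  qed
  have "(\<Sum>r<n. \<Sum>j<p. ((?X - ?X * B) $$ (r, j))\<^sup>2) =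
      (\<Sum>j<p. \<Sum>r<n. (\<Sum>k<p. resid (entries B) j k * \<omega> r k)\<^sup>2)"
    by (subst sum.swap) (simp add: e)
  then show ?thesis
    by (simp add: Qfun_def X pen_eq_penalty[OF B] loss_def bil_gram sum_divide_distrib[symmetric])
qed

text \<open>Positions decrease along edges, so the edge relation lies in the converse of a
  well-founded relation.\<close>

lemma DAG_if_ordered:
  assumes "B \<in> carrier_mat p p"
    and "\<And>i j. i < p \<Longrightarrow> j < p \<Longrightarrow> B $$ (i, j) \<noteq> 0 \<Longrightarrow> (\<tau> j :: nat) < \<tau> i"
  shows "B \<in> DAG p"
proof -
  have "acyclic ((Wellfounded.measure \<tau>)\<inverse>)"
    using wf_acyclic[OF wf_measure] by simp
  then have "acyclic {(i, j). i < p \<and> j < p \<and> B $$ (i, j) \<noteq> 0}"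
    by (rule acyclic_subset) (auto simp: assms(2))
  then show ?thesis
    using assms(1) by (simp add: DAG_def)
qed

text \<open>\<open>lower_tri\<close> admits diagonal entries; acyclicity rules out self-loops and
  makes the inequality strict.\<close>

lemma Pi_hat_ordered:
  assumes "\<pi> \<in> Pi_hat p B" "i < p" "j < p" "B $$ (i, j) \<noteq> 0"
  shows "inv_into UNIV \<pi> j < inv_into UNIV \<pi> i"
proof -
  have \<pi>: "\<pi> permutes {..<p}" and BC: "B \<in> carrier_mat p p"
    and acyc: "acyclic {(i, j). i < p \<and> j < p \<and> B $$ (i, j) \<noteq> 0}"
    and low: "\<And>a b. a < p \<Longrightarrow> b < p \<Longrightarrow> a < b \<Longrightarrow> perm_mat \<pi> B $$ (a, b) = 0"
    using assms(1) by (auto simp: Pi_hat_def DAG_perm_def DAG_def lower_tri_def)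
  let ?\<tau> = "inv_into UNIV \<pi>"
  have lt: "?\<tau> k < p" if "k < p" for k
    using permutes_in_image[OF permutes_inv[OF \<pi>], of k] that by simp
  have \<pi>\<tau>: "\<pi> (?\<tau> k) = k" for k
    by (rule permutes_inverses(1)[OF \<pi>])
  have mem: "(i, j) \<in> {(i, j). i < p \<and> j < p \<and> B $$ (i, j) \<noteq> 0}"
    using assms by simp
  have "i \<noteq> j"
  proof
    assume "i = j"
    then have "(i, i) \<in> {(i, j). i < p \<and> j < p \<and> B $$ (i, j) \<noteq> 0}\<^sup>+"
      using r_into_trancl[OF mem] by simp
    then show False
      using acyc unfolding acyclic_def by (elim allE notE)
  qed
  then have "?\<tau> i \<noteq> ?\<tau> j"
    using \<pi>\<tau> by metis
  moreover have "\<not> ?\<tau> i < ?\<tau> j"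
  proof
    assume "?\<tau> i < ?\<tau> j"
    from low[OF lt[OF assms(2)] lt[OF assms(3)] this] have "B $$ (i, j) = 0"
      using BC lt assms by (simp add: perm_mat_def \<pi>\<tau>)
    then show False using assms(4) by simp
  qed
  ultimately show ?thesis by simp
qed

section \<open>Extremal quantities over all orderings\<close>

lemma finite_perm_index:
  "finite {f \<pi> j | \<pi> j. \<pi> permutes {..<(p::nat)} \<and> j < p \<and> P \<pi> j}"
proof -
  have "{f \<pi> j | \<pi> j. \<pi> permutes {..<p} \<and> j < p \<and> P \<pi> j} \<subseteq>
      (\<lambda>x. f (fst x) (snd x)) ` ({\<pi>. \<pi> permutes {..<p}} \<times> {..<p})"
    by force
  then show ?thesis
    by (rule finite_subset) (simp add: finite_permutations)
qed

lemma l0_col_le_d_Sigma: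
  assumes "dim_row S = p" "\<pi> permutes {..<p}" "j < p"
  shows "l0_col (B_tilde S \<pi>) j \<le> d_Sigma S"
  unfolding d_Sigma_def assms(1)
  using finite_perm_index[of "\<lambda>\<pi> j. l0_col (B_tilde S \<pi>) j" p "\<lambda>_ _. True"] assms(2,3)
  by (intro Max_ge) auto

lemma beta_min_vec_le:
  assumes "i < p" "v i \<noteq> 0"
  shows "0 < beta_min_vec p v" "beta_min_vec p v \<le> \<bar>v i\<bar>"
proof -
  have fin: "finite {\<bar>v i\<bar> | i. i < p \<and> v i \<noteq> 0}" and mem: "\<bar>v i\<bar> \<in> {\<bar>v i\<bar> | i. i < p \<and> v i \<noteq> 0}"
    using assms by auto
  show "beta_min_vec p v \<le> \<bar>v i\<bar>"
    unfolding beta_min_vec_def by (rule Min_le[OF fin mem])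
  have "Min {\<bar>v i\<bar> | i. i < p \<and> v i \<noteq> 0} \<in> {\<bar>v i\<bar> | i. i < p \<and> v i \<noteq> 0}"
    using mem by (intro Min_in[OF fin]) auto
  then show "0 < beta_min_vec p v"
    unfolding beta_min_vec_def by auto
qed

lemma finite_beta_min_set: "finite (beta_min_set S)"
  unfolding beta_min_set_def by (rule finite_perm_index)

lemma beta_min_Sigma_pos:
  assumes "beta_min_set S \<noteq> {}"
  shows "0 < beta_min_Sigma S"
proof -
  have "beta_min_Sigma S \<in> beta_min_set S"
    unfolding beta_min_Sigma_def using assms by (intro Min_in finite_beta_min_set)
  then show ?thesis
    unfolding beta_min_set_def by (auto intro: beta_min_vec_le(1))
qed

lemma beta_min_Sigma_le:
  assumes "dim_row S = p" "\<pi> permutes {..<p}" "i < p" "j < p" "B_tilde S \<pi> $$ (i, j) \<noteq> 0"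
  shows "beta_min_set S \<noteq> {}" "beta_min_Sigma S \<le> \<bar>B_tilde S \<pi> $$ (i, j)\<bar>"
proof -
  have mem: "beta_min_vec p (\<lambda>i. B_tilde S \<pi> $$ (i, j)) \<in> beta_min_set S"
    unfolding beta_min_set_def using assms by auto
  then show "beta_min_set S \<noteq> {}" by auto
  have "beta_min_Sigma S \<le> beta_min_vec p (\<lambda>i. B_tilde S \<pi> $$ (i, j))"
    unfolding beta_min_Sigma_def by (rule Min_le[OF finite_beta_min_set mem])
  also have "\<dots> \<le> \<bar>B_tilde S \<pi> $$ (i, j)\<bar>"
    using assms by (intro beta_min_vec_le)
  finally show "beta_min_Sigma S \<le> \<bar>B_tilde S \<pi> $$ (i, j)\<bar>" .
qed

text \<open>A set of at most \<open>d\<close> indices is listed and padded to length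
  \<open>d\<close> with the dummy value \<open>p\<close>, so words over \<open>p + 1\<close> letters
  cover all such sets.\<close>

lemma card_small_subsets_le:
  "card {T. T \<subseteq> {..<p} \<and> card T \<le> d} \<le> (p + 1) ^ d"
proof -
  let ?L = "{xs. set xs \<subseteq> {..p} \<and> length xs = d}"
  have "{T. T \<subseteq> {..<p} \<and> card T \<le> d} \<subseteq> (\<lambda>xs. set xs \<inter> {..<p}) ` ?L"
  proof
    fix T assume "T \<in> {T. T \<subseteq> {..<p} \<and> card T \<le> d}"
    then have T: "T \<subseteq> {..<p}" "card T \<le> d" "finite T"
      by (auto intro: finite_subset)
    let ?xs = "sorted_list_of_set T @ replicate (d - card T) p"
    have "?xs \<in> ?L" "T = set ?xs \<inter> {..<p}"
      using T by (auto simp: set_replicate_conv_if)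
    then show "T \<in> (\<lambda>xs. set xs \<inter> {..<p}) ` ?L"
      by blast
  qed
  moreover have "finite ?L"
    by (rule finite_lists_length_eq) simp
  ultimately have "card {T. T \<subseteq> {..<p} \<and> card T \<le> d} \<le> card ?L"
    by (meson card_image_le card_mono finite_imageI order_trans)
  also have "\<dots> = (p + 1) ^ d"
    by (simp add: card_lists_length_eq)
  finally show ?thesis .
qed

text \<open>The sums of unit vectors, with \<open>i = j\<close> included, recover the matrix entries
  by polarization. Residuals are set to zero from \<open>p\<close> on, so that they are determined
  as functions by their support; the conjunct \<open>True\<close> gives the second set the shape of
  \<open>finite_perm_index\<close>.\<close>

definition test_vectors :: "nat \<Rightarrow> real mat \<Rightarrow> (nat \<Rightarrow> real) set" where
  "test_vectors p S = {(\<lambda>k. unit_fun i k + unit_fun j k) | i j. i < p \<and> j < p} \<union>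
     {(\<lambda>k. if k < p then resid (entries (B_tilde S \<pi>)) j k else 0) | \<pi> j. \<pi> permutes {..<p} \<and> j < p \<and> True}"

lemma finite_test_vectors: "finite (test_vectors p S)"
  unfolding test_vectors_def
  by (intro finite_UnI finite_perm_index) (auto intro!: finite_image_set2)

lemma resid_diag:
  assumes "pos_def p S" "\<pi> permutes {..<p}" "j < p"
  shows "resid (entries (B_tilde S \<pi>)) j j = 1"
  using B_tilde_props(2)[OF assms(1,2,3,3)] by (auto simp: resid_def)

lemma test_vectors_pos:
  assumes S: "pos_def p S"
  shows "\<forall>v\<in>test_vectors p S. 0 < bil p (entries S) v v"
proof
  fix v assume v: "v \<in> test_vectors p S"
  have "\<exists>i<p. v i \<noteq> 0"
    using v unfolding test_vectors_def
  proof (elim UnE CollectE exE conjE)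
    fix i j assume "v = (\<lambda>k. unit_fun i k + unit_fun j k)" "i < p" "j < p"
    then show ?thesis by (intro exI[of _ i]) simp
  next
    fix \<pi> j assume "v = (\<lambda>k. if k < p then resid (entries (B_tilde S \<pi>)) j k else 0)" "\<pi> permutes {..<p}" "j < p"
    then show ?thesis
      using resid_diag[OF S, of \<pi> j] by (intro exI[of _ j]) simp
  qed
  then show "0 < bil p (entries S) v v"
    using pos_def_pd_form[OF S] unfolding pd_form_def by blast
qed

text \<open>A regression column is the regression on its own support, so that only supports need to be counted.\<close>
lemma card_test_vectors_le:
  assumes S: "pos_def p S"
  shows "card (test_vectors p S) \<le> p * p + p * (p + 1) ^ d_Sigma S"
proof -
  note pd = pos_def_pd_form[OF S]
  have dS: "dim_row S = p"
    using S by (auto simp: pos_def_def)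
  let ?T = "{T. T \<subseteq> {..<p} \<and> card T \<le> d_Sigma S}"
  have fT: "finite ?T" by simp
  \<comment> \<open>Intersecting with the index range makes the regression exist for every
    \<open>T\<close>, so one total choice function suffices.\<close>
  define l where "l j T = (SOME l. (\<forall>i. i \<notin> T \<inter> {..<p} \<longrightarrow> l i = 0) \<and>
    (\<forall>i\<in>T \<inter> {..<p}. bil p (entries S) (unit_fun i) (\<lambda>k. unit_fun j k - l k) = 0))" for j T
  have l: "(\<forall>i. i \<notin> T \<inter> {..<p} \<longrightarrow> l j T i = 0) \<and>
      (\<forall>i\<in>T \<inter> {..<p}. bil p (entries S) (unit_fun i) (\<lambda>k. unit_fun j k - l j T k) = 0)" for j T
    unfolding l_def by (rule someI_ex[OF regression_exists[OF pd Int_lower2, where v = "unit_fun j"]])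
  define g where "g x k = (if k < p then unit_fun (fst x) k - l (fst x) (snd x) k else 0)" for x k
  define V1 where "V1 = {(\<lambda>k. unit_fun i k + unit_fun j k) | i j. i < p \<and> j < p}"
  define V2 where "V2 = {(\<lambda>k. if k < p then resid (entries (B_tilde S \<pi>)) j k else 0) | \<pi> j. \<pi> permutes {..<p} \<and> j < p \<and> True}"
  have "V2 \<subseteq> g ` ({..<p} \<times> ?T)"
  proof
    fix v assume "v \<in> V2"
    then obtain \<pi> j where v: "v = (\<lambda>k. if k < p then resid (entries (B_tilde S \<pi>)) j k else 0)"
      and \<pi>: "\<pi> permutes {..<p}" and j: "j < p"
      unfolding V2_def by blast
    note B = B_tilde_props[OF S \<pi>]
    define T where "T = {i. i < p \<and> B_tilde S \<pi> $$ (i, j) \<noteq> 0}"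
    have "card T = l0_col (B_tilde S \<pi>) j"
      using B(1) by (simp add: T_def l0_col_def)
    then have T: "T \<in> ?T"
      using l0_col_le_d_Sigma[OF dS \<pi> j] by (auto simp: T_def)
    \<comment> \<open>Nonzero entries of the column belong to coordinates at later positions, to
      which the residual is orthogonal; hence the column solves the normal equations on its own
      support.\<close>
    have "B_tilde S \<pi> $$ (k, j) = l j T k" if "k < p" for k
    proof (rule regression_unique[OF pd, where T = T and v = "unit_fun j"])
      show "bil p (entries S) (unit_fun i) (\<lambda>k. unit_fun j k - B_tilde S \<pi> $$ (k, j)) = 0" if "i < p" "i \<in> T" for i
        using B(3)[OF that(1) j B(2)[OF that(1) j]] that(2) by (simp add: T_def)
    qed (use l[of T j] that in \<open>auto simp: T_def\<close>)
    then have "v = g (j, T)"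
      by (auto simp: v g_def resid_def fun_eq_iff)
    then show "v \<in> g ` ({..<p} \<times> ?T)"
      using j T by blast
  qed
  then have "card V2 \<le> card ({..<p} \<times> ?T)"
    using fT by (intro surj_card_le) auto
  also have "\<dots> \<le> p * (p + 1) ^ d_Sigma S"
    using card_small_subsets_le[of p "d_Sigma S"] by (simp add: card_cartesian_product)
  finally have "card V2 \<le> p * (p + 1) ^ d_Sigma S" .
  moreover have "card V1 \<le> card ({..<p} \<times> {..<p})"
  proof (rule surj_card_le)
    show "V1 \<subseteq> (\<lambda>x k. unit_fun (fst x) k + unit_fun (snd x) k) ` ({..<p} \<times> {..<p})"
      unfolding V1_def by force
  qed simp
  moreover have "card (test_vectors p S) \<le> card V1 + card V2"
    unfolding test_vectors_def V1_def V2_def by (rule card_Un_le)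
  ultimately show ?thesis
    by simp
qed

text \<open>This and \<open>resid_bound\<close> are sums that serve as crude upper bounds for
  maxima. They depend on \<open>S\<close> alone and influence only the required sample size.\<close>

definition form_bound :: "nat \<Rightarrow> real mat \<Rightarrow> real" where
  "form_bound p S = (\<Sum>i<p. \<Sum>j<p. bil p (entries S) (\<lambda>k. unit_fun i k + unit_fun j k) (\<lambda>k. unit_fun i k + unit_fun j k))"

definition resid_bound :: "nat \<Rightarrow> real mat \<Rightarrow> real" where
  "resid_bound p S = (\<Sum>\<pi>\<in>{\<pi>. \<pi> permutes {..<p}}. \<Sum>j<p. \<Sum>k<p. \<bar>resid (entries (B_tilde S \<pi>)) j k\<bar>)"

lemma double_sum_ge:
  fixes g :: "'a \<Rightarrow> 'b \<Rightarrow> real"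
  assumes "finite I" "finite J" "i \<in> I" "j \<in> J" "\<And>i j. i \<in> I \<Longrightarrow> j \<in> J \<Longrightarrow> 0 \<le> g i j"
  shows "g i j \<le> (\<Sum>i\<in>I. \<Sum>j\<in>J. g i j)"
proof -
  have "g i j \<le> (\<Sum>j\<in>J. g i j)"
    using assms by (intro member_le_sum) auto
  also have "\<dots> \<le> (\<Sum>i\<in>I. \<Sum>j\<in>J. g i j)"
    using assms by (intro member_le_sum[of i I "\<lambda>i. \<Sum>j\<in>J. g i j"] sum_nonneg) auto
  finally show ?thesis .
qed

lemma resid_sum_le:
  assumes "\<pi> permutes {..<p}" "j < p"
  shows "(\<Sum>k<p. \<bar>resid (entries (B_tilde S \<pi>)) j k\<bar>) \<le> resid_bound p S"
  unfolding resid_bound_def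
  by (rule double_sum_ge[where g = "\<lambda>\<pi> j. \<Sum>k<p. \<bar>resid (entries (B_tilde S \<pi>)) j k\<bar>"])
     (use assms in \<open>auto intro: sum_nonneg finite_permutations\<close>)

lemma resid_bound_nonneg: "0 \<le> resid_bound p S"
  unfolding resid_bound_def by (intro sum_nonneg) auto

lemma form_bound_nonneg: "pos_def p S \<Longrightarrow> 0 \<le> form_bound p S"
  unfolding form_bound_def by (intro sum_nonneg pd_form_nonneg pos_def_pd_form)

text \<open>For \<open>i = j\<close> the vector is twice a unit vector, so \<open>b i i\<close> is
  four times the diagonal entry; this explains the weights \<open>1 / 8\<close>.\<close>

lemma bil_polarization:
  assumes "\<And>i j. i < p \<Longrightarrow> j < p \<Longrightarrow> A i j = A j i" "i < p" "j < p"
  defines "b \<equiv> \<lambda>i j. bil p A (\<lambda>k. unit_fun i k + unit_fun j k) (\<lambda>k. unit_fun i k + unit_fun j k)"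
  shows "A i j = b i j / 2 - b i i / 8 - b j j / 8"
proof -
  have "b i j = A i i + 2 * A i j + A j j" if "i < p" "j < p" for i j
    unfolding b_def bil_add_left bil_add_right using assms(1)[OF that] that by (simp add: bil_unit_unit)
  then show ?thesis
    using assms(2,3) by (simp add: field_simps)
qed

text \<open>The polarization weights \<open>1 / 2\<close>, \<open>1 / 8\<close>,
  \<open>1 / 8\<close> add up to less than one, so the relative accuracy on the test vectors becomes
  an absolute accuracy of the entries.\<close>

lemma entries_close:
  assumes S: "pos_def p S" and H: "\<And>i j. i < p \<Longrightarrow> j < p \<Longrightarrow> H i j = H j i" and \<tau>: "0 \<le> \<tau>"
    and close: "\<forall>v\<in>test_vectors p S. \<bar>bil p H v v - bil p (entries S) v v\<bar> \<le> \<tau> * bil p (entries S) v v"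
    and ij: "i < p" "j < p"
  shows "\<bar>H i j - S $$ (i, j)\<bar> \<le> \<tau> * form_bound p S"
proof -
  note pd = pos_def_pd_form[OF S]
  let ?b = "\<lambda>A i j. bil p A (\<lambda>k. unit_fun i k + unit_fun j k) (\<lambda>k. unit_fun i k + unit_fun j k)"
  have c: "\<bar>?b H i j - ?b (entries S) i j\<bar> \<le> \<tau> * form_bound p S" if "i < p" "j < p" for i j
  proof -
    have "\<bar>?b H i j - ?b (entries S) i j\<bar> \<le> \<tau> * ?b (entries S) i j"
      using that by (intro bspec[OF close]) (auto simp: test_vectors_def)
    also have "\<dots> \<le> \<tau> * form_bound p S"
      unfolding form_bound_def using that \<tau>
      by (intro mult_left_mono double_sum_ge[where g = "?b (entries S)"] pd_form_nonneg[OF pd]) auto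
    finally show ?thesis .
  qed
  have "S $$ (i, j) = ?b (entries S) i j / 2 - ?b (entries S) i i / 8 - ?b (entries S) j j / 8"
    by (rule bil_polarization) (use pd ij in \<open>auto simp: pd_form_def\<close>)
  moreover have "H i j = ?b H i j / 2 - ?b H i i / 8 - ?b H j j / 8"
    by (rule bil_polarization) (use H ij in auto)
  ultimately show ?thesis
    using c[OF ij] c[OF ij(1) ij(1)] c[OF ij(2) ij(2)] by linarith
qed

section \<open>Both penalty inequalities on the event of accurate test vectors\<close>

lemma loss_cong:
  assumes "\<And>i j. i < p \<Longrightarrow> j < p \<Longrightarrow> B i j = B' i j"
  shows "loss p A B = loss p A B'"
  unfolding loss_def using assms by (intro sum.cong refl bil_cong) (auto simp: resid_def)

lemma penalty_cong:
  assumes "\<And>i j. i < p \<Longrightarrow> j < p \<Longrightarrow> B i j = B' i j"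
  shows "penalty p f B = penalty p f B'"
  unfolding penalty_def using assms by simp

lemma loss_eq_trace:
  assumes "pos_def p S" "\<pi> permutes {..<p}"
  shows "loss p (entries S) (entries (B_tilde S \<pi>)) = mat_trace (Omega_tilde S \<pi>)"
  unfolding loss_def B_tilde_props(4)[OF assms] by (simp add: resid_def[abs_def])

text \<open>Sampling accuracy enters only through \<open>close\<close>. The ordering
  \<open>\<pi>h\<close> depends on the data, which is harmless because the test vectors contain the
  residuals of every ordering.\<close>

lemma deterministic_bounds:
  assumes S: "pos_def p S" and p: "0 < p" and pen: "concave_penalty (rho lam) (rho_d0 rho lam)"
    and \<tau>: "0 \<le> \<tau>" "\<tau> \<le> 1"
    and \<tau>1: "\<tau> * (form_bound p S * p) \<le> lambda_min S / 100"
    and \<tau>2: "beta_min_set S \<noteq> {} \<longrightarrow>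
      \<tau> * (280 * (form_bound p S * resid_bound p S * p)) \<le> beta_min_Sigma S * lambda_min S"
    and \<tau>3: "\<tau> * (form_bound p S * resid_bound p S * p)\<^sup>2 \<le> (lambda_min S)\<^sup>2"
    and close: "\<forall>v\<in>test_vectors p S.
      \<bar>bil p (gram n \<omega>) v v - bil p (entries S) v v\<bar> \<le> \<tau> * bil p (entries S) v v"
    and signal: "beta_min_set S \<noteq> {} \<longrightarrow> 2 * (rho_d0 rho lam)\<^sup>2 / lambda_min S \<le> rho lam (beta_min_Sigma S)"
    and \<pi>0: "min_trace_perm S \<pi>0"
    and Bh: "global_min_Q rho lam (data_mat n p \<omega>) Bh" and \<pi>h: "\<pi>h \<in> Pi_hat p Bh"
  shows "penalty p (rho lam) (entries (B_tilde S \<pi>h)) \<le> 4 * penalty p (rho lam) (entries Bh)"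
    and "penalty p (rho lam) (entries Bh) \<le>
      penalty p (rho lam) (entries (B_tilde S \<pi>0)) + 2 * \<tau> * mat_trace (Omega_tilde S \<pi>0)"
proof -
  let ?f = "rho lam" and ?H = "gram n \<omega>" and ?\<mu> = "lambda_min S"
  let ?R = "resid_bound p S" and ?\<eta> = "\<tau> * form_bound p S"
  have dS: "dim_row S = p"
    using S by (auto simp: pos_def_def)
  note pd = pos_def_pd_form[OF S] and \<mu> = lambda_min_props[OF S p]
  have \<pi>h': "\<pi>h permutes {..<p}" and BhC: "Bh \<in> carrier_mat p p"
    using \<pi>h by (auto simp: Pi_hat_def DAG_perm_def DAG_def)
  have \<pi>0': "\<pi>0 permutes {..<p}"
    and min: "\<And>\<pi>. \<pi> permutes {..<p} \<Longrightarrow> mat_trace (Omega_tilde S \<pi>0) \<le> mat_trace (Omega_tilde S \<pi>)"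
    using \<pi>0 by (auto simp: min_trace_perm_def dS)
  note B = B_tilde_props[OF S \<pi>h'] and B0 = B_tilde_props[OF S \<pi>0']
  let ?B = "entries (B_tilde S \<pi>h)" and ?Bmin = "entries (B_tilde S \<pi>0)"
  have H_sym: "?H i j = ?H j i" for i j
    by (simp add: gram_def mult.commute)
  interpret perturbed_regression ?f "rho_d0 rho lam" p "entries S" ?H ?B "entries Bh" ?\<mu> ?\<eta> ?R
  proof (intro perturbed_regression.intro perturbed_regression_axioms.intro pen)
    show "entries S i j = entries S j i" if "i < p" "j < p" for i j
      using pd that by (auto simp: pd_form_def)
    show "\<bar>?H i j - entries S i j\<bar> \<le> ?\<eta>" if "i < p" "j < p" for i j
      using entries_close[OF S H_sym \<tau>(1) close that] by simp
    show "bil p (entries S) (unit_fun i) (resid ?B j) = 0" if "i < p" "j < p" "?B i j \<noteq> entries Bh i j" for i j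
    proof -
      \<comment> \<open>Where the matrices differ, at least one has an edge, and both are ordered by
        \<open>\<pi>h\<close>; hence \<open>i\<close> is among the regressors of
        \<open>j\<close>.\<close>
      have "B_tilde S \<pi>h $$ (i, j) \<noteq> 0 \<or> Bh $$ (i, j) \<noteq> 0"
        using that(3) by auto
      then have "inv_into UNIV \<pi>h j < inv_into UNIV \<pi>h i"
        using B(2)[OF that(1,2)] Pi_hat_ordered[OF \<pi>h that(1,2)] by blast
      from B(3)[OF that(1,2) this] show ?thesis
        by (simp add: resid_def[abs_def])
    qed
  qed (use \<mu> \<tau> \<tau>1 resid_sum_le[OF \<pi>h'] resid_bound_nonneg form_bound_nonneg[OF S] H_sym in \<open>auto simp: mult.assoc\<close>)
  have Q: "loss p ?H (entries Bh) / 2 + penalty p ?f (entries Bh) \<le> loss p ?H (entries C) / 2 + penalty p ?f (entries C)"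
    if "C \<in> DAG p" for C
  proof -
    have "Qfun rho lam (data_mat n p \<omega>) Bh \<le> Qfun rho lam (data_mat n p \<omega>) C"
      using Bh that by (auto simp: global_min_Q_def data_mat_def)
    then show ?thesis
      using that by (simp add: Qfun_eq_loss[OF BhC] Qfun_eq_loss[of C p] DAG_def)
  qed
  show "penalty p ?f ?B \<le> 4 * penalty p ?f (entries Bh)"
  proof -
    \<comment> \<open>The midpoint is an admissible competitor because both endpoints respect the
      same ordering.\<close>
    define C where "C = mat p p (\<lambda>(i, j). (?B i j + entries Bh i j) / 2)"
    have "C \<in> DAG p"
    proof (rule DAG_if_ordered)
      show "C \<in> carrier_mat p p" by (simp add: C_def)
      fix i j assume ij: "i < p" "j < p" and "C $$ (i, j) \<noteq> 0"
      then have "?B i j \<noteq> 0 \<or> entries Bh i j \<noteq> 0"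
        by (auto simp: C_def)
      then show "inv_into UNIV \<pi>h j < inv_into UNIV \<pi>h i"
        using B(2)[OF ij] Pi_hat_ordered[OF \<pi>h ij] by blast
    qed
    have C: "entries C i j = (?B i j + entries Bh i j) / 2" if "i < p" "j < p" for i j
      using that by (simp add: C_def)
    \<comment> \<open>If all coefficients of all orderings vanish, \<open>beta_min_Sigma\<close> is
      the minimum of an empty set; a positive number large enough for the noise condition then takes
      its place.\<close>
    define \<beta> where "\<beta> = (if beta_min_set S = {} then 280 * (?\<eta> * ?R * p) / ?\<mu> + 1 else beta_min_Sigma S)"
    show ?thesis
    proof (rule penalty_comparison[where \<beta> = \<beta>])
      show "loss p ?H (entries Bh) / 2 + penalty p ?f (entries Bh) \<le>
          loss p ?H (\<lambda>i j. (?B i j + entries Bh i j) / 2) / 2 + penalty p ?f (\<lambda>i j. (?B i j + entries Bh i j) / 2)"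
        using Q[OF \<open>C \<in> DAG p\<close>] loss_cong[of p "entries C", OF C] penalty_cong[of p "entries C", OF C] by simp
      show "0 < \<beta>"
        using beta_min_Sigma_pos[of S] \<mu>_pos \<eta>_nonneg R_nonneg
        by (auto simp: \<beta>_def intro!: add_nonneg_pos divide_nonneg_pos mult_nonneg_nonneg)
      show "\<beta> \<le> \<bar>?B i j\<bar>" if "i < p" "j < p" "?B i j \<noteq> 0" for i j
        using beta_min_Sigma_le[OF dS \<pi>h' that] by (simp add: \<beta>_def)
      show "280 * (?\<eta> * ?R * p) \<le> \<beta> * ?\<mu>"
      proof (cases "beta_min_set S = {}")
        case True
        then have "\<beta> * ?\<mu> = 280 * (?\<eta> * ?R * p) + ?\<mu>"
          using \<mu>_pos by (simp add: \<beta>_def field_simps)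
        then show ?thesis using \<mu>_pos by linarith
      next
        case False
        then show ?thesis
          using \<tau>2 by (simp add: \<beta>_def mult_ac)
      qed
      show "2 * (rho_d0 rho lam)\<^sup>2 / ?\<mu> \<le> ?f \<beta>" if ne: "supp p ?B \<noteq> {}"
      proof -
        obtain i j where "i < p" "j < p" "?B i j \<noteq> 0"
          using ne by (auto simp: supp_def)
        from beta_min_Sigma_le(1)[OF dS \<pi>h' this] show ?thesis
          using signal by (simp add: \<beta>_def)
      qed
    qed
  qed
  have test: "\<bar>bil p ?H (resid (entries (B_tilde S \<pi>)) j) (resid (entries (B_tilde S \<pi>)) j) -
        bil p (entries S) (resid (entries (B_tilde S \<pi>)) j) (resid (entries (B_tilde S \<pi>)) j)\<bar> \<le>
      \<tau> * bil p (entries S) (resid (entries (B_tilde S \<pi>)) j) (resid (entries (B_tilde S \<pi>)) j)"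
    if "\<pi> permutes {..<p}" "j < p" for \<pi> j
  proof -
    let ?r = "resid (entries (B_tilde S \<pi>)) j"
    have "(\<lambda>k. if k < p then ?r k else 0) \<in> test_vectors p S"
      using that unfolding test_vectors_def by blast
    moreover have "bil p A (\<lambda>k. if k < p then ?r k else 0) (\<lambda>k. if k < p then ?r k else 0) = bil p A ?r ?r" for A
      by (rule bil_cong) auto
    ultimately show ?thesis
      using bspec[OF close, of "\<lambda>k. if k < p then ?r k else 0"] by simp
  qed
  have "penalty p ?f (entries Bh) \<le> penalty p ?f ?Bmin + \<tau> * loss p (entries S) ?Bmin + (?\<eta> * ?R * p)\<^sup>2 / ?\<mu>"
  proof (rule penalty_upper)
    show "loss p ?H (entries Bh) / 2 + penalty p ?f (entries Bh) \<le> loss p ?H ?Bmin / 2 + penalty p ?f ?Bmin"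
      using DAG_if_ordered[OF B0(1,2)] by (intro Q)
    show "(1 - \<tau>) * bil p (entries S) (resid ?B j) (resid ?B j) \<le> bil p ?H (resid ?B j) (resid ?B j)" if "j < p" for j
      using test[OF \<pi>h' that] by (simp add: algebra_simps abs_le_iff)
    show "bil p ?H (resid ?Bmin j) (resid ?Bmin j) \<le> (1 + \<tau>) * bil p (entries S) (resid ?Bmin j) (resid ?Bmin j)" if "j < p" for j
      using test[OF \<pi>0' that] by (simp add: algebra_simps abs_le_iff)
    show "loss p (entries S) ?Bmin \<le> loss p (entries S) ?B"
      using min[OF \<pi>h'] by (simp add: loss_eq_trace[OF S] \<pi>h' \<pi>0')
  qed (use \<tau> in auto)
  \<comment> \<open>This error is of second order in \<open>\<tau>\<close>: \<open>\<tau>3\<close>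
    bounds it by \<open>\<tau> * lambda_min S\<close>, and the trace is at least
    \<open>lambda_min S\<close> because a residual vector has a coordinate equal to one.\<close>
  also have "(?\<eta> * ?R * p)\<^sup>2 / ?\<mu> \<le> \<tau> * loss p (entries S) ?Bmin"
  proof -
    have "?\<mu> * 1 \<le> ?\<mu> * (\<Sum>k<p. (resid ?Bmin 0 k)\<^sup>2)"
      using resid_diag[OF S \<pi>0' p] \<mu>_pos p
      by (intro mult_left_mono order_trans[OF _ member_le_sum[of 0 "{..<p}"]]) auto
    also have "\<dots> \<le> bil p (entries S) (resid ?Bmin 0) (resid ?Bmin 0)"
      by (rule \<mu>)
    also have "\<dots> \<le> loss p (entries S) ?Bmin"
      unfolding loss_def using p
      by (intro member_le_sum[of 0 "{..<p}" "\<lambda>j. bil p (entries S) (resid ?Bmin j) (resid ?Bmin j)"] pd_form_nonneg[OF pd]) auto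
    finally have \<mu>_le: "?\<mu> \<le> loss p (entries S) ?Bmin" by simp
    have "(?\<eta> * ?R * p)\<^sup>2 = \<tau> * (\<tau> * (form_bound p S * ?R * p)\<^sup>2)"
      by (simp add: power2_eq_square mult_ac)
    also have "\<dots> \<le> \<tau> * (?\<mu>)\<^sup>2"
      using \<tau>3 \<tau> by (intro mult_left_mono)
    also have "\<dots> = (\<tau> * ?\<mu>) * ?\<mu>"
      by (simp add: power2_eq_square)
    finally have "(?\<eta> * ?R * p)\<^sup>2 / ?\<mu> \<le> \<tau> * ?\<mu>"
      unfolding pos_divide_le_eq[OF \<mu>_pos] .
    also have "\<dots> \<le> \<tau> * loss p (entries S) ?Bmin"
      using \<mu>_le \<tau> by (intro mult_left_mono)
    finally show ?thesis .
  qed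
  finally show "penalty p ?f (entries Bh) \<le> penalty p ?f ?Bmin + 2 * \<tau> * mat_trace (Omega_tilde S \<pi>0)"
    by (simp add: loss_eq_trace[OF S \<pi>0'])
qed

lemma trace_pos:
  assumes S: "pos_def p S" and p: "0 < p" and \<pi>: "\<pi> permutes {..<p}"
  shows "0 < mat_trace (Omega_tilde S \<pi>)"
proof -
  have "0 < bil p (entries S) (resid (entries (B_tilde S \<pi>)) j) (resid (entries (B_tilde S \<pi>)) j)" if "j < p" for j
    using pos_def_pd_form[OF S] resid_diag[OF S \<pi> that] that unfolding pd_form_def by (metis zero_neq_one)
  then have "0 < loss p (entries S) (entries (B_tilde S \<pi>))"
    unfolding loss_def using p by (intro sum_pos) auto
  then show ?thesis
    by (simp add: loss_eq_trace[OF S \<pi>])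
qed

text \<open>For \<open>p \<ge> 2\<close> one has \<open>p + 1 \<le> p ^ 2\<close>, and the factor 2
  from adding the two families is at most \<open>p\<close>. The exponent \<open>2 * d + 3\<close> is
  rounded up to \<open>4 * (d + 1)\<close>, a multiple of the rate in the tail bound.\<close>

lemma real_card_test_vectors_le:
  assumes S: "pos_def p S" and p: "2 \<le> p"
  shows "real (card (test_vectors p S)) \<le> exp (4 * ((real (d_Sigma S) + 1) * ln (real p)))"
proof -
  let ?d = "d_Sigma S"
  have "(p + 1) ^ ?d \<le> (p ^ 2) ^ ?d"
  proof (rule power_mono)
    have "2 * p \<le> p * p" using p by (rule mult_le_mono1)
    then show "p + 1 \<le> p ^ 2" using p unfolding power2_eq_square by linarith
  qed simp
  then have "(p + 1) ^ ?d \<le> p ^ (2 * ?d)"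
    unfolding power_mult[symmetric] .
  then have "p * p + p * (p + 1) ^ ?d \<le> p ^ 2 + p * p ^ (2 * ?d)"
    unfolding power2_eq_square by (intro add_mono mult_le_mono le_refl)
  also have "p ^ 2 + p * p ^ (2 * ?d) \<le> p ^ (2 * ?d + 2) + p ^ (2 * ?d + 2)"
    using p by (intro add_mono power_increasing) (auto simp flip: power_Suc intro!: power_increasing)
  also have "\<dots> = 2 * p ^ (2 * ?d + 2)"
    by (rule mult_2[symmetric])
  also have "\<dots> \<le> p * p ^ (2 * ?d + 2)"
    using p by (rule mult_le_mono1)
  also have "\<dots> = p ^ (2 * ?d + 3)"
    by (simp add: numeral_3_eq_3)
  also have "\<dots> \<le> p ^ (4 * (?d + 1))"
    using p by (intro power_increasing) auto
  finally have "card (test_vectors p S) \<le> p ^ (4 * (?d + 1))"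
    using card_test_vectors_le[OF S] by linarith
  then have "real (card (test_vectors p S)) \<le> real (p ^ (4 * (?d + 1)))"
    by (rule of_nat_mono)
  also have "\<dots> = exp (real (4 * (?d + 1)) * ln (real p))"
    using p unfolding exp_of_nat_mult by simp
  also have "real (4 * (?d + 1)) * ln (real p) = 4 * ((real ?d + 1) * ln (real p))"
    by simp
  finally show ?thesis .
qed

section \<open>Choice of constants\<close>

lemma small_multiple:
  fixes c e :: real
  assumes "0 \<le> c" "0 < e"
  shows "\<exists>\<tau>0>0. \<forall>\<tau>. 0 \<le> \<tau> \<longrightarrow> \<tau> \<le> \<tau>0 \<longrightarrow> \<tau> * c \<le> e"
proof (intro exI[of _ "e / (c + 1)"] conjI allI impI)
  show "0 < e / (c + 1)"
    using assms by (intro divide_pos_pos) auto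
  fix \<tau> assume "0 \<le> \<tau>" "\<tau> \<le> e / (c + 1)"
  then have "\<tau> * (c + 1) \<le> e"
    using assms by (simp add: pos_le_divide_eq)
  then show "\<tau> * c \<le> e"
    using \<open>0 \<le> \<tau>\<close> by (simp add: algebra_simps)
qed

text \<open>The 46 is twice the factor 23 of the sampling tolerance, and 4 is the constant of the
  first comparison. The absolute value keeps the constant positive for every real
  \<open>a2\<close>.\<close>

definition bound_const :: "real \<Rightarrow> real" where
  "bound_const a2 = 4 * (1 + 46 / \<bar>a2\<bar>)"

text \<open>\<open>\<bar>b'\<bar> + 1\<close> bounds \<open>b'\<close> and stays positive for every
  real \<open>b'\<close>.\<close>

definition l0_const :: "real \<Rightarrow> real \<Rightarrow> real" where
  "l0_const a2 b' = bound_const a2 * (\<bar>b'\<bar> + 1)"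

lemma bound_const_pos: "0 < bound_const a2"
  unfolding bound_const_def by (intro mult_pos_pos add_pos_nonneg) auto

lemma l0_const_pos: "0 < l0_const a2 b'"
  unfolding l0_const_def by (intro mult_pos_pos bound_const_pos) auto

lemma l0_mat_eq_card_supp:
  assumes "B \<in> carrier_mat p p"
  shows "l0_mat B = card (supp p (entries B))"
  using assms by (simp add: l0_mat_def supp_def)

text \<open>Collects the smallness conditions of the deterministic bounds into one threshold
  depending on \<open>S\<close> alone; the sample size constant is later read off from it.\<close>

lemma tolerance_exists:
  assumes S: "pos_def p S" and p: "0 < p"
  obtains \<tau>0 where "0 < \<tau>0" "\<tau>0 \<le> 1"
    "\<And>\<tau>. 0 \<le> \<tau> \<Longrightarrow> \<tau> \<le> \<tau>0 \<Longrightarrow> \<tau> * (form_bound p S * p) \<le> lambda_min S / 100"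
    "\<And>\<tau>. 0 \<le> \<tau> \<Longrightarrow> \<tau> \<le> \<tau>0 \<Longrightarrow> beta_min_set S \<noteq> {} \<longrightarrow>
      \<tau> * (280 * (form_bound p S * resid_bound p S * p)) \<le> beta_min_Sigma S * lambda_min S"
    "\<And>\<tau>. 0 \<le> \<tau> \<Longrightarrow> \<tau> \<le> \<tau>0 \<Longrightarrow> \<tau> * (form_bound p S * resid_bound p S * p)\<^sup>2 \<le> (lambda_min S)\<^sup>2"
proof -
  note \<mu> = lambda_min_props(1)[OF S p] and G = form_bound_nonneg[OF S] and R = resid_bound_nonneg[of p S]
  have c: "0 \<le> form_bound p S * p" "0 \<le> 280 * (form_bound p S * resid_bound p S * p)"
    using G R by auto
  \<comment> \<open>The conditional avoids the unspecified minimum of an empty set; the value 1 in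
    that case is arbitrary.\<close>
  have e: "0 < lambda_min S / 100" "0 < (lambda_min S)\<^sup>2"
      "0 < (if beta_min_set S = {} then 1 else beta_min_Sigma S * lambda_min S)"
    using beta_min_Sigma_pos[of S] \<mu> by auto
  obtain t1 where t1: "0 < t1"
    "\<forall>\<tau>. 0 \<le> \<tau> \<longrightarrow> \<tau> \<le> t1 \<longrightarrow> \<tau> * (form_bound p S * p) \<le> lambda_min S / 100"
    using small_multiple[OF c(1) e(1)] by (elim exE conjE)
  obtain t2 where t2: "0 < t2"
    "\<forall>\<tau>. 0 \<le> \<tau> \<longrightarrow> \<tau> \<le> t2 \<longrightarrow> \<tau> * (280 * (form_bound p S * resid_bound p S * p)) \<le>
      (if beta_min_set S = {} then 1 else beta_min_Sigma S * lambda_min S)"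
    using small_multiple[OF c(2) e(3)] by (elim exE conjE)
  obtain t3 where t3: "0 < t3"
    "\<forall>\<tau>. 0 \<le> \<tau> \<longrightarrow> \<tau> \<le> t3 \<longrightarrow> \<tau> * (form_bound p S * resid_bound p S * p)\<^sup>2 \<le> (lambda_min S)\<^sup>2"
    using small_multiple[OF zero_le_power2[of "form_bound p S * resid_bound p S * p"] e(2)] by (elim exE conjE)
  show thesis
  proof (rule that[of "min 1 (min t1 (min t2 t3))"])
    show "beta_min_set S \<noteq> {} \<longrightarrow>
        \<tau> * (280 * (form_bound p S * resid_bound p S * p)) \<le> beta_min_Sigma S * lambda_min S"
      if "0 \<le> \<tau>" "\<tau> \<le> min 1 (min t1 (min t2 t3))" for \<tau>
      using t2(2)[rule_format, of \<tau>] that by (auto split: if_splits)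
  qed (use t1 t2(1) t3 in auto)
qed

text \<open>The factor 23 makes \<open>real n * \<tau>^2 / 100\<close> equal to
  \<open>5.29 * x\<close>, which exceeds the exponent \<open>4 * x\<close> of the cardinality bound
  by more than \<open>x\<close>.\<close>

lemma design_event:
  assumes S: "pos_def p S" and G: "gaussian_design M n S" and p: "2 \<le> p" and n: "0 < n"
  defines "x \<equiv> (real (d_Sigma S) + 1) * ln (real p)"
  defines "\<tau> \<equiv> 23 * sqrt (x / real n)"
  assumes \<tau>1: "\<tau> \<le> 1"
  shows "\<exists>A\<in>sets M. measure M A \<ge> 1 - 2 * exp (- x) \<and>
    (\<forall>\<omega>\<in>A. \<forall>v\<in>test_vectors p S.
      \<bar>bil p (gram n \<omega>) v v - bil p (entries S) v v\<bar> \<le> \<tau> * bil p (entries S) v v)"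
proof -
  have x: "0 \<le> x"
    using p by (simp add: x_def)
  then have \<tau>0: "0 \<le> \<tau>"
    by (simp add: \<tau>_def)
  have n\<tau>: "real n * \<tau>\<^sup>2 = 529 * x"
    using n x by (simp add: \<tau>_def power_mult_distrib)
  obtain A where A: "A \<in> sets M"
      "measure M A \<ge> 1 - real (card (test_vectors p S)) * (2 * exp (- real n * \<tau>\<^sup>2 / 100))"
    and close: "\<forall>\<omega>\<in>A. \<forall>v\<in>test_vectors p S.
      (\<Sum>i<n. (\<Sum>j<p. v j * \<omega> i j)\<^sup>2) \<le> real n * bil p (entries S) v v * (1 + \<tau>) \<and>
      real n * bil p (entries S) v v * (1 - \<tau>) \<le> (\<Sum>i<n. (\<Sum>j<p. v j * \<omega> i j)\<^sup>2)"
    using gaussian_design_event[OF S G finite_test_vectors test_vectors_pos[OF S] \<tau>0 \<tau>1]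
    by (elim bexE conjE)
  have "real (card (test_vectors p S)) * (2 * exp (- real n * \<tau>\<^sup>2 / 100)) \<le> exp (4 * x) * (2 * exp (- 529 * x / 100))"
    using real_card_test_vectors_le[OF S p] n\<tau> by (intro mult_mono) (auto simp: x_def)
  also have "\<dots> = 2 * exp (4 * x + - 529 * x / 100)"
    unfolding exp_add by simp
  also have "\<dots> \<le> 2 * exp (- x)"
    using x by simp
  finally have "measure M A \<ge> 1 - 2 * exp (- x)"
    using A(2) by linarith
  moreover have "\<bar>bil p (gram n \<omega>) v v - bil p (entries S) v v\<bar> \<le> \<tau> * bil p (entries S) v v"
    if "\<omega> \<in> A" "v \<in> test_vectors p S" for \<omega> v
  proof -
    let ?s = "\<Sum>i<n. (\<Sum>j<p. v j * \<omega> i j)\<^sup>2" and ?b = "bil p (entries S) v v"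
    have "?s / real n \<le> ?b * (1 + \<tau>)" "?b * (1 - \<tau>) \<le> ?s / real n"
      using bspec[OF bspec[OF close that(1)] that(2)] n by (simp_all add: pos_divide_le_eq pos_le_divide_eq mult_ac)
    then show ?thesis
      unfolding bil_gram by (simp add: algebra_simps abs_le_iff)
  qed
  ultimately show ?thesis
    using A(1) by blast
qed

text \<open>The hypothesis \<open>trace\<close> converts the error
  \<open>46 * s * mat_trace (Omega_tilde S \<pi>0)\<close> into \<open>46 / a2\<close> times the
  penalty at \<open>\<pi>0\<close>. For the count, a nonzero entry at \<open>\<pi>h\<close> costs at
  least the squared slope over \<open>lambda_min S\<close>, while one at \<open>\<pi>0\<close> costs
  at most \<open>b' * lam^2\<close>.\<close>

lemma normalized_bounds:
  assumes S: "pos_def p S" and p: "0 < p" and pen: "concave_penalty (rho lam) (rho_d0 rho lam)" and lam: "0 < lam"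
    and a1: "2 < a1" and a2: "0 < a2"
    and signal: "beta_min_set S \<noteq> {} \<longrightarrow> rho lam (beta_min_Sigma S) \<ge> a1 * (rho_d0 rho lam)\<^sup>2 / lambda_min S"
    and trace: "pen rho lam (B_tilde S \<pi>0) / mat_trace (Omega_tilde S \<pi>0) \<ge> a2 * s"
    and \<pi>0: "\<pi>0 permutes {..<p}" and \<pi>h: "\<pi>h permutes {..<p}" and Bh: "Bh \<in> carrier_mat p p"
    and 1: "penalty p (rho lam) (entries (B_tilde S \<pi>h)) \<le> 4 * penalty p (rho lam) (entries Bh)"
    and 2: "penalty p (rho lam) (entries Bh) \<le>
      penalty p (rho lam) (entries (B_tilde S \<pi>0)) + 2 * (23 * s) * mat_trace (Omega_tilde S \<pi>0)"
  shows "pen rho lam (B_tilde S \<pi>h) \<le> bound_const a2 * pen rho lam Bh"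
    and "pen rho lam Bh \<le> bound_const a2 * pen rho lam (B_tilde S \<pi>0)"
    and "l0_compatible rho b' \<Longrightarrow> real (l0_mat (B_tilde S \<pi>h)) \<le>
      l0_const a2 b' * lambda_min S * lam\<^sup>2 / (rho_d0 rho lam)\<^sup>2 * real (l0_mat (B_tilde S \<pi>0))"
proof -
  interpret concave_penalty "rho lam" "rho_d0 rho lam" by (rule pen)
  let ?D = "rho_d0 rho lam" and ?\<mu> = "lambda_min S"
  let ?h = "penalty p (rho lam) (entries (B_tilde S \<pi>h))"
    and ?min = "penalty p (rho lam) (entries (B_tilde S \<pi>0))" and ?est = "penalty p (rho lam) (entries Bh)"
  have dS: "dim_row S = p"
    using S by (auto simp: pos_def_def)
  note C = B_tilde_props(1)[OF S \<pi>h] B_tilde_props(1)[OF S \<pi>0]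
  note peneq = pen_eq_penalty[OF C(1)] pen_eq_penalty[OF C(2)] pen_eq_penalty[OF Bh]
  have nonneg': "0 \<le> penalty p (rho lam) B" for B
    unfolding penalty_def by (intro sum_nonneg nonneg) auto
  have "a2 * s * mat_trace (Omega_tilde S \<pi>0) \<le> ?min"
    using trace trace_pos[OF S p \<pi>0] by (simp add: peneq pos_le_divide_eq)
  then have "s * mat_trace (Omega_tilde S \<pi>0) \<le> ?min / a2"
    using a2 by (simp add: pos_le_divide_eq mult_ac)
  then have est: "?est \<le> (1 + 46 / a2) * ?min"
    using 2 by (simp add: algebra_simps)
  have c: "4 \<le> bound_const a2" "1 + 46 / a2 \<le> bound_const a2"
  proof -
    define y where "y = 46 / a2"
    have "0 < y" "bound_const a2 = 4 * (1 + y)"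
      using a2 by (simp_all add: y_def bound_const_def)
    then show "4 \<le> bound_const a2" "1 + 46 / a2 \<le> bound_const a2"
      unfolding y_def[symmetric] by simp_all
  qed
  show "pen rho lam (B_tilde S \<pi>h) \<le> bound_const a2 * pen rho lam Bh"
    unfolding peneq using 1 mult_right_mono[OF c(1) nonneg'[of "entries Bh"]] by linarith
  show "pen rho lam Bh \<le> bound_const a2 * pen rho lam (B_tilde S \<pi>0)"
    unfolding peneq using est mult_right_mono[OF c(2) nonneg'[of "entries (B_tilde S \<pi>0)"]] by linarith
  have h: "?h \<le> bound_const a2 * ?min"
  proof -
    have "bound_const a2 * ?min = 4 * ((1 + 46 / a2) * ?min)"
      using a2 by (simp add: bound_const_def)
    then show ?thesis
      using 1 est by linarith
  qed
  show "real (l0_mat (B_tilde S \<pi>h)) \<le>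
      l0_const a2 b' * ?\<mu> * lam\<^sup>2 / ?D\<^sup>2 * real (l0_mat (B_tilde S \<pi>0))" if b': "l0_compatible rho b'"
  proof -
    have b'0: "0 \<le> b'" and b'le: "\<And>x. 0 \<le> x \<Longrightarrow> rho lam x \<le> b' * lam\<^sup>2"
      using b' lam by (auto simp: l0_compatible_def)
    let ?q = "real (card (supp p (entries (B_tilde S \<pi>h))))" and ?r = "real (card (supp p (entries (B_tilde S \<pi>0))))"
    note \<mu> = lambda_min_props(1)[OF S p]
    have lower: "?q * (?D\<^sup>2 / ?\<mu>) \<le> ?h"
    proof (cases "beta_min_set S = {}")
      case True
      then have "supp p (entries (B_tilde S \<pi>h)) = {}"
        using beta_min_Sigma_le(1)[OF dS \<pi>h] by (auto simp: supp_def)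
      then show ?thesis
        using nonneg' by simp
    next
      case False
      have "1 * (?D\<^sup>2 / ?\<mu>) \<le> a1 * (?D\<^sup>2 / ?\<mu>)"
        using a1 \<mu> by (intro mult_right_mono) auto
      then have "?D\<^sup>2 / ?\<mu> \<le> rho lam (beta_min_Sigma S)"
        using signal False by simp
      then have "?q * (?D\<^sup>2 / ?\<mu>) \<le> ?q * rho lam (beta_min_Sigma S)"
        by (rule mult_left_mono) simp
      also have "\<dots> \<le> ?h"
        using beta_min_Sigma_pos[OF False] beta_min_Sigma_le(2)[OF dS \<pi>h] by (intro penalty_ge_card) auto
      finally show ?thesis .
    qed
    have "?min = (\<Sum>x\<in>supp p (entries (B_tilde S \<pi>0)). rho lam \<bar>entries (B_tilde S \<pi>0) (fst x) (snd x)\<bar>)"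
      by (rule penalty_supp) (rule f0)
    also have "\<dots> \<le> (\<Sum>x\<in>supp p (entries (B_tilde S \<pi>0)). b' * lam\<^sup>2)"
      by (intro sum_mono b'le) simp
    finally have upper: "?min \<le> b' * lam\<^sup>2 * ?r"
      by (simp add: mult_ac)
    have "?q * (?D\<^sup>2 / ?\<mu>) \<le> bound_const a2 * (b' * lam\<^sup>2 * ?r)"
      using lower h mult_left_mono[OF upper less_imp_le[OF bound_const_pos[of a2]]] by linarith
    also have "\<dots> \<le> bound_const a2 * ((\<bar>b'\<bar> + 1) * lam\<^sup>2 * ?r)"
      using bound_const_pos[of a2] by (intro mult_left_mono mult_right_mono) auto
    also have "\<dots> = (l0_const a2 b' * ?\<mu> * lam\<^sup>2 / ?D\<^sup>2 * ?r) * (?D\<^sup>2 / ?\<mu>)"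
      using \<mu> D_pos by (simp add: l0_const_def)
    finally have "?q \<le> l0_const a2 b' * ?\<mu> * lam\<^sup>2 / ?D\<^sup>2 * ?r"
      by (rule mult_right_le_imp_le) (use \<mu> D_pos in simp)
    then show ?thesis
      by (simp only: l0_mat_eq_card_supp[OF C(1)] l0_mat_eq_card_supp[OF C(2)])
  qed
qed

text \<open>Used to exclude \<open>d_Sigma S = 0\<close>: without edges in any ordering the penalty
  at \<open>\<pi>0\<close> would vanish, against its assumed positive ratio to the trace.\<close>

lemma pen_eq_0:
  assumes S: "pos_def p S" and \<pi>: "\<pi> permutes {..<p}" and d: "d_Sigma S = 0" and "rho lam 0 = 0"
  shows "pen rho lam (B_tilde S \<pi>) = 0"
proof -
  note C = B_tilde_props(1)[OF S \<pi>]
  have dS: "dim_row S = p"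
    using S by (auto simp: pos_def_def)
  have "B_tilde S \<pi> $$ (i, j) = 0" if "i < p" "j < p" for i j
  proof -
    have "l0_col (B_tilde S \<pi>) j = 0"
      using l0_col_le_d_Sigma[OF dS \<pi> that(2)] d by simp
    then show ?thesis
      using that C by (auto simp: l0_col_def)
  qed
  then show ?thesis
    unfolding pen_eq_penalty[OF C] penalty_def using assms(4) by simp
qed

lemma bounds_for_covariance:
  assumes S: "pos_def p S"
  shows "\<exists>C1>0. \<exists>C2>0.
     \<forall>(rho::real \<Rightarrow> real \<Rightarrow> real) (n::nat) (lam::real) (M::(nat \<Rightarrow> nat \<Rightarrow> real) measure)
        (a1::real) (a2::real) \<pi>0.
      condition_R rho \<longrightarrow> gaussian_design M n S \<longrightarrow>
      real n > C1 * real (d_Sigma S) * ln (real p) \<longrightarrow>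
      lam > 0 \<longrightarrow>
      lam \<ge> C2 * sqrt ((real (d_Sigma S) + 1) * ln (real p) / real n) \<longrightarrow>
      a1 > 2 \<longrightarrow>
      (beta_min_set S \<noteq> {} \<longrightarrow>
         rho lam (beta_min_Sigma S) \<ge> a1 * (rho_d0 rho lam)\<^sup>2 / lambda_min S) \<longrightarrow>
      a2 > 0 \<longrightarrow>
      min_trace_perm S \<pi>0 \<longrightarrow>
      pen rho lam (B_tilde S \<pi>0) / mat_trace (Omega_tilde S \<pi>0)
         \<ge> a2 * sqrt ((real (d_Sigma S) + 1) * ln (real p) / real n) \<longrightarrow>
      (\<exists>A \<in> sets M.
         measure M A \<ge> 1 - 2 * exp (- 1 * min (real n) ((real (d_Sigma S) + 1) * ln (real p))) \<and>
         (\<forall>\<omega> \<in> A. \<forall>Bh. global_min_Q rho lam (data_mat n p \<omega>) Bh \<longrightarrow>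
            (\<forall>\<pi>h \<in> Pi_hat p Bh.
               pen rho lam (B_tilde S \<pi>h) \<le> bound_const a2 * pen rho lam Bh \<and>
               pen rho lam Bh \<le> bound_const a2 * pen rho lam (B_tilde S \<pi>0) \<and>
               (\<forall>b'. l0_compatible rho b' \<longrightarrow>
                  real (l0_mat (B_tilde S \<pi>h)) \<le> l0_const a2 b' * lambda_min S *
                     lam\<^sup>2 / (rho_d0 rho lam)\<^sup>2 * real (l0_mat (B_tilde S \<pi>0))))))"
    (is "\<exists>C1>0. \<exists>C2>0. \<forall>rho n lam M a1 a2 \<pi>0. _ \<longrightarrow> _ \<longrightarrow> _ \<longrightarrow> _ \<longrightarrow> _ \<longrightarrow> _ \<longrightarrow> _ \<longrightarrow> _ \<longrightarrow> _ \<longrightarrow> _ \<longrightarrow> ?event rho n lam M a1 a2 \<pi>0")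
proof (cases "2 \<le> p")
  case False
  \<comment> \<open>In these dimensions \<open>ln (real p) = 0\<close>, using the convention
    \<open>ln 0 = 0\<close>. The required probability is then negative, and the empty event is
    enough.\<close>
  then have "p = 0 \<or> p = 1" by auto
  then have "ln (real p) = 0" by auto
  then have "1 - 2 * exp (- 1 * min (real n) ((real (d_Sigma S) + 1) * ln (real p))) \<le> 0" for n
    by simp
  then show ?thesis
    by (intro exI[of _ 1] conjI allI impI bexI[of _ "{}"]) auto
next
  case True
  then have p: "0 < p" and lnp: "0 < ln (real p)" by auto
  have dS: "dim_row S = p"
    using S by (auto simp: pos_def_def)
  obtain \<tau>0 where \<tau>0: "0 < \<tau>0" "\<tau>0 \<le> 1"
    "\<And>\<tau>. 0 \<le> \<tau> \<Longrightarrow> \<tau> \<le> \<tau>0 \<Longrightarrow> \<tau> * (form_bound p S * p) \<le> lambda_min S / 100"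
    "\<And>\<tau>. 0 \<le> \<tau> \<Longrightarrow> \<tau> \<le> \<tau>0 \<Longrightarrow> beta_min_set S \<noteq> {} \<longrightarrow>
      \<tau> * (280 * (form_bound p S * resid_bound p S * p)) \<le> beta_min_Sigma S * lambda_min S"
    "\<And>\<tau>. 0 \<le> \<tau> \<Longrightarrow> \<tau> \<le> \<tau>0 \<Longrightarrow> \<tau> * (form_bound p S * resid_bound p S * p)\<^sup>2 \<le> (lambda_min S)\<^sup>2"
    using tolerance_exists[OF S p] by blast
  \<comment> \<open>The factor 2 pays for \<open>d + 1 \<le> 2 * d\<close>, and the square is what
    brings \<open>23 * s\<close> below \<open>\<tau>0\<close>.\<close>
  define C1 where "C1 = 2 * (23 / \<tau>0)\<^sup>2"
  have C1: "0 < C1"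
    using \<tau>0(1) by (simp add: C1_def)
  show ?thesis
  proof (intro exI[of _ C1] exI[of _ 1] conjI C1 zero_less_one allI impI)
    fix rho n lam M a1 a2 \<pi>0
    assume R: "condition_R rho" and G: "gaussian_design M n S"
      and n: "real n > C1 * real (d_Sigma S) * ln (real p)" and lam: "0 < lam" and a1: "2 < a1"
      and signal: "beta_min_set S \<noteq> {} \<longrightarrow> rho lam (beta_min_Sigma S) \<ge> a1 * (rho_d0 rho lam)\<^sup>2 / lambda_min S"
      and a2: "0 < a2" and \<pi>0: "min_trace_perm S \<pi>0"
      and trace: "pen rho lam (B_tilde S \<pi>0) / mat_trace (Omega_tilde S \<pi>0)
        \<ge> a2 * sqrt ((real (d_Sigma S) + 1) * ln (real p) / real n)"
    define x where "x = (real (d_Sigma S) + 1) * ln (real p)"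
    define s where "s = sqrt (x / real n)"
    have x: "0 < x"
      using lnp by (simp add: x_def)
    have "0 \<le> C1 * real (d_Sigma S) * ln (real p)"
      using C1 lnp by simp
    then have n0: "0 < n"
      using n by simp
    have pen: "concave_penalty (rho lam) (rho_d0 rho lam)"
      by (rule condition_R_concave_penalty[OF R lam])
    interpret concave_penalty "rho lam" "rho_d0 rho lam" by (rule pen)
    have \<pi>0': "\<pi>0 permutes {..<p}"
      using \<pi>0 by (simp add: min_trace_perm_def dS)
    have s: "0 < s"
      using x n0 by (simp add: s_def)
    \<comment> \<open>The sample size condition controls \<open>(d + 1) * ln p\<close> only when
      \<open>d\<close> is at least 1.\<close>
    have "d_Sigma S \<noteq> 0"
    proof
      assume "d_Sigma S = 0"
      then have "a2 * s \<le> 0"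
        using trace pen_eq_0[OF S \<pi>0', of rho lam] f0 by (simp add: s_def x_def)
      then show False
        using mult_pos_pos[OF a2 s] by simp
    qed
    then have d: "1 \<le> real (d_Sigma S)" by simp
    have \<tau>: "23 * s \<le> \<tau>0"
    proof -
      have "x \<le> 2 * (real (d_Sigma S) * ln (real p))"
        using d lnp by (simp add: x_def algebra_simps)
      then have "C1 * x \<le> 2 * (C1 * real (d_Sigma S) * ln (real p))"
        using C1 by (simp add: algebra_simps)
      also have "\<dots> \<le> 2 * real n"
        using n by simp
      finally have "(23 / \<tau>0)\<^sup>2 * x \<le> real n"
        by (simp add: C1_def)
      then have "23\<^sup>2 * (x / real n) \<le> \<tau>0\<^sup>2"
        using n0 \<tau>0(1) by (simp add: power_divide field_simps)
      then have "(23 * s)\<^sup>2 \<le> \<tau>0\<^sup>2"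
        using x by (simp add: s_def power_mult_distrib)
      then show ?thesis
        by (rule power2_le_imp_le) (use \<tau>0(1) in simp)
    qed
    have \<tau>': "0 \<le> 23 * s" "23 * s \<le> 1"
      using s \<tau> \<tau>0(2) by auto
    obtain A where A: "A \<in> sets M" "measure M A \<ge> 1 - 2 * exp (- x)"
      and close: "\<forall>\<omega>\<in>A. \<forall>v\<in>test_vectors p S.
          \<bar>bil p (gram n \<omega>) v v - bil p (entries S) v v\<bar> \<le> 23 * s * bil p (entries S) v v"
      using design_event[OF S G True n0] \<tau>'(2) unfolding x_def s_def by blast
    have signal': "beta_min_set S \<noteq> {} \<longrightarrow> 2 * (rho_d0 rho lam)\<^sup>2 / lambda_min S \<le> rho lam (beta_min_Sigma S)"
    proof -
      have "2 * ((rho_d0 rho lam)\<^sup>2 / lambda_min S) \<le> a1 * ((rho_d0 rho lam)\<^sup>2 / lambda_min S)"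
        using a1 lambda_min_props(1)[OF S p] by (intro mult_right_mono) auto
      then show ?thesis
        using signal by auto
    qed
    show "?event rho n lam M a1 a2 \<pi>0"
    proof (intro bexI[OF _ A(1)] conjI ballI allI impI)
      have "exp (- x) \<le> exp (- 1 * min (real n) x)"
        by simp
      then show "measure M A \<ge> 1 - 2 * exp (- 1 * min (real n) ((real (d_Sigma S) + 1) * ln (real p)))"
        using A(2) unfolding x_def by linarith
      fix \<omega> Bh \<pi>h b'
      assume \<omega>: "\<omega> \<in> A" and Bh: "global_min_Q rho lam (data_mat n p \<omega>) Bh" and \<pi>h: "\<pi>h \<in> Pi_hat p Bh"
      have \<pi>h': "\<pi>h permutes {..<p}" and BhC: "Bh \<in> carrier_mat p p"
        using \<pi>h by (auto simp: Pi_hat_def DAG_perm_def DAG_def)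
      note det = deterministic_bounds[OF S p pen \<tau>' \<tau>0(3)[OF \<tau>'(1) \<tau>] \<tau>0(4)[OF \<tau>'(1) \<tau>] \<tau>0(5)[OF \<tau>'(1) \<tau>]
          bspec[OF close \<omega>] signal' \<pi>0 Bh \<pi>h]
      note c = normalized_bounds[OF S p pen lam a1 a2 signal trace[folded x_def, folded s_def] \<pi>0' \<pi>h' BhC det]
      show "pen rho lam (B_tilde S \<pi>h) \<le> bound_const a2 * pen rho lam Bh"
        by (rule c(1))
      show "pen rho lam Bh \<le> bound_const a2 * pen rho lam (B_tilde S \<pi>0)"
        by (rule c(2))
      show "real (l0_mat (B_tilde S \<pi>h)) \<le> l0_const a2 b' * lambda_min S *
          lam\<^sup>2 / (rho_d0 rho lam)\<^sup>2 * real (l0_mat (B_tilde S \<pi>0))" if "l0_compatible rho b'"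
        by (rule c(3)[OF that])
    qed
  qed
qed

theorem theorem4:
  shows "\<exists>c1>0. \<exists>c2>0. \<exists>K :: real \<Rightarrow> real \<Rightarrow> real. \<exists>K0 :: real \<Rightarrow> real \<Rightarrow> real \<Rightarrow> real.
   (\<forall>a1 a2. K a1 a2 > 0) \<and> (\<forall>a1 a2 b'. K0 a1 a2 b' > 0) \<and>
   (\<forall>(p::nat) (S::real mat). pos_def p S \<longrightarrow>
    (\<exists>C1>0. \<exists>C2>0.
     \<forall>(rho::real \<Rightarrow> real \<Rightarrow> real) (n::nat) (lam::real) (M::(nat \<Rightarrow> nat \<Rightarrow> real) measure)
        (a1::real) (a2::real) \<pi>0.
      condition_R rho \<longrightarrow> gaussian_design M n S \<longrightarrow>
      real n > C1 * real (d_Sigma S) * ln (real p) \<longrightarrow>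
      lam > 0 \<longrightarrow>
      lam \<ge> C2 * sqrt ((real (d_Sigma S) + 1) * ln (real p) / real n) \<longrightarrow>
      a1 > 2 \<longrightarrow>
      (beta_min_set S \<noteq> {} \<longrightarrow>
         rho lam (beta_min_Sigma S) \<ge> a1 * (rho_d0 rho lam)\<^sup>2 / lambda_min S) \<longrightarrow>
      a2 > 0 \<longrightarrow>
      min_trace_perm S \<pi>0 \<longrightarrow>
      pen rho lam (B_tilde S \<pi>0) / mat_trace (Omega_tilde S \<pi>0)
         \<ge> a2 * sqrt ((real (d_Sigma S) + 1) * ln (real p) / real n) \<longrightarrow>
      (\<exists>A \<in> sets M.
         measure M A \<ge> 1 - c1 * exp (- c2 * min (real n) ((real (d_Sigma S) + 1) * ln (real p))) \<and>
         (\<forall>\<omega> \<in> A. \<forall>Bh. global_min_Q rho lam (data_mat n p \<omega>) Bh \<longrightarrow>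
            (\<forall>\<pi>h \<in> Pi_hat p Bh.
               pen rho lam (B_tilde S \<pi>h) \<le> K a1 a2 * pen rho lam Bh \<and>
               pen rho lam Bh \<le> K a1 a2 * pen rho lam (B_tilde S \<pi>0) \<and>
               (\<forall>b'. l0_compatible rho b' \<longrightarrow>
                  real (l0_mat (B_tilde S \<pi>h)) \<le> K0 a1 a2 b' * lambda_min S *
                     lam\<^sup>2 / (rho_d0 rho lam)\<^sup>2 * real (l0_mat (B_tilde S \<pi>0))))))))"
  \<comment> \<open>The probability constants are 2, one for each tail, and 1, the part of the
    exponent left after the union bound.\<close>
  by (rule exI[of _ 2], rule conjI, simp, rule exI[of _ 1], rule conjI, simp,
      rule exI[of _ "\<lambda>a1 a2. bound_const a2"], rule exI[of _ "\<lambda>a1 a2 b'. l0_const a2 b'"])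
     (intro conjI allI impI bound_const_pos l0_const_pos bounds_for_covariance)

end
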